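(* There exists a polynomial-time $11$-approximation algorithm for the $(L,\{U_u\},\text{soft-}\emptyset,p)$-Supplier problem.
   Context: An instance of $(L,\{U_u\},\text{soft-}\emptyset,p)$-Supplier consists of an integer $p\ge0$, a finite client set $\mathcal{C}$, a finite facility set $\mathcal{F}$, a symmetric distance function $d:(\mathcal{C}\cup\mathcal{F})^2\to\mathbb{R}_{\ge0}$ satisfying the triangle inequality, a uniform lower bound $L\in\mathbb{Z}_{\ge0}$, and for each facility $u$ an upper bound $U_u\in\mathbb{Z}_{\ge0}$ with $L\le U_u$. A feasible solution consists of a client set $C\subseteq\mathcal{C}$ with $|C|\ge p$, a multiset $F$ of facilities of arbitrary size (soft capacities: a facility may be opened several times, each copy a separate center), and an assignment $\phi$ of each client in $C$ to an open copy such that every open copy of facility $u$ receives between $L$ and $U_u$ clients; its value is $\max_{v\in C}d(v,\phi(v))$, to be minimized. A $\rho$-approximation algorithm outputs, on every instance having a feasible solution, a feasible solution of value at most $\rho$ times the optimum. *)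

theory Defs
  imports
    Complex_Main
    "HOL-Library.Multiset"
    "HOL-Library.Log_Nat"
    "HOL-Computational_Algebra.Polynomial"
begin

record 'a supplier =
  clients :: "'a set"
  facilities :: "'a set"
  distance :: "'a \<Rightarrow> 'a \<Rightarrow> real"
  lower :: nat
  upper :: "'a \<Rightarrow> nat"
  quota :: nat

definition points :: "'a supplier \<Rightarrow> 'a set" where
  "points I = clients I \<union> facilities I"

text \<open>Clients and facilities may overlap, and \<open>distance I x x = 0\<close> is not required.\<close>

definition supplier_instance :: "'a supplier \<Rightarrow> bool" where
  "supplier_instance I \<longleftrightarrow>
     finite (clients I) \<and> finite (facilities I) \<and>
     (\<forall>x\<in>points I. \<forall>y\<in>points I. 0 \<le> distance I x y) \<and>
     (\<forall>x\<in>points I. \<forall>y\<in>points I. distance I x y = distance I y x) \<and>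
     (\<forall>x\<in>points I. \<forall>y\<in>points I. \<forall>z\<in>points I.
        distance I x z \<le> distance I x y + distance I y z) \<and>
     (\<forall>u\<in>facilities I. lower I \<le> upper I u)"

text \<open>The copies of a facility \<open>u\<close> in the multiset \<open>opened S\<close> are distinguished as the pairs
  \<open>(u, i)\<close> with \<open>i < count (opened S) u\<close>; clients are assigned to these pairs.\<close>

record 'a solution =
  served :: "'a set"
  opened :: "'a multiset"
  assigned :: "'a \<Rightarrow> 'a \<times> nat"

definition open_copies :: "'a solution \<Rightarrow> ('a \<times> nat) set" where
  "open_copies S = {(u, i). i < count (opened S) u}"

definition feasible :: "'a supplier \<Rightarrow> 'a solution \<Rightarrow> bool" where
  "feasible I S \<longleftrightarrow>
     served S \<subseteq> clients I \<and>
     quota I \<le> card (served S) \<and>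
     set_mset (opened S) \<subseteq> facilities I \<and>
     (\<forall>v\<in>served S. assigned S v \<in> open_copies S) \<and>
     (\<forall>(u, i)\<in>open_copies S.
        lower I \<le> card {v \<in> served S. assigned S v = (u, i)} \<and>
        card {v \<in> served S. assigned S v = (u, i)} \<le> upper I u)"

text \<open>A solution serving no client has value 0.\<close>

definition solution_value :: "'a supplier \<Rightarrow> 'a solution \<Rightarrow> real" where
  "solution_value I S =
     (if served S = {} then 0
      else Max ((\<lambda>v. distance I v (fst (assigned S v))) ` served S))"

definition optimum :: "'a supplier \<Rightarrow> real" where
  "optimum I = (INF S \<in> {S. feasible I S}. solution_value I S)"

text \<open>
  Programs are while programs over a random access memory that consists of zero-initialised
  arrays of natural numbers and zero-initialised arrays of reals. A scalar variable is cell 0 of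
  an array.

  Operations on natural numbers are charged by the bit length of their operands and results
  (the logarithmic cost criterion). Reals can only be copied, added, subtracted and compared, each
  at unit cost. Without multiplication or rounding, a run of length \<open>t\<close> produces only integer
  combinations, with coefficients of \<open>O(t)\<close> bits, of the real inputs. So on rational inputs a
  polynomial number of steps in this model is also polynomial time on a Turing machine.
\<close>

type_synonym mem = "(string \<Rightarrow> nat \<Rightarrow> nat) \<times> (string \<Rightarrow> nat \<Rightarrow> real)"

datatype nexp =
    NConst nat
  | NRead string nexp
  | NAdd nexp nexp
  | NSub nexp nexp
  | NMul nexp nexp
  | NDiv nexp nexp
  | NMod nexp nexp

datatype rexp =
    RZero
  | RRead string nexp
  | RAdd rexp rexp
  | RSub rexp rexp

datatype bexp =
    NLess nexp nexp
  | RLess rexp rexp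
  | Neg bexp
  | Conj bexp bexp

datatype com =
    Skip
  | NWrite string nexp nexp
  | RWrite string nexp rexp
  | Seq com com
  | Cond bexp com com
  | While bexp com

primrec nval :: "nexp \<Rightarrow> mem \<Rightarrow> nat" where
  "nval (NConst n) s = n"
| "nval (NRead x a) s = fst s x (nval a s)"
| "nval (NAdd a b) s = nval a s + nval b s"
| "nval (NSub a b) s = nval a s - nval b s"
| "nval (NMul a b) s = nval a s * nval b s"
| "nval (NDiv a b) s = nval a s div nval b s"
| "nval (NMod a b) s = nval a s mod nval b s"

primrec rval :: "rexp \<Rightarrow> mem \<Rightarrow> real" where
  "rval RZero s = 0"
| "rval (RRead x a) s = snd s x (nval a s)"
| "rval (RAdd a b) s = rval a s + rval b s"
| "rval (RSub a b) s = rval a s - rval b s"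

primrec bval :: "bexp \<Rightarrow> mem \<Rightarrow> bool" where
  "bval (NLess a b) s \<longleftrightarrow> nval a s < nval b s"
| "bval (RLess a b) s \<longleftrightarrow> rval a s < rval b s"
| "bval (Neg b) s \<longleftrightarrow> \<not> bval b s"
| "bval (Conj a b) s \<longleftrightarrow> bval a s \<and> bval b s"

definition bits :: "nat \<Rightarrow> nat" where
  "bits n = 1 + floorlog 2 n"

text \<open>Every node of an expression pays for the bits of its own value, so an operation also pays
  for its operands and an array access for its address.\<close>

primrec ncost :: "nexp \<Rightarrow> mem \<Rightarrow> nat" where
  "ncost (NConst n) s = bits n"
| "ncost (NRead x a) s = ncost a s + bits (nval (NRead x a) s)"
| "ncost (NAdd a b) s = ncost a s + ncost b s + bits (nval (NAdd a b) s)"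
| "ncost (NSub a b) s = ncost a s + ncost b s + bits (nval (NSub a b) s)"
| "ncost (NMul a b) s = ncost a s + ncost b s + bits (nval (NMul a b) s)"
| "ncost (NDiv a b) s = ncost a s + ncost b s + bits (nval (NDiv a b) s)"
| "ncost (NMod a b) s = ncost a s + ncost b s + bits (nval (NMod a b) s)"

primrec rcost :: "rexp \<Rightarrow> mem \<Rightarrow> nat" where
  "rcost RZero s = 1"
| "rcost (RRead x a) s = ncost a s + 1"
| "rcost (RAdd a b) s = rcost a s + rcost b s + 1"
| "rcost (RSub a b) s = rcost a s + rcost b s + 1"

primrec bcost :: "bexp \<Rightarrow> mem \<Rightarrow> nat" where
  "bcost (NLess a b) s = ncost a s + ncost b s + 1"
| "bcost (RLess a b) s = rcost a s + rcost b s + 1"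
| "bcost (Neg b) s = bcost b s + 1"
| "bcost (Conj a b) s = bcost a s + bcost b s + 1"

definition nwrite :: "string \<Rightarrow> nat \<Rightarrow> nat \<Rightarrow> mem \<Rightarrow> mem" where
  "nwrite x i n s = ((fst s)(x := (fst s x)(i := n)), snd s)"

definition rwrite :: "string \<Rightarrow> nat \<Rightarrow> real \<Rightarrow> mem \<Rightarrow> mem" where
  "rwrite x i r s = (fst s, (snd s)(x := (snd s x)(i := r)))"

text \<open>\<open>exec c s t s'\<close>: started in memory \<open>s\<close>, program \<open>c\<close> halts after time \<open>t\<close> in memory \<open>s'\<close>.\<close>

inductive exec :: "com \<Rightarrow> mem \<Rightarrow> nat \<Rightarrow> mem \<Rightarrow> bool" where
  Skip: "exec Skip s 1 s"
| NWrite: "exec (NWrite x a e) s (ncost a s + ncost e s + 1) (nwrite x (nval a s) (nval e s) s)"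
| RWrite: "exec (RWrite x a e) s (ncost a s + rcost e s + 1) (rwrite x (nval a s) (rval e s) s)"
| Seq: "exec c1 s t1 s' \<Longrightarrow> exec c2 s' t2 s'' \<Longrightarrow> exec (Seq c1 c2) s (t1 + t2) s''"
| CondTrue: "bval b s \<Longrightarrow> exec c1 s t s' \<Longrightarrow> exec (Cond b c1 c2) s (bcost b s + t + 1) s'"
| CondFalse: "\<not> bval b s \<Longrightarrow> exec c2 s t s' \<Longrightarrow> exec (Cond b c1 c2) s (bcost b s + t + 1) s'"
| WhileFalse: "\<not> bval b s \<Longrightarrow> exec (While b c) s (bcost b s + 1) s"
| WhileTrue: "bval b s \<Longrightarrow> exec c s t1 s' \<Longrightarrow> exec (While b c) s' t2 s'' \<Longrightarrow>
    exec (While b c) s (bcost b s + t1 + t2 + 1) s''"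

text \<open>The points of an input instance are numbered consecutively from 0.\<close>

definition input_instance :: "nat supplier \<Rightarrow> bool" where
  "input_instance I \<longleftrightarrow> supplier_instance I \<and> points I = {..<card (points I)}"

definition initial_mem :: "nat supplier \<Rightarrow> mem" where
  "initial_mem I =
     (let n = card (points I) in
       ((\<lambda>_ _. 0)
          (''n'' := (\<lambda>_. 0)(0 := n),
           ''L'' := (\<lambda>_. 0)(0 := lower I),
           ''p'' := (\<lambda>_. 0)(0 := quota I),
           ''client'' := (\<lambda>v. if v \<in> clients I then 1 else 0),
           ''facility'' := (\<lambda>u. if u \<in> facilities I then 1 else 0),
           ''U'' := (\<lambda>u. if u \<in> facilities I then upper I u else 0)),
        (\<lambda>_ _. 0)
          (''d'' := (\<lambda>k. if k < n * n then distance I (k div n) (k mod n) else 0))))"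

text \<open>The two membership tables take one bit per point; each real takes one unit.\<close>

definition input_size :: "nat supplier \<Rightarrow> nat" where
  "input_size I =
     (let n = card (points I) in
       bits n + bits (lower I) + bits (quota I) + 2 * n +
       (\<Sum>u\<in>facilities I. bits (upper I u)) + n * n)"

definition read_solution :: "nat supplier \<Rightarrow> mem \<Rightarrow> nat solution" where
  "read_solution I s =
     \<lparr>served = {v \<in> points I. fst s ''served'' v \<noteq> 0},
      opened = (\<Sum>u\<in>points I. replicate_mset (fst s ''copies'' u) u),
      assigned = (\<lambda>v. (fst s ''center'' v, fst s ''copy'' v))\<rparr>"

definition polynomial_time :: "com \<Rightarrow> bool" where
  "polynomial_time c \<longleftrightarrow>
     (\<exists>q :: nat poly. \<forall>I. input_instance I \<longrightarrow>
        (\<exists>t s. exec c (initial_mem I) t s \<and> t \<le> poly q (input_size I)))"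

definition approximation_algorithm :: "real \<Rightarrow> com \<Rightarrow> bool" where
  "approximation_algorithm \<rho> c \<longleftrightarrow>
     (\<forall>I. input_instance I \<and> (\<exists>S. feasible I S) \<longrightarrow>
        (\<exists>t s. exec c (initial_mem I) t s \<and> feasible I (read_solution I s) \<and>
           solution_value I (read_solution I s) \<le> \<rho> * optimum I))"

end

theory Submission
  imports Defs
begin

text \<open>
  For every candidate radius \<open>r\<close> a solution of value at most \<open>11r\<close> is built that serves at least as
  many clients as any solution of value at most \<open>r\<close>; the smallest radius for which enough clients are
  served is at most the optimum.

  Let \<open>l = max 1 L\<close>, and call a facility good if it has capacity at least \<open>l\<close> and at least \<open>l\<close> clients
  within \<open>r\<close>; only good facilities can be used. Select good facilities with pairwise disjoint
  \<open>r\<close>-balls (cores), each new one at distance at most \<open>4r\<close> from an earlier one if possible (its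
  parent), and represent a selected \<open>i\<close> by the facility \<open>m i\<close> of largest capacity within \<open>2r\<close>. A new
  root is chosen with minimal capacity of \<open>m i\<close>, so it is the minimum of its tree. Every client goes
  home to a selected \<open>i\<close> within \<open>3r\<close> whose \<open>m i\<close> has at least the capacity of each good facility
  within \<open>r\<close> of the client; all clients of one group of a solution of value \<open>r\<close> have their homes in
  one tree.

  Each tree is cut from the leaves upwards into blocks of \<open>l\<close> clients; fewer than \<open>l\<close> clients are left
  over at a node, all from its core, and they are passed to its parent. A block is opened at
  the largest \<open>m i\<close> among the homes of its members. Averaging over the blocks shows that their total
  capacity is at least what any solution of value \<open>r\<close> serves in the tree, because the clients left
  over at the root have the cheapest home. They are finally inserted into blocks with spare
  capacity: along the path from the root to the block, the \<open>h\<close>-th core client of each node takes the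
  place of the \<open>h\<close>-th core client of the next. As \<open>h\<close> is used only once per tree and there are at least
  \<open>l\<close> core clients, core clients move along at most two edges and travel at most
  \<open>r + 4r + 4r + 2r\<close>, the other ones at most \<open>3r + 4r + 2r\<close>.
\<close>

section \<open>Loop programs and their running time\<close>

text \<open>Non-uniform upper bounds are the obstacle: blocks of \<open>l\<close> clients settle the
  lower bounds, but they must also offer as much room as an unknown solution. The comparison is
  therefore made client by client. Each group of the solution is represented by exactly
  \<open>l\<close> of its members, as many as a block has, and every representative carries the
  excess \<open>U (m (hm v)) - l\<close> of its home, which is at least the excess of the group's
  facility. As fewer than \<open>l\<close> clients of a tree lie outside the blocks, there are at
  least as many blocks as groups, and the representatives can be exchanged for block members without
  loss. Since this argument controls only the total room of a tree, a surplus client must be able to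
  use room in any block of its tree, however distant. The running time needs little structure: loops
  of exactly \<open>n\<close> rounds nested to a fixed depth, and products only with
  \<open>n\<close>. Every command then lengthens the stored numbers by an amount that depends on
  \<open>n\<close> alone, so bounds survive iteration.\<close>

declare split_paired_All [simp del] split_paired_Ex [simp del]

text \<open>All loops run \<open>n\<close> rounds, so a program denotes a total function
  \<open>sem\<close> and its running time can be bounded by structural induction.
  \<open>While\<close> occurs only in the image of \<open>compile\<close>.\<close>

datatype prog =
    PSkip
  | PN string nexp nexp
  | PR string nexp rexp
  | PSeq prog prog (infixr ";;" 60)
  | PIf bexp prog prog
  | PFor string prog

abbreviation V :: "string \<Rightarrow> nexp" where "V x \<equiv> NRead x (NConst 0)"

primrec compile :: "prog \<Rightarrow> com" where
  "compile PSkip = Skip"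
| "compile (PN x a e) = NWrite x a e"
| "compile (PR x a e) = RWrite x a e"
| "compile (p ;; q) = Seq (compile p) (compile q)"
| "compile (PIf b p q) = Cond b (compile p) (compile q)"
| "compile (PFor i p) =
     Seq (NWrite i (NConst 0) (NConst 0))
       (While (NLess (V i) (V ''n''))
         (Seq (compile p) (NWrite i (NConst 0) (NAdd (V i) (NConst 1)))))"

definition incr :: "string \<Rightarrow> mem \<Rightarrow> mem" where
  "incr i s = nwrite i 0 (fst s i 0 + 1) s"

text \<open>The number of rounds is read once on entry, whereas the compiled loop compares the
  counter with \<open>n\<close> before each round. The two agree because \<open>wf_prog\<close>
  forbids a body to write its own counter or \<open>''n''\<close>.\<close>

primrec sem :: "prog \<Rightarrow> mem \<Rightarrow> mem" where
  "sem PSkip s = s"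
| "sem (PN x a e) s = nwrite x (nval a s) (nval e s) s"
| "sem (PR x a e) s = rwrite x (nval a s) (rval e s) s"
| "sem (p ;; q) s = sem q (sem p s)"
| "sem (PIf b p q) s = (if bval b s then sem p s else sem q s)"
| "sem (PFor i p) s = ((\<lambda>s. incr i (sem p s)) ^^ fst s ''n'' 0) (nwrite i 0 0 s)"

primrec nwrites :: "prog \<Rightarrow> string set" where
  "nwrites PSkip = {}"
| "nwrites (PN x a e) = {x}"
| "nwrites (PR x a e) = {}"
| "nwrites (p ;; q) = nwrites p \<union> nwrites q"
| "nwrites (PIf b p q) = nwrites p \<union> nwrites q"
| "nwrites (PFor i p) = insert i (nwrites p)"

primrec rwrites :: "prog \<Rightarrow> string set" where
  "rwrites PSkip = {}"
| "rwrites (PN x a e) = {}"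
| "rwrites (PR x a e) = {x}"
| "rwrites (p ;; q) = rwrites p \<union> rwrites q"
| "rwrites (PIf b p q) = rwrites p \<union> rwrites q"
| "rwrites (PFor i p) = rwrites p"

text \<open>Multiplication is restricted to the factor \<open>n\<close>, so that one assignment lengthens the
  stored numbers by at most \<open>O(n)\<close> bits.\<close>

primrec wf_nexp :: "nexp \<Rightarrow> bool" where
  "wf_nexp (NConst k) = True"
| "wf_nexp (NRead x a) = wf_nexp a"
| "wf_nexp (NAdd a b) = (wf_nexp a \<and> wf_nexp b)"
| "wf_nexp (NSub a b) = (wf_nexp a \<and> wf_nexp b)"
| "wf_nexp (NMul a b) = (wf_nexp a \<and> b = V ''n'')"
| "wf_nexp (NDiv a b) = (wf_nexp a \<and> wf_nexp b)"
| "wf_nexp (NMod a b) = (wf_nexp a \<and> wf_nexp b)"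

primrec wf_rexp :: "rexp \<Rightarrow> bool" where
  "wf_rexp RZero = True"
| "wf_rexp (RRead x a) = wf_nexp a"
| "wf_rexp (RAdd a b) = (wf_rexp a \<and> wf_rexp b)"
| "wf_rexp (RSub a b) = (wf_rexp a \<and> wf_rexp b)"

primrec wf_bexp :: "bexp \<Rightarrow> bool" where
  "wf_bexp (NLess a b) = (wf_nexp a \<and> wf_nexp b)"
| "wf_bexp (RLess a b) = (wf_rexp a \<and> wf_rexp b)"
| "wf_bexp (Neg b) = wf_bexp b"
| "wf_bexp (Conj a b) = (wf_bexp a \<and> wf_bexp b)"

primrec wf_prog :: "prog \<Rightarrow> bool" where
  "wf_prog PSkip = True"
| "wf_prog (PN x a e) = (wf_nexp a \<and> wf_nexp e \<and> x \<noteq> ''n'')"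
| "wf_prog (PR x a e) = (wf_nexp a \<and> wf_rexp e)"
| "wf_prog (p ;; q) = (wf_prog p \<and> wf_prog q)"
| "wf_prog (PIf b p q) = (wf_bexp b \<and> wf_prog p \<and> wf_prog q)"
| "wf_prog (PFor i p) = (wf_prog p \<and> i \<notin> nwrites p \<and> i \<noteq> ''n'')"

lemma fst_nwrite: "fst (nwrite x i k s) y = (if y = x then (fst s x)(i := k) else fst s y)"
  by (simp add: nwrite_def)

lemma snd_nwrite [simp]: "snd (nwrite x i k s) = snd s"
  by (simp add: nwrite_def)

lemma fst_rwrite [simp]: "fst (rwrite x i k s) = fst s"
  by (simp add: rwrite_def)

lemma snd_rwrite: "snd (rwrite x i k s) y = (if y = x then (snd s x)(i := k) else snd s y)"
  by (simp add: rwrite_def)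

lemma sem_frame_fst: "x \<notin> nwrites p \<Longrightarrow> fst (sem p s) x = fst s x"
proof (induction p arbitrary: s)
  case (PFor i p)
  have "fst (((\<lambda>s. incr i (sem p s)) ^^ k) (nwrite i 0 0 s)) x = fst s x" for k
    using PFor by (induction k) (auto simp: incr_def fst_nwrite)
  then show ?case by simp
qed (auto simp: fst_nwrite)

lemma sem_frame_snd: "x \<notin> rwrites p \<Longrightarrow> snd (sem p s) x = snd s x"
proof (induction p arbitrary: s)
  case (PFor i p)
  have "snd (((\<lambda>s. incr i (sem p s)) ^^ k) (nwrite i 0 0 s)) x = snd s x" for k
    using PFor by (induction k) (auto simp: incr_def)
  then show ?case by simp
qed (auto simp: snd_rwrite)

lemma n_notin_nwrites: "wf_prog p \<Longrightarrow> ''n'' \<notin> nwrites p"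
  by (induction p) auto

lemma sem_n: "wf_prog p \<Longrightarrow> fst (sem p s) ''n'' = fst s ''n''"
  by (simp add: n_notin_nwrites sem_frame_fst)

text \<open>Besides the invariant, the step receives the value of the counter and frame facts for
  everything that the body does not write. An invariant thus has to mention only the arrays that its
  loop changes.\<close>

lemma sem_For_invariant:
  assumes wf: "wf_prog (PFor i p)"
    and init: "P 0 (nwrite i 0 0 s)"
    and step: "\<And>k t. k < fst s ''n'' 0 \<Longrightarrow> fst t i 0 = k \<Longrightarrow>
        (\<And>x. x \<notin> insert i (nwrites p) \<Longrightarrow> fst t x = fst s x) \<Longrightarrow>
        (\<And>x. x \<notin> rwrites p \<Longrightarrow> snd t x = snd s x) \<Longrightarrow>
        P k t \<Longrightarrow> P (Suc k) (nwrite i 0 (Suc k) (sem p t))"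
  shows "P (fst s ''n'' 0) (sem (PFor i p) s)"
proof -
  define u where "u k = ((\<lambda>s. incr i (sem p s)) ^^ k) (nwrite i 0 0 s)" for k
  have "P k (u k) \<and> fst (u k) i 0 = k \<and> (\<forall>x. x \<notin> insert i (nwrites p) \<longrightarrow> fst (u k) x = fst s x)
      \<and> (\<forall>x. x \<notin> rwrites p \<longrightarrow> snd (u k) x = snd s x)" if "k \<le> fst s ''n'' 0" for k
    using that
  proof (induction k)
    case 0
    then show ?case using init by (simp add: u_def fst_nwrite)
  next
    case (Suc k)
    have e: "u (Suc k) = nwrite i 0 (Suc k) (sem p (u k))"
      using Suc wf by (simp add: u_def incr_def sem_frame_fst)
    have "P (Suc k) (u (Suc k))"
      unfolding e using Suc by (intro step) auto
    then show ?case using Suc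
      by (auto simp: e fst_nwrite sem_frame_fst sem_frame_snd)
  qed
  from this[of "fst s ''n'' 0"] show ?thesis by (simp add: u_def)
qed

section \<open>Bit lengths and costs of expressions\<close>

definition bounded :: "nat \<Rightarrow> mem \<Rightarrow> bool" where
  "bounded B s \<longleftrightarrow> (\<forall>x i. fst s x i < 2 ^ B)"

lemma bounded_mono: "bounded B s \<Longrightarrow> B \<le> B' \<Longrightarrow> bounded B' s"
  unfolding bounded_def by (meson less_le_trans one_le_numeral power_increasing)

lemma poly_nat_mono: "x \<le> y \<Longrightarrow> poly (q :: nat poly) x \<le> poly q y"
  by (induction q) (auto intro!: add_mono mult_mono)

lemma bits_le: "k < 2 ^ B \<Longrightarrow> bits k \<le> B + 1"
  by (simp add: bits_def floorlog_leD floorlog_leI)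

lemma mult_lt_power2: "a < 2 ^ k \<Longrightarrow> b < 2 ^ m \<Longrightarrow> a * b < (2::nat) ^ (k + m)"
  by (metis mult_strict_mono' power_add zero_le)

lemma add_lt_power2: "a < 2 ^ k \<Longrightarrow> b < 2 ^ k \<Longrightarrow> a + b < (2::nat) ^ Suc k"
  by simp


lemma lt_power2_mono: "a < (2::nat) ^ k \<Longrightarrow> k \<le> m \<Longrightarrow> a < 2 ^ m"
  by (meson less_le_trans one_le_numeral power_increasing)

text \<open>A factor \<open>n\<close> is estimated crudely by \<open>n < 2 ^ n\<close>, which is why
  the additional bits are linear in \<open>n\<close>. One constant \<open>c\<close> serves value and
  cost alike and keeps the induction over expressions uniform.\<close>

definition nexp_bound :: "nat \<Rightarrow> nexp \<Rightarrow> bool" where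
  "nexp_bound c e \<longleftrightarrow> (\<forall>s B. bounded B s \<longrightarrow>
      nval e s < 2 ^ (B + c * Suc (fst s ''n'' 0)) \<and>
      ncost e s \<le> c * (B + c * Suc (fst s ''n'' 0) + 1))"

lemma nexp_bound_mono:
  assumes "nexp_bound c e" "c \<le> c'"
  shows "nexp_bound c' e"
  unfolding nexp_bound_def
proof (intro allI impI conjI)
  fix s B assume b: "bounded B s"
  have le: "B + c * Suc (fst s ''n'' 0) \<le> B + c' * Suc (fst s ''n'' 0)"
    using assms(2) by (intro add_left_mono mult_right_mono) auto
  show "nval e s < 2 ^ (B + c' * Suc (fst s ''n'' 0))"
    using assms(1) b le unfolding nexp_bound_def by (meson lt_power2_mono)
  have "ncost e s \<le> c * (B + c * Suc (fst s ''n'' 0) + 1)"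
    using assms(1) b by (auto simp: nexp_bound_def)
  also have "\<dots> \<le> c' * (B + c' * Suc (fst s ''n'' 0) + 1)"
    using assms(2) le by (intro mult_mono) auto
  finally show "ncost e s \<le> c' * (B + c' * Suc (fst s ''n'' 0) + 1)" .
qed

lemma nexp_bound_binary:
  assumes a: "nexp_bound c a" and b: "nexp_bound c b"
    and val: "\<And>s B. bounded B s \<Longrightarrow> nval e s < 2 ^ (B + (2 * c + 2) * Suc (fst s ''n'' 0))"
    and cost: "\<And>s. ncost e s = ncost a s + ncost b s + bits (nval e s)"
  shows "nexp_bound (2 * c + 2) e"
  unfolding nexp_bound_def
proof (intro allI impI conjI)
  fix s B assume B: "bounded B s"
  show v: "nval e s < 2 ^ (B + (2 * c + 2) * Suc (fst s ''n'' 0))" using val[OF B] .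
  have "c * (B + c * Suc (fst s ''n'' 0) + 1) \<le> c * (B + (2 * c + 2) * Suc (fst s ''n'' 0) + 1)"
    by (intro mult_left_mono add_mono mult_right_mono) auto
  then have "ncost a s \<le> c * (B + (2 * c + 2) * Suc (fst s ''n'' 0) + 1)"
    and "ncost b s \<le> c * (B + (2 * c + 2) * Suc (fst s ''n'' 0) + 1)"
    using a b B unfolding nexp_bound_def by (meson order_trans)+
  moreover have "bits (nval e s) \<le> B + (2 * c + 2) * Suc (fst s ''n'' 0) + 1"
    using bits_le[OF v] .
  ultimately have "ncost e s \<le> (2 * c + 1) * (B + (2 * c + 2) * Suc (fst s ''n'' 0) + 1)"
    unfolding cost by (simp only: add_mult_distrib mult_1 mult_2)
  also have "\<dots> \<le> (2 * c + 2) * (B + (2 * c + 2) * Suc (fst s ''n'' 0) + 1)"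
    by (intro mult_right_mono) auto
  finally show "ncost e s \<le> (2 * c + 2) * (B + (2 * c + 2) * Suc (fst s ''n'' 0) + 1)" .
qed

lemma nexp_bound_value:
  assumes "nexp_bound c a" "bounded B s" "B + c * Suc (fst s ''n'' 0) \<le> k"
  shows "nval a s < 2 ^ k"
  using assms unfolding nexp_bound_def by (meson lt_power2_mono)

lemma wf_nexp_bound: "wf_nexp e \<Longrightarrow> \<exists>c. nexp_bound c e"
proof (induction e)
  case (NConst k)
  have "k < 2 ^ (B + Suc k * Suc m)" for B m :: nat
    by (rule lt_power2_mono[of _ k]) auto
  moreover have "bits k \<le> Suc k * (B + Suc k * Suc m + 1)" for B m
    using bits_le[of k k] by (simp add: algebra_simps)
  ultimately have "nexp_bound (Suc k) (NConst k)"
    unfolding nexp_bound_def by (metis nval.simps(1) ncost.simps(1))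
  then show ?case by blast
next
  case (NRead x a)
  then obtain c where c: "nexp_bound c a" by auto
  have "nexp_bound (2 * c + 2) (NRead x a)"
    unfolding nexp_bound_def
  proof (intro allI impI conjI)
    fix s B assume B: "bounded B s"
    then have v: "fst s x (nval a s) < 2 ^ B" by (simp add: bounded_def)
    then show "nval (NRead x a) s < 2 ^ (B + (2 * c + 2) * Suc (fst s ''n'' 0))"
      by (simp only: nval.simps) (erule lt_power2_mono, simp)
    have "ncost a s \<le> c * (B + c * Suc (fst s ''n'' 0) + 1)"
      using c B by (auto simp: nexp_bound_def)
    also have "\<dots> \<le> c * (B + (2 * c + 2) * Suc (fst s ''n'' 0) + 1)"
      by (intro mult_left_mono add_mono mult_right_mono) auto
    finally have "ncost (NRead x a) s \<le> Suc c * (B + (2 * c + 2) * Suc (fst s ''n'' 0) + 1)"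
      using bits_le[OF v] by simp
    also have "\<dots> \<le> (2 * c + 2) * (B + (2 * c + 2) * Suc (fst s ''n'' 0) + 1)"
      by (intro mult_right_mono) auto
    finally show "ncost (NRead x a) s \<le> (2 * c + 2) * (B + (2 * c + 2) * Suc (fst s ''n'' 0) + 1)" .
  qed
  then show ?case by blast
next
  case (NAdd a b)
  then obtain c1 c2 where "nexp_bound c1 a" "nexp_bound c2 b" by auto
  then have ab: "nexp_bound (max c1 c2) a" "nexp_bound (max c1 c2) b"
    by (auto elim: nexp_bound_mono)
  let ?c = "max c1 c2"
  have "nexp_bound (2 * ?c + 2) (NAdd a b)"
  proof (rule nexp_bound_binary[OF ab])
    fix s B assume B: "bounded B s"
    have "nval a s < 2 ^ (B + ?c * Suc (fst s ''n'' 0))" "nval b s < 2 ^ (B + ?c * Suc (fst s ''n'' 0))"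
      using ab B by (auto intro: nexp_bound_value)
    then have "nval a s + nval b s < 2 ^ Suc (B + ?c * Suc (fst s ''n'' 0))"
      by (rule add_lt_power2)
    then show "nval (NAdd a b) s < 2 ^ (B + (2 * ?c + 2) * Suc (fst s ''n'' 0))"
      unfolding nval.simps by (rule lt_power2_mono) (simp add: algebra_simps)
  qed simp
  then show ?case by blast
next
  case (NSub a b)
  then obtain c1 c2 where "nexp_bound c1 a" "nexp_bound c2 b" by auto
  then have ab: "nexp_bound (max c1 c2) a" "nexp_bound (max c1 c2) b"
    by (auto elim: nexp_bound_mono)
  have "nexp_bound (2 * max c1 c2 + 2) (NSub a b)"
  proof (rule nexp_bound_binary[OF ab])
    fix s B assume "bounded B s"
    then have "nval a s < 2 ^ (B + (2 * max c1 c2 + 2) * Suc (fst s ''n'' 0))"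
      by (rule nexp_bound_value[OF ab(1)]) (simp add: algebra_simps)
    then show "nval (NSub a b) s < 2 ^ (B + (2 * max c1 c2 + 2) * Suc (fst s ''n'' 0))"
      unfolding nval.simps by (rule less_imp_diff_less)
  qed simp
  then show ?case by blast
next
  case (NMul a b)
  then obtain c where c: "nexp_bound c a" and b: "b = V ''n''" by auto
  have "nexp_bound 2 b"
    unfolding nexp_bound_def
  proof (intro allI impI conjI)
    fix s B assume B: "bounded B s"
    have v: "fst s ''n'' 0 < 2 ^ B" using B by (simp add: bounded_def)
    then show "nval b s < 2 ^ (B + 2 * Suc (fst s ''n'' 0))"
      unfolding b nval.simps by (rule lt_power2_mono) simp
    have "bits 0 = 1" by (simp add: bits_def floorlog_def)
    then show "ncost b s \<le> 2 * (B + 2 * Suc (fst s ''n'' 0) + 1)"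
      using bits_le[OF v] by (simp add: b)
  qed
  then have ab: "nexp_bound (max c 2) a" "nexp_bound (max c 2) b"
    using c by (auto elim: nexp_bound_mono)
  have "nexp_bound (2 * max c 2 + 2) (NMul a b)"
  proof (rule nexp_bound_binary[OF ab])
    fix s B assume B: "bounded B s"
    have "nval a s < 2 ^ (B + max c 2 * Suc (fst s ''n'' 0))"
      using ab B by (auto intro: nexp_bound_value)
    then have "nval a s * fst s ''n'' 0 < 2 ^ (B + max c 2 * Suc (fst s ''n'' 0) + fst s ''n'' 0)"
      by (intro mult_lt_power2) auto
    then show "nval (NMul a b) s < 2 ^ (B + (2 * max c 2 + 2) * Suc (fst s ''n'' 0))"
      unfolding b nval.simps by (rule lt_power2_mono) (simp add: algebra_simps)
  qed simp
  then show ?case by blast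
next
  case (NDiv a b)
  then obtain c1 c2 where "nexp_bound c1 a" "nexp_bound c2 b" by auto
  then have ab: "nexp_bound (max c1 c2) a" "nexp_bound (max c1 c2) b"
    by (auto elim: nexp_bound_mono)
  have "nexp_bound (2 * max c1 c2 + 2) (NDiv a b)"
  proof (rule nexp_bound_binary[OF ab])
    fix s B assume "bounded B s"
    then have "nval a s < 2 ^ (B + (2 * max c1 c2 + 2) * Suc (fst s ''n'' 0))"
      by (rule nexp_bound_value[OF ab(1)]) (simp add: algebra_simps)
    then show "nval (NDiv a b) s < 2 ^ (B + (2 * max c1 c2 + 2) * Suc (fst s ''n'' 0))"
      unfolding nval.simps by (rule le_less_trans[OF div_le_dividend])
  qed simp
  then show ?case by blast
next
  case (NMod a b)
  then obtain c1 c2 where "nexp_bound c1 a" "nexp_bound c2 b" by auto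
  then have ab: "nexp_bound (max c1 c2) a" "nexp_bound (max c1 c2) b"
    by (auto elim: nexp_bound_mono)
  have "nexp_bound (2 * max c1 c2 + 2) (NMod a b)"
  proof (rule nexp_bound_binary[OF ab])
    fix s B assume "bounded B s"
    then have "nval a s < 2 ^ (B + (2 * max c1 c2 + 2) * Suc (fst s ''n'' 0))"
      by (rule nexp_bound_value[OF ab(1)]) (simp add: algebra_simps)
    then show "nval (NMod a b) s < 2 ^ (B + (2 * max c1 c2 + 2) * Suc (fst s ''n'' 0))"
      unfolding nval.simps by (rule le_less_trans[OF mod_less_eq_dividend])
  qed simp
  then show ?case by blast
qed

lemma wf_nexp_poly:
  assumes "wf_nexp e"
  shows "\<exists>q :: nat poly. \<forall>s B. bounded B s \<longrightarrow>
      nval e s < 2 ^ (B + poly q (fst s ''n'' 0)) \<and> ncost e s \<le> poly q (B + fst s ''n'' 0)"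
proof -
  obtain c where c: "nexp_bound c e" using wf_nexp_bound[OF assms] by blast
  let ?q = "[:c * (c + 1) + c, c * (c + 1) + c:]"
  have "nval e s < 2 ^ (B + poly ?q (fst s ''n'' 0)) \<and> ncost e s \<le> poly ?q (B + fst s ''n'' 0)"
    if "bounded B s" for s B
  proof
    show "nval e s < 2 ^ (B + poly ?q (fst s ''n'' 0))"
      by (rule nexp_bound_value[OF c that]) (simp add: algebra_simps)
    have "ncost e s \<le> c * (B + c * Suc (fst s ''n'' 0) + 1)"
      using c that by (auto simp: nexp_bound_def)
    also have "\<dots> \<le> poly ?q (B + fst s ''n'' 0)" by (simp add: algebra_simps)
    finally show "ncost e s \<le> poly ?q (B + fst s ''n'' 0)" .
  qed
  then show ?thesis by blast
qed

lemma wf_rexp_poly: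
  assumes "wf_rexp e"
  shows "\<exists>q :: nat poly. \<forall>s B. bounded B s \<longrightarrow> rcost e s \<le> poly q (B + fst s ''n'' 0)"
  using assms
proof (induction e)
  case RZero
  show ?case by (rule exI[of _ 1]) simp
next
  case (RRead x a)
  then obtain q :: "nat poly" where "\<And>s B. bounded B s \<Longrightarrow> ncost a s \<le> poly q (B + fst s ''n'' 0)"
    using wf_nexp_poly[of a] unfolding wf_rexp.simps by blast
  then show ?case by (intro exI[of _ "q + 1"]) auto
next
  case (RAdd a b)
  then obtain q1 q2 :: "nat poly" where
    "\<And>s B. bounded B s \<Longrightarrow> rcost a s \<le> poly q1 (B + fst s ''n'' 0)"
    "\<And>s B. bounded B s \<Longrightarrow> rcost b s \<le> poly q2 (B + fst s ''n'' 0)"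
    unfolding wf_rexp.simps by blast
  then show ?case by (intro exI[of _ "q1 + q2 + 1"]) (auto intro!: add_mono)
next
  case (RSub a b)
  then obtain q1 q2 :: "nat poly" where
    "\<And>s B. bounded B s \<Longrightarrow> rcost a s \<le> poly q1 (B + fst s ''n'' 0)"
    "\<And>s B. bounded B s \<Longrightarrow> rcost b s \<le> poly q2 (B + fst s ''n'' 0)"
    unfolding wf_rexp.simps by blast
  then show ?case by (intro exI[of _ "q1 + q2 + 1"]) (auto intro!: add_mono)
qed

lemma wf_bexp_poly:
  assumes "wf_bexp e"
  shows "\<exists>q :: nat poly. \<forall>s B. bounded B s \<longrightarrow> bcost e s \<le> poly q (B + fst s ''n'' 0)"
  using assms
proof (induction e)
  case (NLess a b)
  then obtain q1 q2 :: "nat poly" where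
    "\<And>s B. bounded B s \<Longrightarrow> ncost a s \<le> poly q1 (B + fst s ''n'' 0)"
    "\<And>s B. bounded B s \<Longrightarrow> ncost b s \<le> poly q2 (B + fst s ''n'' 0)"
    using wf_nexp_poly[of a] wf_nexp_poly[of b] unfolding wf_bexp.simps by blast
  then show ?case by (intro exI[of _ "q1 + q2 + 1"]) (auto intro!: add_mono)
next
  case (RLess a b)
  then obtain q1 q2 :: "nat poly" where
    "\<And>s B. bounded B s \<Longrightarrow> rcost a s \<le> poly q1 (B + fst s ''n'' 0)"
    "\<And>s B. bounded B s \<Longrightarrow> rcost b s \<le> poly q2 (B + fst s ''n'' 0)"
    using wf_rexp_poly[of a] wf_rexp_poly[of b] unfolding wf_bexp.simps by blast
  then show ?case by (intro exI[of _ "q1 + q2 + 1"]) (auto intro!: add_mono)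
next
  case (Neg b)
  then obtain q :: "nat poly" where "\<And>s B. bounded B s \<Longrightarrow> bcost b s \<le> poly q (B + fst s ''n'' 0)"
    unfolding wf_bexp.simps by blast
  then show ?case by (intro exI[of _ "q + 1"]) auto
next
  case (Conj a b)
  then obtain q1 q2 :: "nat poly" where
    "\<And>s B. bounded B s \<Longrightarrow> bcost a s \<le> poly q1 (B + fst s ''n'' 0)"
    "\<And>s B. bounded B s \<Longrightarrow> bcost b s \<le> poly q2 (B + fst s ''n'' 0)"
    unfolding wf_bexp.simps by blast
  then show ?case by (intro exI[of _ "q1 + q2 + 1"]) (auto intro!: add_mono)
qed

section \<open>Polynomial bounds for commands\<close>

definition poly_prog :: "nat poly \<Rightarrow> com \<Rightarrow> (mem \<Rightarrow> mem) \<Rightarrow> bool" where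
  "poly_prog q c f \<longleftrightarrow> (\<forall>s B. bounded B s \<longrightarrow>
     (\<exists>t. exec c s t (f s) \<and> t \<le> poly q (B + fst s ''n'' 0)) \<and>
     bounded (B + poly q (fst s ''n'' 0)) (f s))"

lemma poly_prog_NWrite:
  assumes "wf_nexp a" "wf_nexp e"
  shows "\<exists>q. poly_prog q (NWrite x a e) (\<lambda>s. nwrite x (nval a s) (nval e s) s)"
proof -
  obtain q1 q2 where
    q1: "\<And>s B. bounded B s \<Longrightarrow> ncost a s \<le> poly q1 (B + fst s ''n'' 0)" and
    q2: "\<And>s B. bounded B s \<Longrightarrow> nval e s < 2 ^ (B + poly q2 (fst s ''n'' 0))"
      "\<And>s B. bounded B s \<Longrightarrow> ncost e s \<le> poly q2 (B + fst s ''n'' 0)"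
    using wf_nexp_poly[OF assms(1)] wf_nexp_poly[OF assms(2)] by blast
  have "poly_prog (q1 + q2 + 1) (NWrite x a e) (\<lambda>s. nwrite x (nval a s) (nval e s) s)"
    unfolding poly_prog_def
  proof (intro allI impI conjI)
    fix s B assume B: "bounded B s"
    show "\<exists>t. exec (NWrite x a e) s t (nwrite x (nval a s) (nval e s) s) \<and>
        t \<le> poly (q1 + q2 + 1) (B + fst s ''n'' 0)"
      using exec.NWrite[of x a e s] q1[OF B] q2(2)[OF B]
      by (intro exI[of _ "ncost a s + ncost e s + 1"]) simp
    have "nval e s < 2 ^ (B + poly (q1 + q2 + 1) (fst s ''n'' 0))"
      using q2(1)[OF B] by (rule lt_power2_mono) simp
    moreover have "fst s y i < 2 ^ (B + poly (q1 + q2 + 1) (fst s ''n'' 0))" for y i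
      using B unfolding bounded_def by (meson lt_power2_mono le_add1)
    ultimately show "bounded (B + poly (q1 + q2 + 1) (fst s ''n'' 0)) (nwrite x (nval a s) (nval e s) s)"
      unfolding bounded_def fst_nwrite by auto
  qed
  then show ?thesis by blast
qed

lemma poly_prog_RWrite:
  assumes "wf_nexp a" "wf_rexp e"
  shows "\<exists>q. poly_prog q (RWrite x a e) (\<lambda>s. rwrite x (nval a s) (rval e s) s)"
proof -
  obtain q1 q2 where
    q1: "\<And>s B. bounded B s \<Longrightarrow> ncost a s \<le> poly q1 (B + fst s ''n'' 0)" and
    q2: "\<And>s B. bounded B s \<Longrightarrow> rcost e s \<le> poly q2 (B + fst s ''n'' 0)"
    using wf_nexp_poly[OF assms(1)] wf_rexp_poly[OF assms(2)] by blast
  have "poly_prog (q1 + q2 + 1) (RWrite x a e) (\<lambda>s. rwrite x (nval a s) (rval e s) s)"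
    unfolding poly_prog_def
  proof (intro allI impI conjI)
    fix s B assume B: "bounded B s"
    show "\<exists>t. exec (RWrite x a e) s t (rwrite x (nval a s) (rval e s) s) \<and>
        t \<le> poly (q1 + q2 + 1) (B + fst s ''n'' 0)"
      using exec.RWrite[of x a e s] q1[OF B] q2[OF B]
      by (intro exI[of _ "ncost a s + rcost e s + 1"]) simp
    have "bounded (B + poly (q1 + q2 + 1) (fst s ''n'' 0)) s"
      using B by (rule bounded_mono) simp
    then show "bounded (B + poly (q1 + q2 + 1) (fst s ''n'' 0)) (rwrite x (nval a s) (rval e s) s)"
      by (auto simp only: bounded_def fst_rwrite)
  qed
  then show ?thesis by blast
qed

lemma poly_prog_Seq:
  assumes f: "poly_prog q1 c f" and g: "poly_prog q2 d g" and n: "\<And>s. fst (f s) ''n'' = fst s ''n''"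
  shows "\<exists>q. poly_prog q (Seq c d) (\<lambda>s. g (f s))"
proof -
  \<comment> \<open>The second command starts with up to \<open>poly q1 n\<close> more bits, so its
    time is \<open>q2\<close> at \<open>x + q1 x\<close>. The plain summands cover the time of the
    first command and the bit growth of both.\<close>
  let ?q = "q1 + q2 + pcompose q2 ([:0, 1:] + q1)"
  have "poly_prog ?q (Seq c d) (\<lambda>s. g (f s))"
    unfolding poly_prog_def
  proof (intro allI impI conjI)
    fix s B assume B: "bounded B s"
    let ?n = "fst s ''n'' 0"
    obtain t1 where t1: "exec c s t1 (f s)" "t1 \<le> poly q1 (B + ?n)"
      and B1: "bounded (B + poly q1 ?n) (f s)" using f B unfolding poly_prog_def by blast
    obtain t2 where t2: "exec d (f s) t2 (g (f s))" "t2 \<le> poly q2 (B + poly q1 ?n + ?n)"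
      and B2: "bounded (B + poly q1 ?n + poly q2 ?n) (g (f s))"
      using g B1 n unfolding poly_prog_def by metis
    have "poly q2 (B + poly q1 ?n + ?n) \<le> poly q2 (B + ?n + poly q1 (B + ?n))"
      using poly_nat_mono[of ?n "B + ?n" q1] by (intro poly_nat_mono) auto
    then show "\<exists>t. exec (Seq c d) s t (g (f s)) \<and> t \<le> poly ?q (B + ?n)"
      using t1 t2 by (intro exI[of _ "t1 + t2"] conjI exec.Seq) (auto simp: poly_pcompose)
    show "bounded (B + poly ?q ?n) (g (f s))" using B2 by (rule bounded_mono) simp
  qed
  then show ?thesis by blast
qed

lemma poly_prog_Cond:
  assumes b: "wf_bexp b" and f: "poly_prog q1 c f" and g: "poly_prog q2 d g"
  shows "\<exists>q. poly_prog q (Cond b c d) (\<lambda>s. if bval b s then f s else g s)"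
proof -
  obtain q0 where q0: "\<And>s B. bounded B s \<Longrightarrow> bcost b s \<le> poly q0 (B + fst s ''n'' 0)"
    using wf_bexp_poly[OF b] by blast
  have "poly_prog (q0 + q1 + q2 + 1) (Cond b c d) (\<lambda>s. if bval b s then f s else g s)"
    unfolding poly_prog_def
  proof (intro allI impI conjI)
    fix s B assume B: "bounded B s"
    let ?n = "fst s ''n'' 0"
    obtain t1 where t1: "exec c s t1 (f s)" "t1 \<le> poly q1 (B + ?n)"
      and B1: "bounded (B + poly q1 ?n) (f s)" using f B unfolding poly_prog_def by blast
    obtain t2 where t2: "exec d s t2 (g s)" "t2 \<le> poly q2 (B + ?n)"
      and B2: "bounded (B + poly q2 ?n) (g s)" using g B unfolding poly_prog_def by blast
    show "\<exists>t. exec (Cond b c d) s t (if bval b s then f s else g s) \<and>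
        t \<le> poly (q0 + q1 + q2 + 1) (B + ?n)"
    proof (cases "bval b s")
      case True
      then show ?thesis using q0[OF B] t1 by (auto intro!: exI conjI exec.CondTrue)
    next
      case False
      then show ?thesis using q0[OF B] t2 by (auto intro!: exI conjI exec.CondFalse)
    qed
    show "bounded (B + poly (q0 + q1 + q2 + 1) ?n) (if bval b s then f s else g s)"
      using B1 B2 by (auto elim!: bounded_mono)
  qed
  then show ?thesis by blast
qed

text \<open>Here it matters that \<open>poly_prog\<close> bounds the bit growth by a polynomial in
  \<open>n\<close> alone, independently of \<open>B\<close>: \<open>n\<close> rounds add
  \<open>n * poly q1 n\<close> bits. A growth depending on \<open>B\<close> would compose the
  polynomial with itself \<open>n\<close> times.\<close>

lemma poly_prog_For:
  assumes body: "poly_prog q0 c f" and i: "i \<noteq> ''n''"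
    and fi: "\<And>s. fst (f s) i = fst s i" and fn: "\<And>s. fst (f s) ''n'' = fst s ''n''"
  shows "\<exists>q. poly_prog q
     (Seq (NWrite i (NConst 0) (NConst 0))
       (While (NLess (V i) (V ''n'')) (Seq c (NWrite i (NConst 0) (NAdd (V i) (NConst 1))))))
     (\<lambda>s. ((\<lambda>s. incr i (f s)) ^^ fst s ''n'' 0) (nwrite i 0 0 s))"
proof -
  let ?inc = "NWrite i (NConst 0) (NAdd (V i) (NConst 1))"
  let ?b = "NLess (V i) (V ''n'')"
  let ?w = "While ?b (Seq c ?inc)"
  let ?g = "\<lambda>s. incr i (f s)"
  have "\<exists>q. poly_prog q ?inc (\<lambda>s. nwrite i (nval (NConst 0) s) (nval (NAdd (V i) (NConst 1)) s) s)"
    by (rule poly_prog_NWrite) auto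
  then obtain q' where inc: "poly_prog q' ?inc (incr i)"
    unfolding incr_def by auto
  obtain q1 where q1: "poly_prog q1 (Seq c ?inc) ?g"
    using poly_prog_Seq[OF body inc fn] by blast
  obtain q2 where q2: "\<And>s B. bounded B s \<Longrightarrow> bcost ?b s \<le> poly q2 (B + fst s ''n'' 0)"
    using wf_bexp_poly[of ?b] by auto
  have gi: "fst (?g s) i 0 = Suc (fst s i 0)" and gn: "fst (?g s) ''n'' = fst s ''n''" for s
    using i by (auto simp: incr_def fst_nwrite fi fn)
  \<comment> \<open>\<open>k\<close> counts the remaining rounds, and each is charged at the size
    bound reached at the end. The additional unit in \<open>Suc k\<close> pays for the final test,
    which fails.\<close>
  have loop: "\<exists>t. exec ?w s t ((?g ^^ k) s) \<and>
        t \<le> Suc k * (poly q1 (B + k * poly q1 (fst s ''n'' 0) + fst s ''n'' 0) +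
          poly q2 (B + k * poly q1 (fst s ''n'' 0) + fst s ''n'' 0) + 1) \<and>
        bounded (B + k * poly q1 (fst s ''n'' 0)) ((?g ^^ k) s)"
    if "bounded B s" "fst s i 0 + k = fst s ''n'' 0" for k s B
    using that
  proof (induction k arbitrary: s B)
    case 0
    have "exec ?w s (bcost ?b s + 1) s" using 0 by (intro exec.WhileFalse) simp
    then show ?case using 0 q2[OF 0(1)] by (intro exI[of _ "bcost ?b s + 1"]) simp
  next
    case (Suc k)
    let ?n = "fst s ''n'' 0"
    let ?X = "B + Suc k * poly q1 ?n + ?n"
    obtain t1 where t1: "exec (Seq c ?inc) s t1 (?g s)" "t1 \<le> poly q1 (B + ?n)"
      and B1: "bounded (B + poly q1 ?n) (?g s)" using q1 Suc.prems(1) unfolding poly_prog_def by blast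
    obtain t2 where t2: "exec ?w (?g s) t2 ((?g ^^ k) (?g s))"
      "t2 \<le> Suc k * (poly q1 (B + poly q1 ?n + k * poly q1 ?n + ?n) +
          poly q2 (B + poly q1 ?n + k * poly q1 ?n + ?n) + 1)"
      and B2: "bounded (B + poly q1 ?n + k * poly q1 ?n) ((?g ^^ k) (?g s))"
      using Suc.IH[OF B1] Suc.prems(2) gi gn by auto
    have X: "B + poly q1 ?n + k * poly q1 ?n + ?n = ?X" by simp
    have ex: "exec ?w s (bcost ?b s + t1 + t2 + 1) ((?g ^^ k) (?g s))"
      using t1 t2 Suc.prems(2) by (intro exec.WhileTrue) auto
    have "t1 \<le> poly q1 ?X" using t1(2) poly_nat_mono[of "B + ?n" ?X q1] by simp
    moreover have "bcost ?b s \<le> poly q2 ?X"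
      using q2[OF Suc.prems(1)] poly_nat_mono[of "B + ?n" ?X q2] by simp
    moreover have "t2 \<le> Suc k * (poly q1 ?X + poly q2 ?X + 1)" using t2(2) unfolding X .
    ultimately have "bcost ?b s + t1 + t2 + 1 \<le> Suc (Suc k) * (poly q1 ?X + poly q2 ?X + 1)"
      by (subst mult_Suc) linarith
    then show ?case using ex B2
      by (intro exI[of _ "bcost ?b s + t1 + t2 + 1"])
        (simp only: funpow_Suc_right o_apply, simp add: add_ac)
  qed
  \<comment> \<open>In terms of \<open>x = B + n\<close> the sizes during the loop stay below
    \<open>x + x * q1 x\<close>, which turns the bound into a polynomial in
    \<open>x\<close>.\<close>
  let ?Y = "[:0, 1:] + [:0, 1:] * q1"
  have w: "\<exists>t. exec ?w s t ((?g ^^ fst s ''n'' 0) s) \<and>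
        t \<le> poly ([:1, 1:] * (pcompose q1 ?Y + pcompose q2 ?Y + 1)) (B + fst s ''n'' 0) \<and>
        bounded (B + poly ([:0, 1:] * q1) (fst s ''n'' 0)) ((?g ^^ fst s ''n'' 0) s)"
    if B: "bounded B s" and i0: "fst s i 0 = 0" for s B
  proof -
    let ?n = "fst s ''n'' 0"
    let ?x = "B + ?n"
    let ?y = "B + ?n * poly q1 ?n + ?n"
    obtain t where t: "exec ?w s t ((?g ^^ ?n) s)" "t \<le> Suc ?n * (poly q1 ?y + poly q2 ?y + 1)"
      "bounded (B + ?n * poly q1 ?n) ((?g ^^ ?n) s)"
      using loop[OF B, of ?n] i0 by (metis add_0)
    have y: "?y \<le> ?x + ?x * poly q1 ?x"
      using mult_mono[of ?n ?x "poly q1 ?n" "poly q1 ?x"] poly_nat_mono[of ?n ?x q1] by simp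
    have "Suc ?n * (poly q1 ?y + poly q2 ?y + 1) \<le> Suc ?x * (poly q1 (?x + ?x * poly q1 ?x) + poly q2 (?x + ?x * poly q1 ?x) + 1)"
      using poly_nat_mono[OF y] by (intro mult_mono add_mono) auto
    then have "t \<le> poly ([:1, 1:] * (pcompose q1 ?Y + pcompose q2 ?Y + 1)) ?x"
      using t(2) by (simp add: poly_pcompose)
    then show ?thesis using t by auto
  qed
  define Q where "Q = [:1, 1:] * (pcompose q1 ?Y + pcompose q2 ?Y + 1) + [:0, 1:] * q1"
  have init: "bounded (B + 0) (nwrite i 0 0 s)" if "bounded B s" for s B
    using that by (auto simp: bounded_def fst_nwrite)
  have b0: "bits 0 = 1" by (simp add: bits_def floorlog_def)
  \<comment> \<open>The \<open>3\<close> is the cost of resetting the counter: one unit for each of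
    the two constants \<open>0\<close> and one for the assignment.\<close>
  have "poly_prog (Q + 3) (Seq (NWrite i (NConst 0) (NConst 0)) ?w)
     (\<lambda>s. (?g ^^ fst s ''n'' 0) (nwrite i 0 0 s))"
    unfolding poly_prog_def
  proof (intro allI impI conjI)
    fix s B assume B: "bounded B s"
    let ?s = "nwrite i 0 0 s"
    have n: "fst ?s ''n'' = fst s ''n''" "fst ?s i 0 = 0" using i by (auto simp: fst_nwrite)
    obtain t where t: "exec ?w ?s t ((?g ^^ fst s ''n'' 0) ?s)"
      "t \<le> poly Q (B + fst s ''n'' 0)" "bounded (B + poly ([:0, 1:] * q1) (fst s ''n'' 0)) ((?g ^^ fst s ''n'' 0) ?s)"
      using w[OF init[OF B]] n unfolding Q_def by (auto simp del: mult_pCons_left)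
    have "exec (Seq (NWrite i (NConst 0) (NConst 0)) ?w) s (ncost (NConst 0) s + ncost (NConst 0) s + 1 + t)
        ((?g ^^ fst s ''n'' 0) ?s)"
      using exec.Seq[OF exec.NWrite[of i "NConst 0" "NConst 0" s]] t(1) by simp
    then show "\<exists>t. exec (Seq (NWrite i (NConst 0) (NConst 0)) ?w) s t ((?g ^^ fst s ''n'' 0) ?s) \<and>
        t \<le> poly (Q + 3) (B + fst s ''n'' 0)"
      using t(2) by (intro exI conjI) (auto simp: b0)
    show "bounded (B + poly (Q + 3) (fst s ''n'' 0)) ((?g ^^ fst s ''n'' 0) ?s)"
      using t(3) by (rule bounded_mono) (simp add: Q_def)
  qed
  then show ?thesis by blast
qed

theorem wf_prog_poly: "wf_prog p \<Longrightarrow> \<exists>q. poly_prog q (compile p) (sem p)"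
proof (induction p)
  case PSkip
  have "poly_prog 1 Skip (\<lambda>s. s)"
    unfolding poly_prog_def using exec.Skip by (auto elim: bounded_mono intro!: exI[of _ 1])
  then show ?case by auto
next
  case (PN x a e)
  then show ?case using poly_prog_NWrite[of a e x] by simp
next
  case (PR x a e)
  then show ?case using poly_prog_RWrite[of a e x] by simp
next
  case (PSeq p q)
  then show ?case using poly_prog_Seq[of _ "compile p" "sem p" _ "compile q" "sem q"] sem_n by auto
next
  case (PIf b p q)
  then show ?case using poly_prog_Cond[of b _ "compile p" "sem p" _ "compile q" "sem q"] by auto
next
  case (PFor i p)
  then obtain q0 where "poly_prog q0 (compile p) (sem p)" by auto
  from poly_prog_For[OF this] PFor.prems show ?case by (auto simp: sem_n sem_frame_fst)
qed

section \<open>Running time in terms of the input size\<close>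

lemma initial_mem_bounded:
  assumes "input_instance I"
  shows "bounded (input_size I) (initial_mem I)"
proof -
  let ?n = "card (points I)"
  have fin: "finite (facilities I)"
    using assms by (simp add: input_instance_def supplier_instance_def)
  have lt: "k < 2 ^ B" if "bits k \<le> B" for k B
    using that by (intro floorlog_leD) (auto simp: bits_def)
  have U: "bits (upper I u) \<le> (\<Sum>u\<in>facilities I. bits (upper I u))" if "u \<in> facilities I" for u
    using member_le_sum[of u "facilities I" "\<lambda>u. bits (upper I u)"] that fin by simp
  have *: "bits ?n \<le> input_size I" "bits (lower I) \<le> input_size I" "bits (quota I) \<le> input_size I"
    "\<And>u. u \<in> facilities I \<Longrightarrow> bits (upper I u) \<le> input_size I"
    using U by (auto simp: input_size_def Let_def intro: trans_le_add1 trans_le_add2)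
  have "1 \<le> input_size I" using *(1) by (simp add: bits_def)
  then have "Suc 0 < 2 ^ input_size I" by (metis One_nat_def power_one_right lt_power2_mono one_less_numeral_iff semiring_norm(76))
  then show ?thesis using *[THEN lt] unfolding bounded_def initial_mem_def Let_def by auto
qed

theorem compile_correct:
  assumes "wf_prog p" "input_instance I"
  shows "\<exists>t. exec (compile p) (initial_mem I) t (sem p (initial_mem I))"
  using wf_prog_poly[OF assms(1)] initial_mem_bounded[OF assms(2)] unfolding poly_prog_def by blast

theorem compile_polynomial_time:
  assumes "wf_prog p"
  shows "polynomial_time (compile p)"
proof -
  obtain q where q: "poly_prog q (compile p) (sem p)" using wf_prog_poly[OF assms] by blast
  show ?thesis
    unfolding polynomial_time_def
  \<comment> \<open>The input size bounds both \<open>n\<close> and the bit length of every cell, so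
    the argument of \<open>q\<close> is at most twice the input size.\<close>
  proof (intro exI[of _ "pcompose q [:0, 2:]"] allI impI)
    fix I assume I: "input_instance I"
    let ?z = "input_size I"
    have n: "fst (initial_mem I) ''n'' 0 \<le> ?z" by (simp add: initial_mem_def input_size_def Let_def)
    obtain t where t: "exec (compile p) (initial_mem I) t (sem p (initial_mem I))"
      "t \<le> poly q (?z + fst (initial_mem I) ''n'' 0)"
      using q initial_mem_bounded[OF I] unfolding poly_prog_def by blast
    have "t \<le> poly (pcompose q [:0, 2:]) ?z"
      using t(2) poly_nat_mono[of "?z + fst (initial_mem I) ''n'' 0" "2 * ?z" q] n
      by (simp add: poly_pcompose mult.commute)
    then show "\<exists>t s. exec (compile p) (initial_mem I) t s \<and> t \<le> poly (pcompose q [:0, 2:]) ?z"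
      using t(1) by blast
  qed
qed

section \<open>Clusters, blocks and the approximation guarantee\<close>

lemma card_fibres:
  assumes "finite A" "finite Q" "f ` A \<subseteq> Q"
  shows "card A = (\<Sum>q\<in>Q. card {x \<in> A. f x = q})"
proof -
  have "(\<Sum>q\<in>Q. \<Sum>x | x \<in> A \<and> f x = q. 1) = (\<Sum>x\<in>A. 1::nat)"
    using assms by (intro sum.group) auto
  then show ?thesis by simp
qed

text \<open>The common part cancels, and the maximum of \<open>e\<close> on \<open>S - W\<close>
  separates the rest: it bounds every term on \<open>S - W\<close> from above and every term on
  \<open>W - S\<close> from below, and \<open>W - S\<close> has at least as many elements.\<close>

lemma sum_le_sum_exchange:
  fixes e :: "'a \<Rightarrow> nat"
  assumes fin: "finite S" "finite W" and card: "card S \<le> card W"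
    and le: "\<And>x y. x \<in> S - W \<Longrightarrow> y \<in> W - S \<Longrightarrow> e x \<le> e y"
  shows "sum e S \<le> sum e W"
proof -
  have S: "card S = card (S - W) + card (S \<inter> W)" "sum e S = sum e (S - W) + sum e (S \<inter> W)"
    using fin by (auto simp: card_Diff_subset_Int card_mono sum.Int_Diff[of S e W])
  have W: "card W = card (W - S) + card (S \<inter> W)" "sum e W = sum e (W - S) + sum e (S \<inter> W)"
    using fin by (auto simp: card_Diff_subset_Int card_mono sum.Int_Diff[of W e S] Int_commute)
  have c: "card (S - W) \<le> card (W - S)" using card S W by simp
  have "sum e (S - W) \<le> sum e (W - S)"
  proof (cases "S - W = {}")
    case False
    define k where "k = Max (e ` (S - W))"
    have k: "k \<in> e ` (S - W)" unfolding k_def using False fin by (intro Max_in) auto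
    have "sum e (S - W) \<le> (\<Sum>x\<in>S - W. k)"
      unfolding k_def using fin by (intro sum_mono Max_ge) auto
    also have "\<dots> \<le> (\<Sum>x\<in>W - S. k)" using c by simp
    also have "\<dots> \<le> sum e (W - S)" using k le by (intro sum_mono) auto
    finally show ?thesis .
  next
    case True
    then show ?thesis by (simp only: sum.empty)
  qed
  then show ?thesis using S W by simp
qed

text \<open>With \<open>lower I = 0\<close> a copy may be opened without clients. Only nonempty
  groups matter, and these have at least \<open>max 1 (lower I)\<close> members; the maximum also
  keeps blocks nonempty and divisions by the block size meaningful.\<close>

definition lb :: "'a supplier \<Rightarrow> nat" where
  "lb I = max 1 (lower I)"

definition good :: "'a supplier \<Rightarrow> real \<Rightarrow> 'a \<Rightarrow> bool" where
  "good I r u \<longleftrightarrow> u \<in> facilities I \<and> lb I \<le> upper I u \<and>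
     lb I \<le> card {v \<in> clients I. distance I v u \<le> r}"

definition reach :: "'a supplier \<Rightarrow> real \<Rightarrow> 'a set" where
  "reach I r = {v \<in> clients I. \<exists>u. good I r u \<and> distance I v u \<le> r}"

section \<open>Facilities and clients at a fixed radius\<close>

locale radius =
  fixes I :: "'a supplier" and r :: real
  assumes inst: "supplier_instance I" and r0: "0 \<le> r"
begin

abbreviation "D \<equiv> distance I"
abbreviation "U \<equiv> upper I"

lemma fin: "finite (clients I)" "finite (facilities I)" "finite (reach I r)"
  using inst by (auto simp: supplier_instance_def reach_def)

lemma D_sym: "x \<in> points I \<Longrightarrow> y \<in> points I \<Longrightarrow> D x y = D y x"
  using inst by (auto simp: supplier_instance_def)

lemma D_tri: "x \<in> points I \<Longrightarrow> y \<in> points I \<Longrightarrow> z \<in> points I \<Longrightarrow> D x z \<le> D x y + D y z"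
  using inst by (auto simp: supplier_instance_def)

lemma lb_pos: "0 < lb I" by (simp add: lb_def)

lemma points_simps: "v \<in> clients I \<Longrightarrow> v \<in> points I" "u \<in> facilities I \<Longrightarrow> u \<in> points I"
  by (auto simp: points_def)

lemma good_points: "good I r u \<Longrightarrow> u \<in> points I" "good I r u \<Longrightarrow> u \<in> facilities I"
  by (auto simp: good_def points_def)

lemma reach_points: "v \<in> reach I r \<Longrightarrow> v \<in> points I" "v \<in> reach I r \<Longrightarrow> v \<in> clients I"
  by (auto simp: reach_def points_def)

lemma close_facilities:
  assumes "v \<in> clients I" "u \<in> points I" "w \<in> points I" "D v u \<le> r" "D v w \<le> r"
  shows "D u w \<le> 2 * r"
  using D_tri[of u v w] D_sym[of u v] assms points_simps(1)[of v] by auto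

text \<open>\<open>D u u = 0\<close> is not assumed; a client within \<open>r\<close> of
  \<open>u\<close> yields the bound through the triangle inequality. It makes \<open>u\<close>
  itself a competitor for \<open>m u\<close> and puts a selected facility among those that it
  covers.\<close>

lemma good_refl:
  assumes "good I r u"
  shows "D u u \<le> 2 * r"
proof -
  have "card {v \<in> clients I. D v u \<le> r} \<noteq> 0"
    using assms lb_pos unfolding good_def by linarith
  then have "{v \<in> clients I. D v u \<le> r} \<noteq> {}" by (metis card.empty)
  then obtain v where "v \<in> clients I" "D v u \<le> r" by auto
  then show ?thesis using close_facilities[of v u u] good_points[OF assms] by auto
qed

end

text \<open>\<open>m u\<close> is the facility of largest capacity within \<open>2r\<close> of \<open>u\<close>. The selected facilities are
  those with \<open>cov u = u\<close>; they form a forest with parents \<open>pa\<close> and roots \<open>ro\<close>.\<close>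

locale clustering = radius I r for I :: "'a supplier" and r +
  fixes m cov pa ro :: "'a \<Rightarrow> 'a"
  assumes m: "good I r u \<Longrightarrow> m u \<in> facilities I \<and> distance I u (m u) \<le> 2 * r"
    and m_max: "good I r u \<Longrightarrow> w \<in> facilities I \<Longrightarrow> distance I u w \<le> 2 * r \<Longrightarrow> upper I w \<le> upper I (m u)"
    and cov: "good I r u \<Longrightarrow> good I r (cov u) \<and> cov (cov u) = cov u \<and> distance I u (cov u) \<le> 2 * r"
    and separated: "good I r i \<Longrightarrow> cov i = i \<Longrightarrow> good I r j \<Longrightarrow> cov j = j \<Longrightarrow> i \<noteq> j \<Longrightarrow> 2 * r < distance I i j"
    and pa: "good I r i \<Longrightarrow> cov i = i \<Longrightarrow> ro i \<noteq> i \<Longrightarrow>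
      good I r (pa i) \<and> cov (pa i) = pa i \<and> distance I i (pa i) \<le> 4 * r \<and> ro (pa i) = ro i"
    and ro: "good I r i \<Longrightarrow> cov i = i \<Longrightarrow> good I r (ro i) \<and> cov (ro i) = ro i \<and> ro (ro i) = ro i"
    and ro_min: "good I r i \<Longrightarrow> cov i = i \<Longrightarrow> upper I (m (ro i)) \<le> upper I (m i)"
    and connected: "good I r u \<Longrightarrow> good I r w \<Longrightarrow> distance I u w \<le> 2 * r \<Longrightarrow> ro (cov u) = ro (cov w)"
begin

definition sel :: "'a \<Rightarrow> bool" where
  "sel i \<longleftrightarrow> good I r i \<and> cov i = i"

lemma sel_ro: "sel i \<Longrightarrow> sel (ro i) \<and> ro (ro i) = ro i"
  using ro by (auto simp: sel_def)

lemma sel_pa: "sel i \<Longrightarrow> ro i \<noteq> i \<Longrightarrow> sel (pa i) \<and> D i (pa i) \<le> 4 * r \<and> ro (pa i) = ro i"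
  using pa by (auto simp: sel_def)

lemma sel_points: "sel i \<Longrightarrow> i \<in> points I" "sel i \<Longrightarrow> m i \<in> points I" "sel i \<Longrightarrow> m i \<in> facilities I"
  using good_points m by (auto simp: sel_def points_def)

lemma m_lb: "good I r u \<Longrightarrow> lb I \<le> U (m u)"
  using m_max[of u u] good_refl[of u] by (auto simp: good_def)

end

text \<open>Two demands compete. A client in the \<open>r\<close>-ball of a selected facility must
  stay there, so that every node keeps \<open>lb I\<close> core clients; any other client follows
  the largest good facility within \<open>r\<close>, so that its home can compete with every group
  it may belong to.\<close>

locale homes = clustering I r m cov pa ro for I :: "'a supplier" and r m cov pa ro +
  fixes hm :: "'a \<Rightarrow> 'a"
  assumes home_core: "v \<in> reach I r \<Longrightarrow> good I r i \<Longrightarrow> cov i = i \<Longrightarrow> distance I v i \<le> r \<Longrightarrow> hm v = i"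
    and home_other: "v \<in> reach I r \<Longrightarrow>
      (good I r (hm v) \<and> cov (hm v) = hm v \<and> distance I v (hm v) \<le> r) \<or>
      (\<exists>u. good I r u \<and> distance I v u \<le> r \<and> hm v = cov u \<and>
         (\<forall>w. good I r w \<longrightarrow> distance I v w \<le> r \<longrightarrow> upper I w \<le> upper I u))"
begin

definition core :: "'a \<Rightarrow> bool" where
  "core v \<longleftrightarrow> D v (hm v) \<le> r"

lemma sel_hm: "v \<in> reach I r \<Longrightarrow> sel (hm v)"
  using home_other[of v] cov by (auto simp: sel_def)

lemma dist_hm:
  assumes "v \<in> reach I r"
  shows "D v (hm v) \<le> 3 * r"
  using home_other[OF assms]
proof
  assume "\<exists>u. good I r u \<and> D v u \<le> r \<and> hm v = cov u \<and>
         (\<forall>w. good I r w \<longrightarrow> D v w \<le> r \<longrightarrow> U w \<le> U u)"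
  then obtain u where u: "good I r u" "D v u \<le> r" "hm v = cov u" by auto
  have "D v (cov u) \<le> D v u + D u (cov u)"
    using u cov good_points reach_points assms by (intro D_tri) auto
  then show ?thesis using u cov[of u] by auto
qed (use r0 in auto)

text \<open>If \<open>v\<close> is a core client, its home is within \<open>2 * r\<close> of
  \<open>u\<close>, so \<open>u\<close> competes for \<open>m (hm v)\<close>. Otherwise the facility
  chosen for \<open>v\<close> is at least as large as \<open>u\<close> and competes for
  \<open>m\<close> of its cover. Both facilities share the client \<open>v\<close> within
  \<open>r\<close>, so \<open>connected\<close> puts them into one tree; as the tree depends on
  \<open>u\<close> only, a group of a solution never spreads over two trees.\<close>

lemma home_dominates:
  assumes v: "v \<in> reach I r" and u: "good I r u" "D v u \<le> r"
  shows "U u \<le> U (m (hm v))" and "ro (hm v) = ro (cov u)"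
proof -
  have vC: "v \<in> clients I" using v by (simp add: reach_def)
  have "U u \<le> U (m (hm v)) \<and> ro (hm v) = ro (cov u)"
    using home_other[OF v]
  proof
    assume h: "good I r (hm v) \<and> cov (hm v) = hm v \<and> D v (hm v) \<le> r"
    have "D (hm v) u \<le> 2 * r"
      using close_facilities[OF vC, of "hm v" u] h u good_points by auto
    then show ?thesis using m_max[of "hm v" u] connected[of "hm v" u] h u good_points by auto
  next
    assume "\<exists>u. good I r u \<and> D v u \<le> r \<and> hm v = cov u \<and>
         (\<forall>w. good I r w \<longrightarrow> D v w \<le> r \<longrightarrow> U w \<le> U u)"
    then obtain u' where u': "good I r u'" "D v u' \<le> r" "hm v = cov u'" "U u \<le> U u'"
      using u by auto
    have "D u' u \<le> 2 * r"
      using close_facilities[OF vC, of u' u] u u' good_points by auto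
    moreover have "D (cov u') u' \<le> 2 * r"
      using cov[OF u'(1)] D_sym[of u' "cov u'"] good_points u'(1) by auto
    ultimately show ?thesis
      using m_max[of "cov u'" u'] connected[of u' u] cov[OF u'(1)] u' u good_points by force
  qed
  then show "U u \<le> U (m (hm v))" "ro (hm v) = ro (cov u)" by auto
qed

text \<open>\<open>home_core\<close> leaves no choice for the clients in the \<open>r\<close>-ball
  of a selected facility, and goodness provides enough of them.\<close>

lemma core_card:
  assumes "sel i"
  shows "lb I \<le> card {v \<in> reach I r. hm v = i \<and> core v}"
proof -
  have "{v \<in> clients I. D v i \<le> r} \<subseteq> {v \<in> reach I r. hm v = i \<and> core v}"
  proof safe
    fix v assume v: "v \<in> clients I" "D v i \<le> r"
    then show vr: "v \<in> reach I r" using assms by (auto simp: reach_def sel_def)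
    show "hm v = i" using home_core[OF vr _ _ v(2)] assms by (auto simp: sel_def)
    then show "core v" using v by (simp add: core_def)
  qed
  then have "card {v \<in> clients I. D v i \<le> r} \<le> card {v \<in> reach I r. hm v = i \<and> core v}"
    using fin by (intro card_mono) auto
  then show ?thesis using assms by (simp add: sel_def good_def)
qed

end

text \<open>The members of block \<open>b\<close> are the clients \<open>v\<close> with \<open>bk0 v = Suc b\<close> before the surplus clients
  are inserted and with \<open>bk v = Suc b\<close> afterwards; a client with value 0 is not served.\<close>

locale blocks = homes I r m cov pa ro hm for I :: "'a supplier" and r m cov pa ro hm +
  fixes star :: "nat \<Rightarrow> 'a" and bk0 bk :: "'a \<Rightarrow> nat" and loc :: "nat \<Rightarrow> 'a"
  assumes star0: "v \<in> reach I r \<Longrightarrow> bk0 v = Suc b \<Longrightarrow>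
      sel (star b) \<and> (hm v = star b \<or> core v \<and> ro (hm v) \<noteq> hm v \<and> pa (hm v) = star b)"
    and card0: "v \<in> reach I r \<Longrightarrow> bk0 v = Suc b \<Longrightarrow> card {v \<in> reach I r. bk0 v = Suc b} = lb I"
    and rest0: "v \<in> reach I r \<Longrightarrow> bk0 v = 0 \<Longrightarrow> ro (hm v) = hm v"
    and rest0_card: "sel q \<Longrightarrow> card {v \<in> reach I r. bk0 v = 0 \<and> hm v = q} < lb I"
    and loc: "v \<in> reach I r \<Longrightarrow> bk0 v = Suc b \<Longrightarrow> \<exists>w\<in>reach I r. bk0 w = Suc b \<and> loc b = hm w"
    and loc_max: "v \<in> reach I r \<Longrightarrow> bk0 v = Suc b \<Longrightarrow> U (m (hm v)) \<le> U (m (loc b))"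
    and star: "v \<in> reach I r \<Longrightarrow> bk v = Suc b \<Longrightarrow> hm v = star b \<or>
      core v \<and> (ro (hm v) \<noteq> hm v \<and> pa (hm v) = star b \<or> ro (star b) \<noteq> star b \<and> pa (star b) = hm v)"
    and nonempty: "v \<in> reach I r \<Longrightarrow> bk v = Suc b \<Longrightarrow> \<exists>w\<in>reach I r. bk0 w = Suc b"
    and card_lb: "v \<in> reach I r \<Longrightarrow> bk0 v = Suc b \<Longrightarrow> lb I \<le> card {v \<in> reach I r. bk v = Suc b}"
    and card_ub: "v \<in> reach I r \<Longrightarrow> bk0 v = Suc b \<Longrightarrow> card {v \<in> reach I r. bk v = Suc b} \<le> U (m (loc b))"
    and full: "v \<in> reach I r \<Longrightarrow> bk v = 0 \<Longrightarrow> w \<in> reach I r \<Longrightarrow> bk0 w = Suc b \<Longrightarrow>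
      ro (star b) = ro (hm v) \<Longrightarrow> card {v \<in> reach I r. bk v = Suc b} = U (m (loc b))"
begin

lemma ro_star0: "v \<in> reach I r \<Longrightarrow> bk0 v = Suc b \<Longrightarrow> ro (star b) = ro (hm v)"
  using star0[of v b] sel_pa[of "hm v"] sel_hm[of v] by auto

lemma ro_star: 
  assumes "v \<in> reach I r" "bk v = Suc b"
  shows "ro (star b) = ro (hm v)"
proof -
  obtain w where "w \<in> reach I r" "bk0 w = Suc b" using nonempty assms by blast
  then have "sel (star b)" using star0 by blast
  then show ?thesis
    using star[OF assms] sel_pa[of "hm v"] sel_pa[of "star b"] sel_hm[of v] assms by auto
qed

lemma sel_loc:
  assumes "v \<in> reach I r" "bk0 v = Suc b"
  shows "sel (loc b)"
  using loc[OF assms] sel_hm by auto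

text \<open>A client of a core moves along at most two edges of the forest, any other client along at
  most one: \<open>r + 4r + 4r + 2r\<close> and \<open>3r + 4r + 2r\<close>.\<close>

lemma dist_loc:
  assumes v: "v \<in> reach I r" "bk v = Suc b"
  shows "D v (m (loc b)) \<le> 11 * r"
proof -
  obtain w where w: "w \<in> reach I r" "bk0 w = Suc b" "loc b = hm w"
    using nonempty[OF v] loc by blast
  let ?h = "hm v" and ?s = "star b" and ?l = "hm w"
  have sel: "sel ?h" "sel ?s" "sel ?l" using sel_hm v w star0 by auto
  note P = sel[THEN sel_points(1)] reach_points(1)[OF v(1)] sel_points(2)[OF sel(3)]
  \<comment> \<open>The location is the home of a member of the original block, hence the star or a
    child of it.\<close>
  have ls: "?l = ?s \<or> D ?s ?l \<le> 4 * r"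
    using star0[OF w(1,2)] sel_pa[OF sel(3)] D_sym[of ?l ?s] P by auto
  have hs: "?h = ?s \<or> D ?h ?s \<le> 4 * r"
    using star[OF v] sel_pa[OF sel(1)] sel_pa[OF sel(2)] D_sym[of ?s ?h] P by auto
  have t: "D v (m ?l) \<le> D v ?l + 2 * r"
    using D_tri[of v ?l "m ?l"] P m[of ?l] sel(3) by (auto simp: sel_def)
  have l: "D v ?l \<le> D v ?s + 4 * r"
    using ls D_tri[of v ?s ?l] P r0 by auto
  \<comment> \<open>Only core clients may sit in a star other than their home, so this edge never
    meets the home distance \<open>3 * r\<close> of the other clients.\<close>
  have s: "?h = ?s \<or> core v \<and> D v ?s \<le> D v ?h + 4 * r"
    using hs star[OF v] D_tri[of v ?h ?s] P by auto
  have "D v ?h \<le> 3 * r" "core v \<Longrightarrow> D v ?h \<le> r" using dist_hm v by (auto simp: core_def)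
  then show ?thesis unfolding w(3) using t l s r0 by auto
qed

section \<open>Comparison with an arbitrary solution of value at most \<open>r\<close>\<close>

lemma group_good:
  assumes S: "feasible I S" and c: "v \<in> served S" "assigned S v = (u, k)"
    and d: "\<And>v. v \<in> served S \<Longrightarrow> D v (fst (assigned S v)) \<le> r"
  shows "lb I \<le> card {v \<in> served S. assigned S v = (u, k)}"
    and "card {v \<in> served S. assigned S v = (u, k)} \<le> U u" and "good I r u"
proof -
  let ?G = "{v \<in> served S. assigned S v = (u, k)}"
  have o: "(u, k) \<in> open_copies S" using S c unfolding feasible_def by metis
  then have b: "lower I \<le> card ?G \<and> card ?G \<le> U u"
    using S unfolding feasible_def by blast
  have u: "u \<in> facilities I"
  proof -
    have "0 < count (opened S) u"
      using o by (auto simp: open_copies_def simp del: count_greater_zero_iff)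
    then have "u \<in># opened S" by (simp only: count_greater_zero_iff)
    then show ?thesis using S unfolding feasible_def by blast
  qed
  have sub: "?G \<subseteq> {v \<in> clients I. D v u \<le> r}"
  proof
    fix x assume x: "x \<in> ?G"
    then have "x \<in> clients I" using S[unfolded feasible_def, THEN conjunct1] by blast
    then show "x \<in> {v \<in> clients I. D v u \<le> r}" using d[of x] x by simp
  qed
  have "finite ?G" using sub fin by (auto intro: finite_subset)
  \<comment> \<open>Being nonempty raises the lower bound of the group from \<open>lower I\<close>
    to \<open>lb I\<close>.\<close>
  then have "0 < card ?G" using c by (auto simp: card_gt_0_iff)
  then show lbG: "lb I \<le> card ?G" using b by (simp add: lb_def)
  have "card ?G \<le> card {v \<in> clients I. D v u \<le> r}" using sub fin by (intro card_mono) auto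
  then show "good I r u" using lbG b u unfolding good_def by linarith
  show "card ?G \<le> U u" using b by simp
qed

text \<open>Each group stays within one tree, so the trees can be compared separately. In a tree,
  the first \<open>lb I\<close> places of the groups are matched by the number of blocks, and the
  places beyond them by the averaged excess capacities.\<close>

theorem served_dominates:
  assumes S: "feasible I S" and d: "\<And>v. v \<in> served S \<Longrightarrow> D v (fst (assigned S v)) \<le> r"
  shows "card (served S) \<le> card {v \<in> reach I r. bk v \<noteq> 0}"
proof -
  let ?R = "reach I r"
  let ?f = "\<lambda>v. ro (hm v)"
  have SR: "served S \<subseteq> ?R"
  proof
    fix v assume v: "v \<in> served S"
    obtain u k where uk: "assigned S v = (u, k)" by (cases "assigned S v")
    have "good I r u" using group_good(3)[OF S v uk d] by blast
    moreover have "v \<in> clients I" using S v by (auto simp: feasible_def)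
    ultimately show "v \<in> ?R" using d[OF v] uk by (auto simp: reach_def)
  qed
  have finS: "finite (served S)" using SR fin finite_subset by blast
  have tree: "card {v \<in> served S. ?f v = q} \<le> card {v \<in> {v \<in> ?R. bk v \<noteq> 0}. ?f v = q}"
    if q: "q \<in> ?f ` ?R" for q
  proof -
    let ?T = "{v \<in> ?R. ?f v = q}"
    let ?S = "{v \<in> served S. ?f v = q}"
    let ?B = "{b. \<exists>v\<in>?T. bk0 v = Suc b}"
    let ?W = "{v \<in> ?T. bk0 v \<noteq> 0}"
    let ?W' = "{v \<in> ?T. bk v \<noteq> 0}"
    have selq: "sel q" "ro q = q" using q sel_hm sel_ro by auto
    have "?B \<subseteq> (\<lambda>v. bk0 v - 1) ` ?T" by force
    then have finB: "finite ?B" by (rule finite_subset) (use fin in simp)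
    have cardW: "card ?W = card ?B * lb I"
    proof -
      have "card ?W = (\<Sum>b\<in>?B. card {v \<in> ?W. bk0 v - 1 = b})"
        using fin finB by (intro card_fibres) force+
      also have "\<dots> = (\<Sum>b\<in>?B. lb I)"
      proof (rule sum.cong)
        fix b assume "b \<in> ?B"
        then obtain w where w: "w \<in> ?R" "?f w = q" "bk0 w = Suc b" by auto
        have "{v \<in> ?W. bk0 v - 1 = b} = {v \<in> ?R. bk0 v = Suc b}"
          using ro_star0[OF w(1,3)] w(2) ro_star0 by force
        then show "card {v \<in> ?W. bk0 v - 1 = b} = lb I" using card0[OF w(1,3)] by simp
      qed simp
      finally show ?thesis by simp
    qed
    have cardW': "card ?W' = (\<Sum>b\<in>?B. card {v \<in> ?R. bk v = Suc b})"
    proof -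
      have "(\<lambda>v. bk v - 1) ` ?W' \<subseteq> ?B"
      proof
        fix b assume "b \<in> (\<lambda>v. bk v - 1) ` ?W'"
        then obtain v where v: "v \<in> ?R" "?f v = q" "bk v = Suc b" by force
        obtain w where w: "w \<in> ?R" "bk0 w = Suc b" using nonempty[OF v(1,3)] by blast
        then have "?f w = q" using ro_star0[OF w] ro_star[OF v(1,3)] v by simp
        then show "b \<in> ?B" using w by blast
      qed
      then have "card ?W' = (\<Sum>b\<in>?B. card {v \<in> ?W'. bk v - 1 = b})"
        using fin finB by (intro card_fibres) auto
      also have "\<dots> = (\<Sum>b\<in>?B. card {v \<in> ?R. bk v = Suc b})"
      proof (rule sum.cong)
        fix b assume "b \<in> ?B"
        then obtain w where w: "w \<in> ?R" "?f w = q" "bk0 w = Suc b" by auto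
        have "{v \<in> ?W'. bk v - 1 = b} = {v \<in> ?R. bk v = Suc b}"
          using ro_star0[OF w(1,3)] w(2) ro_star by force
        then show "card {v \<in> ?W'. bk v - 1 = b} = card {v \<in> ?R. bk v = Suc b}" by simp
      qed simp
      finally show ?thesis .
    qed
    have WT: "?W' = {v \<in> {v \<in> ?R. bk v \<noteq> 0}. ?f v = q}" by auto
    \<comment> \<open>Either the whole tree is served, or some client is left over; then
      \<open>full\<close> makes the number of served clients equal to the total capacity of the
      blocks.\<close>
    have "card ?S \<le> card ?W'"
    proof (cases "\<exists>v\<in>?T. bk v = 0")
      case False
      then have "?S \<subseteq> ?W'" using SR by auto
      then show ?thesis using fin by (intro card_mono) auto
    next
      case True
      then obtain v0 where v0: "v0 \<in> ?R" "?f v0 = q" "bk v0 = 0" by auto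
      have W'_full: "card ?W' = (\<Sum>b\<in>?B. U (m (loc b)))"
        unfolding cardW'
      proof (rule sum.cong)
        fix b assume "b \<in> ?B"
        then obtain w where w: "w \<in> ?R" "?f w = q" "bk0 w = Suc b" by auto
        show "card {v \<in> ?R. bk v = Suc b} = U (m (loc b))"
          by (rule full[OF v0(1,3) w(1,3)]) (use ro_star0[OF w(1,3)] w v0 in simp)
      qed simp
      define Q where "Q = assigned S ` ?S"
      have finQ: "finite Q" using finS by (simp add: Q_def)
      let ?G = "\<lambda>c. {v \<in> served S. assigned S v = c}"
      have G: "lb I \<le> card (?G c) \<and> card (?G c) \<le> U (fst c) \<and> good I r (fst c) \<and> ?G c \<subseteq> ?S \<and>
          (\<forall>v\<in>?G c. U (fst c) \<le> U (m (hm v)))" if c: "c \<in> Q" for c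
      proof -
        obtain u k where uk: "c = (u, k)" by (cases c)
        obtain v where v: "v \<in> served S" "?f v = q" "assigned S v = (u, k)"
          using c uk unfolding Q_def by auto
        note g = group_good[OF S v(1,3) d]
        have dom: "U u \<le> U (m (hm w)) \<and> ?f w = ro (cov u)" if "w \<in> ?G c" for w
          using home_dominates[of w u] that g(3) d[of w] SR uk by auto
        have "?f v = ro (cov u)" using dom[of v] v uk by auto
        then have "?G c \<subseteq> ?S" using dom v(2) by auto
        then show ?thesis using g dom uk by auto
      qed
      have card_S: "card ?S = (\<Sum>c\<in>Q. card (?G c))"
      proof -
        have "card ?S = (\<Sum>c\<in>Q. card {v \<in> ?S. assigned S v = c})"
          using finS finQ by (intro card_fibres) (auto simp: Q_def)
        also have "\<dots> = (\<Sum>c\<in>Q. card (?G c))"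
        proof (rule sum.cong)
          fix c assume "c \<in> Q"
          then have "{v \<in> ?S. assigned S v = c} = ?G c" using G[of c] by blast
          then show "card {v \<in> ?S. assigned S v = c} = card (?G c)" by simp
        qed simp
        finally show ?thesis .
      qed
      \<comment> \<open>A group may be much larger than a block. Choosing exactly
        \<open>lb I\<close> representatives gives groups and blocks equal weight in the
        averages.\<close>
      have "\<exists>H. H \<subseteq> ?G c \<and> card H = lb I" if "c \<in> Q" for c
        using obtain_subset_with_card_n[OF conjunct1[OF G[OF that]]] by metis
      then have "\<forall>c\<in>Q. \<exists>H. H \<subseteq> ?G c \<and> card H = lb I" by (rule ballI)
      from bchoice[OF this] obtain H where "\<forall>c\<in>Q. H c \<subseteq> ?G c \<and> card (H c) = lb I"
        by (rule exE)
      then have H: "H c \<subseteq> ?G c \<and> card (H c) = lb I" if "c \<in> Q" for c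
        using that by (rule bspec)
      have finH: "finite (H c)" if "c \<in> Q" for c
        using finite_subset[OF conjunct1[OF H[OF that]]] finS by simp
      have disjH: "H c \<inter> H c' = {}" if "c \<in> Q" "c' \<in> Q" "c \<noteq> c'" for c c'
        using H[OF that(1)] H[OF that(2)] that(3) by auto
      let ?H = "\<Union>c\<in>Q. H c"
      have cardH: "card ?H = card Q * lb I"
      proof -
        have "card ?H = (\<Sum>c\<in>Q. card (H c))"
          using finQ finH disjH by (intro card_UN_disjoint) auto
        also have "\<dots> = (\<Sum>c\<in>Q. lb I)" using H by (intro sum.cong) auto
        finally show ?thesis by simp
      qed
      have HG: "v \<in> ?G c" if "v \<in> H c" "c \<in> Q" for v c
        using that H[of c] by (rule_tac subsetD) auto
      have HS: "?H \<subseteq> ?S"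
      proof
        fix v assume "v \<in> ?H"
        then obtain c where c: "v \<in> H c" "c \<in> Q" by (rule UN_E)
        have "?G c \<subseteq> ?S" using G[OF c(2)] by (elim conjE)
        then show "v \<in> ?S" using HG[OF c] by (rule subsetD)
      qed
      \<comment> \<open>The groups need \<open>card Q * lb I\<close> different clients, whereas the
        tree has fewer than \<open>(card ?B + 1) * lb I\<close>: those in blocks and fewer than
        \<open>lb I\<close> others, all at home in the root.\<close>
      have QB: "card Q \<le> card ?B"
      proof -
        have "card Q * lb I \<le> card ?S"
          unfolding cardH[symmetric] using HS by (rule card_mono[rotated]) (use finS in simp)
        also have "\<dots> \<le> card ?T" using SR fin by (intro card_mono) auto
        also have "\<dots> = card ?W + card {v \<in> ?T. bk0 v = 0}"
          using fin by (subst card_Un_disjoint[symmetric]) (auto intro: arg_cong[where f=card])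
        also have "{v \<in> ?T. bk0 v = 0} = {v \<in> ?R. bk0 v = 0 \<and> hm v = q}"
          using rest0 selq by force
        also have "card ?W + card \<dots> < card ?B * lb I + lb I"
          using cardW rest0_card[OF selq(1)] by simp
        finally have "card Q * lb I < Suc (card ?B) * lb I" by simp
        then have "card Q < Suc (card ?B)" by (rule mult_less_cancel2[THEN iffD1, THEN conjunct2])
        then show ?thesis by (rule less_Suc_eq_le[THEN iffD1])
      qed
      let ?e = "\<lambda>v. U (m (hm v)) - lb I"
      \<comment> \<open>A representative outside the blocks has its home at the root
        \<open>q\<close>. By \<open>ro_min\<close> the root has the smallest capacity of its tree,
        so any block member is at least as good a substitute.\<close>
      have exch: "sum ?e ?H \<le> sum ?e ?W"
      proof (rule sum_le_sum_exchange)
        show "finite ?H" using finQ finH by blast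
        show "finite ?W" using fin by simp
        show "card ?H \<le> card ?W" unfolding cardH cardW using QB by (rule mult_right_mono) simp
        fix x y assume x: "x \<in> ?H - ?W" and y: "y \<in> ?W - ?H"
        have "x \<in> ?S" using x HS by blast
        then have x': "x \<in> ?R" "?f x = q" using SR by auto
        then have "hm x = q" using x rest0[of x] by auto
        moreover have "U (m (ro (hm y))) \<le> U (m (hm y))"
          using ro_min[of "hm y"] sel_hm[of y] y by (auto simp: sel_def)
        ultimately show "?e x \<le> ?e y" using y by (auto intro: diff_le_mono)
      qed
      \<comment> \<open>The excess of a group is written once for each representative, replaced by
        the excess of its home, moved to the block members, and collected there:
        \<open>loc_max\<close> bounds all \<open>lb I\<close> members of a block by its location.
        The common factor \<open>lb I\<close> cancels at the end.\<close>
      have "lb I * (\<Sum>c\<in>Q. U (fst c) - lb I) = (\<Sum>c\<in>Q. \<Sum>v\<in>H c. U (fst c) - lb I)"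
        unfolding sum_distrib_left using H by (intro sum.cong) auto
      also have "\<dots> \<le> (\<Sum>c\<in>Q. \<Sum>v\<in>H c. ?e v)"
      proof (intro sum_mono diff_le_mono)
        fix c v assume c: "c \<in> Q" "v \<in> H c"
        have "\<forall>v\<in>?G c. U (fst c) \<le> U (m (hm v))" using G[OF c(1)] by (elim conjE)
        then show "U (fst c) \<le> U (m (hm v))" using HG[OF c(2,1)] by (rule bspec)
      qed
      also have "\<dots> = sum ?e ?H"
        by (rule sum.UNION_disjoint[symmetric]) (use finQ finH disjH in auto)
      also have "\<dots> \<le> sum ?e ?W" by (rule exch)
      also have "\<dots> = (\<Sum>b\<in>?B. \<Sum>v | v \<in> ?W \<and> bk0 v - 1 = b. ?e v)"
        using fin finB by (intro sum.group[symmetric]) force+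
      also have "\<dots> \<le> (\<Sum>b\<in>?B. lb I * (U (m (loc b)) - lb I))"
      proof (rule sum_mono)
        fix b assume "b \<in> ?B"
        then obtain w where w: "w \<in> ?R" "?f w = q" "bk0 w = Suc b" by auto
        have eq: "{v. v \<in> ?W \<and> bk0 v - 1 = b} = {v \<in> ?R. bk0 v = Suc b}"
          using ro_star0[OF w(1,3)] w(2) ro_star0 by force
        have "(\<Sum>v | v \<in> ?W \<and> bk0 v - 1 = b. ?e v) \<le> (\<Sum>v\<in>{v \<in> ?R. bk0 v = Suc b}. U (m (loc b)) - lb I)"
          unfolding eq using loc_max by (intro sum_mono diff_le_mono) auto
        then show "(\<Sum>v | v \<in> ?W \<and> bk0 v - 1 = b. ?e v) \<le> lb I * (U (m (loc b)) - lb I)"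
          using card0[OF w(1,3)] by simp
      qed
      also have "\<dots> = lb I * (\<Sum>b\<in>?B. U (m (loc b)) - lb I)" by (simp add: sum_distrib_left)
      finally have ext: "(\<Sum>c\<in>Q. U (fst c) - lb I) \<le> (\<Sum>b\<in>?B. U (m (loc b)) - lb I)"
        using lb_pos by simp
      have "card ?S \<le> (\<Sum>c\<in>Q. lb I + (U (fst c) - lb I))"
        unfolding card_S
      proof (rule sum_mono)
        fix c assume "c \<in> Q"
        from G[OF this] show "card (?G c) \<le> lb I + (U (fst c) - lb I)" by (elim conjE) simp
      qed
      also have "\<dots> = card Q * lb I + (\<Sum>c\<in>Q. U (fst c) - lb I)" by (simp add: sum.distrib)
      also have "\<dots> \<le> card ?B * lb I + (\<Sum>b\<in>?B. U (m (loc b)) - lb I)"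
        using ext QB by (intro add_mono mult_right_mono) auto
      also have "\<dots> = (\<Sum>b\<in>?B. lb I + (U (m (loc b)) - lb I))" by (simp add: sum.distrib)
      \<comment> \<open>The truncated subtraction is exact here, because \<open>m_lb\<close> gives
        every location at least \<open>lb I\<close> places.\<close>
      also have "\<dots> = (\<Sum>b\<in>?B. U (m (loc b)))"
      proof (rule sum.cong)
        fix b assume "b \<in> ?B"
        then have "lb I \<le> U (m (loc b))" using sel_loc m_lb by (auto simp: sel_def)
        then show "lb I + (U (m (loc b)) - lb I) = U (m (loc b))" by simp
      qed simp
      finally show ?thesis using W'_full by simp
    qed
    then show ?thesis using WT by simp
  qed
  have "card (served S) = (\<Sum>q\<in>?f ` ?R. card {v \<in> served S. ?f v = q})"
    using finS fin SR by (intro card_fibres) auto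
  also have "\<dots> \<le> (\<Sum>q\<in>?f ` ?R. card {v \<in> {v \<in> ?R. bk v \<noteq> 0}. ?f v = q})"
    using tree by (rule sum_mono)
  also have "\<dots> = card {v \<in> ?R. bk v \<noteq> 0}"
    using fin by (intro card_fibres[symmetric]) auto
  finally show ?thesis .
qed

text \<open>The assumptions make \<open>(fa, ci)\<close> a bijection between the blocks in use and
  the opened copies, so the clients of a copy are exactly the members of one block and inherit its
  cardinality bounds.\<close>

theorem feasible_assignment:
  assumes quota: "quota I \<le> card {v \<in> reach I r. bk v \<noteq> 0}"
    and fa: "\<And>v b. v \<in> reach I r \<Longrightarrow> bk0 v = Suc b \<Longrightarrow> fa b = m (loc b) \<and> ci b < count M (fa b)"
    and inj: "\<And>v w b b'. v \<in> reach I r \<Longrightarrow> bk0 v = Suc b \<Longrightarrow> w \<in> reach I r \<Longrightarrow> bk0 w = Suc b' \<Longrightarrow>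
      fa b = fa b' \<Longrightarrow> ci b = ci b' \<Longrightarrow> b = b'"
    and surj: "\<And>u k. k < count M u \<Longrightarrow> \<exists>v\<in>reach I r. \<exists>b. bk0 v = Suc b \<and> fa b = u \<and> ci b = k"
    and S: "served S = {v \<in> reach I r. bk v \<noteq> 0}" "opened S = M"
      "\<And>v. v \<in> served S \<Longrightarrow> assigned S v = (fa (bk v - 1), ci (bk v - 1))"
  shows "feasible I S \<and> solution_value I S \<le> 11 * r"
proof
  let ?R = "reach I r"
  have members: "{v \<in> served S. assigned S v = (u, k)} = {v \<in> ?R. bk v = Suc b}"
    if w: "w \<in> ?R" "bk0 w = Suc b" and b: "fa b = u" "ci b = k" for w b u k
  proof (intro set_eqI iffI)
    fix v assume "v \<in> {v \<in> served S. assigned S v = (u, k)}"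
    then have vS: "v \<in> served S" "assigned S v = (u, k)" by auto
    then have v0: "v \<in> ?R" "bk v \<noteq> 0" using S(1) by auto
    then obtain b' where v: "v \<in> ?R" "bk v = Suc b'" using not0_implies_Suc by blast
    have a: "fa b' = u" "ci b' = k" using S(3)[OF vS(1)] vS(2) v(2) by auto
    obtain w' where "w' \<in> ?R" "bk0 w' = Suc b'" using nonempty[OF v] by blast
    then have "b = b'" using inj[OF w, of w' b'] b a by simp
    then show "v \<in> {v \<in> ?R. bk v = Suc b}" using v by simp
  next
    fix v assume v: "v \<in> {v \<in> ?R. bk v = Suc b}"
    then have "v \<in> served S" using S(1) by simp
    then show "v \<in> {v \<in> served S. assigned S v = (u, k)}" using S(3) v b by simp
  qed
  have dist: "D v (fst (assigned S v)) \<le> 11 * r" and op: "assigned S v \<in> open_copies S"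
    if v: "v \<in> served S" for v
  proof -
    have "v \<in> ?R" "bk v \<noteq> 0" using v S(1) by auto
    then obtain b where b: "v \<in> ?R" "bk v = Suc b" using not0_implies_Suc by blast
    obtain w where w: "w \<in> ?R" "bk0 w = Suc b" using nonempty[OF b] by blast
    have a: "assigned S v = (fa b, ci b)" using S(3)[OF v] b(2) by simp
    show "D v (fst (assigned S v)) \<le> 11 * r"
      unfolding a fst_conv fa[OF w, THEN conjunct1] by (rule dist_loc[OF b])
    show "assigned S v \<in> open_copies S" 
      unfolding a open_copies_def S(2) using fa[OF w, THEN conjunct2] by simp
  qed
  show "feasible I S"
    unfolding feasible_def
  proof (intro conjI ballI)
    show "served S \<subseteq> clients I" using S(1) by (auto simp: reach_def)
    show "quota I \<le> card (served S)" using quota S(1) by simp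
    show "set_mset (opened S) \<subseteq> facilities I"
    proof
      fix u assume "u \<in># opened S"
      then have "0 < count M u" using S by simp
      then obtain v b where "v \<in> ?R" "bk0 v = Suc b" "fa b = u" using surj by blast
      then show "u \<in> facilities I" using fa[of v b] sel_points(3)[OF sel_loc[of v b]] by simp
    qed
    show "assigned S v \<in> open_copies S" if "v \<in> served S" for v using op that .
    fix c assume c: "c \<in> open_copies S"
    obtain u k where uk: "c = (u, k)" by (cases c)
    have "k < count M u" using c S unfolding open_copies_def uk by auto
    then obtain w b where w: "w \<in> ?R" "bk0 w = Suc b" and b: "fa b = u" "ci b = k"
      using surj by blast
    have "lower I \<le> card {v \<in> ?R. bk v = Suc b}"
      using card_lb[OF w] by (simp add: lb_def)
    moreover have "card {v \<in> ?R. bk v = Suc b} \<le> U u"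
      using card_ub[OF w] fa[OF w] b by simp
    ultimately show "case c of (u, k) \<Rightarrow>
        lower I \<le> card {v \<in> served S. assigned S v = (u, k)} \<and>
        card {v \<in> served S. assigned S v = (u, k)} \<le> U u"
      using members[OF w b] uk by simp
  qed
  have "finite (served S)" using S fin by simp
  then show "solution_value I S \<le> 11 * r"
    using dist r0 by (auto simp: solution_value_def)
qed

end

section \<open>The program\<close>

definition eqb :: "nexp \<Rightarrow> nexp \<Rightarrow> bexp" where
  "eqb a b = Conj (Neg (NLess a b)) (Neg (NLess b a))"

definition orb :: "bexp \<Rightarrow> bexp \<Rightarrow> bexp" where
  "orb a b = Neg (Conj (Neg a) (Neg b))"

abbreviation nz :: "nexp \<Rightarrow> bexp" where "nz a \<equiv> NLess (NConst 0) a"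
abbreviation pred :: "nexp \<Rightarrow> nexp" where "pred a \<equiv> NSub a (NConst 1)"
abbreviation succ :: "nexp \<Rightarrow> nexp" where "succ a \<equiv> NAdd a (NConst 1)"
abbreviation pair :: "nexp \<Rightarrow> nexp \<Rightarrow> nexp" where "pair a b \<equiv> NAdd (NMul a (V ''n'')) b"
abbreviation assign :: "string \<Rightarrow> nexp \<Rightarrow> prog" where "assign x a \<equiv> PN x (NConst 0) a"
abbreviation radius_exp :: rexp where "radius_exp \<equiv> RRead ''r'' (NConst 0)"
abbreviation close :: "nexp \<Rightarrow> nexp \<Rightarrow> rexp \<Rightarrow> bexp" where
  "close a b e \<equiv> Neg (RLess e (RRead ''d'' (pair a b)))"

lemma bval_eqb [simp]: "bval (eqb a b) s \<longleftrightarrow> nval a s = nval b s"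
  by (auto simp: eqb_def)

lemma bval_orb [simp]: "bval (orb a b) s \<longleftrightarrow> bval a s \<or> bval b s"
  by (auto simp: orb_def)

lemma wf_eqb [simp]: "wf_bexp (eqb a b) \<longleftrightarrow> wf_nexp a \<and> wf_nexp b"
  by (auto simp: eqb_def)

lemma wf_orb [simp]: "wf_bexp (orb a b) \<longleftrightarrow> wf_bexp a \<and> wf_bexp b"
  by (auto simp: orb_def)

text \<open>The entries of \<open>cov\<close>, \<open>near\<close>, \<open>order\<close>, \<open>hm\<close>, \<open>st\<close> and \<open>bk\<close> and the scalar \<open>x\<close> are names plus one,
  with 0 for none. \<open>st v\<close> and \<open>sp v\<close> are the star of client \<open>v\<close> and its position there; entry \<open>p * n + k\<close> of
  \<open>ca\<close> is the client at position \<open>k\<close> of star \<open>p\<close>; \<open>rm p\<close> counts the clients that leave \<open>p\<close>, and later, at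
  a root, those that are not served yet; block \<open>p * n + i\<close> is the \<open>i\<close>-th block of star \<open>p\<close>.\<close>

definition count_clients :: prog where
  "count_clients = PFor ''v'' (PIf (Conj (nz (NRead ''client'' (V ''v''))) (close (V ''v'') (V ''u'') radius_exp))
     (assign ''c'' (succ (V ''c''))) PSkip)"

definition find_best :: prog where
  "find_best = PFor ''w''
     (PIf (Conj (nz (NRead ''facility'' (V ''w'')))
          (Conj (close (V ''u'') (V ''w'') (RAdd radius_exp radius_exp))
            (NLess (NRead ''U'' (NRead ''m'' (V ''u''))) (NRead ''U'' (V ''w'')))))
       (PN ''m'' (V ''u'') (V ''w'')) PSkip)"

text \<open>The same memory serves all radii. \<open>cov\<close>, \<open>near\<close>,
  \<open>len\<close> and \<open>cp\<close> are later only updated incrementally and must therefore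
  be reset.\<close>

definition prepare :: prog where
  "prepare = PFor ''u''
     (assign ''c'' (NConst 0) ;; count_clients ;;
      PN ''m'' (V ''u'') (V ''u'') ;; find_best ;;
      PIf (Conj (nz (NRead ''facility'' (V ''u'')))
          (Conj (Neg (NLess (NRead ''U'' (V ''u'')) (V ''l''))) (Neg (NLess (V ''c'') (V ''l'')))))
        (PN ''good'' (V ''u'') (NConst 1)) (PN ''good'' (V ''u'') (NConst 0)) ;;
      PN ''cov'' (V ''u'') (NConst 0) ;; PN ''near'' (V ''u'') (NConst 0) ;;
      PN ''len'' (V ''u'') (NConst 0) ;; PN ''cp'' (V ''u'') (NConst 0))"

text \<open>A facility marked in \<open>near\<close> beats every unmarked one, so a tree grows until
  no uncovered facility lies within \<open>4 * r\<close> of it. Only then does the smallest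
  \<open>U (m u)\<close> decide, which picks the next root; hence all marks in use refer to the
  current tree.\<close>

definition find_candidate :: prog where
  "find_candidate = PFor ''u''
     (PIf (Conj (nz (NRead ''good'' (V ''u''))) (eqb (NRead ''cov'' (V ''u'')) (NConst 0)))
       (PIf (orb (eqb (V ''x'') (NConst 0))
            (Conj (eqb (NRead ''near'' (pred (V ''x''))) (NConst 0))
              (orb (nz (NRead ''near'' (V ''u'')))
                (NLess (NRead ''U'' (NRead ''m'' (V ''u''))) (NRead ''U'' (NRead ''m'' (pred (V ''x''))))))))
         (assign ''x'' (succ (V ''u''))) PSkip)
       PSkip)"

definition cover :: prog where
  "cover = PFor ''w''
     (PIf (Conj (nz (NRead ''good'' (V ''w''))) (eqb (NRead ''cov'' (V ''w'')) (NConst 0)))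
       (PIf (close (V ''w'') (V ''y'') (RAdd radius_exp radius_exp))
         (PN ''cov'' (V ''w'') (succ (V ''y'')))
         (PIf (close (V ''w'') (V ''y'')
              (RAdd (RAdd radius_exp radius_exp) (RAdd radius_exp radius_exp)))
           (PN ''near'' (V ''w'') (succ (V ''y''))) PSkip))
       PSkip)"

definition link_node :: prog where
  "link_node =
     PIf (nz (NRead ''near'' (V ''y'')))
       (PN ''pa'' (V ''y'') (pred (NRead ''near'' (V ''y''))) ;;
        PN ''ro'' (V ''y'') (NRead ''ro'' (NRead ''pa'' (V ''y''))))
       (PN ''pa'' (V ''y'') (V ''y'') ;; PN ''ro'' (V ''y'') (V ''y''))"

definition grow_tree :: prog where
  "grow_tree = assign ''y'' (pred (V ''x'')) ;; link_node ;; cover"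

definition select_one :: prog where
  "select_one =
     assign ''x'' (NConst 0) ;; find_candidate ;; PN ''order'' (V ''t'') (V ''x'') ;;
     PIf (nz (V ''x'')) grow_tree PSkip"

definition select :: prog where
  "select = PFor ''t'' select_one"

definition nearest_good :: prog where
  "nearest_good = PFor ''u''
     (PIf (Conj (nz (NRead ''good'' (V ''u''))) (close (V ''v'') (V ''u'') radius_exp))
       (PIf (orb (eqb (V ''x'') (NConst 0)) (NLess (NRead ''U'' (pred (V ''x''))) (NRead ''U'' (V ''u''))))
         (assign ''x'' (succ (V ''u''))) PSkip)
       PSkip)"

definition nearest_core :: prog where
  "nearest_core = PFor ''u''
     (PIf (Conj (nz (NRead ''good'' (V ''u'')))
          (Conj (eqb (NRead ''cov'' (V ''u'')) (succ (V ''u''))) (close (V ''v'') (V ''u'') radius_exp)))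
       (PN ''hm'' (V ''v'') (succ (V ''u'')) ;; PN ''core'' (V ''v'') (NConst 1)) PSkip)"

definition find_home :: prog where
  "find_home =
     (PN ''st'' (V ''v'') (NConst 0) ;; PN ''hm'' (V ''v'') (NConst 0) ;; PN ''core'' (V ''v'') (NConst 0) ;;
      PIf (nz (NRead ''client'' (V ''v'')))
        (assign ''x'' (NConst 0) ;; nearest_good ;;
         PIf (nz (V ''x'')) (PN ''hm'' (V ''v'') (NRead ''cov'' (pred (V ''x'')))) PSkip ;;
         nearest_core)
        PSkip)"

definition find_homes :: prog where
  "find_homes = PFor ''v'' find_home"

text \<open>\<open>ca\<close> is written only in \<open>push_home\<close>. A client that is passed
  up keeps its entry in the row of its home, so \<open>ca (p * n + h)\<close> remains the
  \<open>h\<close>-th core client of \<open>p\<close> for the later walks.\<close>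

definition push :: "prog" where
  "push =
     PN ''st'' (V ''v'') (succ (V ''q'')) ;; PN ''sp'' (V ''v'') (NRead ''len'' (V ''q'')) ;;
     PN ''len'' (V ''q'') (succ (NRead ''len'' (V ''q'')))"

definition push_home :: "prog" where
  "push_home =
     assign ''q'' (pred (NRead ''hm'' (V ''v''))) ;;
     PN ''ca'' (pair (V ''q'') (NRead ''len'' (V ''q''))) (V ''v'') ;; push"

text \<open>Two passes put the core clients in front. The first \<open>lb I\<close> positions of a
  row then hold core clients only, and these are the ones that may leave or be moved by a
  walk.\<close>

definition push_clients :: prog where
  "push_clients =
     PFor ''v'' (PIf (nz (NRead ''core'' (V ''v''))) push_home PSkip) ;;
     PFor ''v'' (PIf (Conj (nz (NRead ''hm'' (V ''v''))) (eqb (NRead ''core'' (V ''v'')) (NConst 0))) push_home PSkip)"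

definition move_client :: prog where
  "move_client =
     (PIf (NLess (V ''k'') (NRead ''rm'' (V ''y'')))
       (assign ''v'' (NRead ''ca'' (pair (V ''y'') (V ''k''))) ;;
        PIf (eqb (NRead ''ro'' (V ''y'')) (V ''y''))
          (PN ''st'' (V ''v'') (NConst 0))
          (assign ''q'' (NRead ''pa'' (V ''y'')) ;; push))
       PSkip)"

definition pass_one :: prog where
  "pass_one = PFor ''k'' move_client"

text \<open>\<open>order\<close> is read backwards, so children come before their parents. The
  clients that leave are taken from the front; being fewer than \<open>lb I\<close>, they are core
  clients, and the positions that remain form an interval.\<close>

definition pass_node :: prog where
  "pass_node =
     (assign ''x'' (NRead ''order'' (NSub (V ''n'') (succ (V ''t'')))) ;;
      PIf (nz (V ''x''))
        (assign ''y'' (pred (V ''x'')) ;;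
         PN ''rm'' (V ''y'') (NMod (NRead ''len'' (V ''y'')) (V ''l'')) ;; pass_one)
        PSkip)"

definition pass_up :: prog where
  "pass_up = PFor ''t'' pass_node"

definition make_blocks :: prog where
  "make_blocks = PFor ''v''
     (PIf (nz (NRead ''st'' (V ''v'')))
       (assign ''q'' (pred (NRead ''st'' (V ''v''))) ;;
        PN ''bk'' (V ''v'') (succ (pair (V ''q'') (NDiv (NSub (NRead ''sp'' (V ''v'')) (NRead ''rm'' (V ''q''))) (V ''l'')))))
       (PN ''bk'' (V ''v'') (NConst 0)))"

definition find_location :: prog where
  "find_location = PFor ''v''
     (PIf (eqb (NRead ''bk'' (V ''v'')) (succ (V ''b'')))
       (PIf (orb (eqb (V ''x'') (NConst 0))
            (NLess (NRead ''U'' (NRead ''m'' (pred (NRead ''hm'' (pred (V ''x''))))))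
              (NRead ''U'' (NRead ''m'' (pred (NRead ''hm'' (V ''v'')))))))
         (assign ''x'' (succ (V ''v''))) PSkip)
       PSkip)"

definition open_block :: prog where
  "open_block =
     (assign ''b'' (pair (V ''s'') (V ''i'')) ;; assign ''x'' (NConst 0) ;; find_location ;;
      PIf (nz (V ''x''))
        (assign ''y'' (NRead ''m'' (pred (NRead ''hm'' (pred (V ''x''))))) ;;
         PN ''fa'' (V ''b'') (V ''y'') ;; PN ''ci'' (V ''b'') (NRead ''cp'' (V ''y'')) ;;
         PN ''cp'' (V ''y'') (succ (NRead ''cp'' (V ''y''))) ;;
         PN ''ex'' (V ''b'') (NSub (NRead ''U'' (V ''y'')) (V ''l'')))
        (PN ''ex'' (V ''b'') (NConst 0)))"

definition open_blocks :: prog where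
  "open_blocks = PFor ''s'' (PFor ''i'' open_block)"

text \<open>The walk to the root gives each core client with index \<open>h\<close> on the way the block of its
  predecessor.\<close>

definition walk_step :: prog where
  "walk_step =
     PIf (nz (V ''z''))
       (assign ''v'' (NRead ''ca'' (pair (V ''y'') (V ''h''))) ;;
        assign ''x'' (NRead ''bk'' (V ''v'')) ;; PN ''bk'' (V ''v'') (V ''c'') ;; assign ''c'' (V ''x'') ;;
        PIf (eqb (NRead ''ro'' (V ''y'')) (V ''y'')) (assign ''z'' (NConst 0))
          (assign ''y'' (NRead ''pa'' (V ''y''))))
       PSkip"

definition walk :: prog where
  "walk = PFor ''j'' walk_step"

definition insert_one :: prog where
  "insert_one =
     assign ''q'' (NRead ''ro'' (V ''s'')) ;;
     PIf (Conj (NLess (V ''k'') (NRead ''ex'' (V ''b''))) (nz (NRead ''rm'' (V ''q''))))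
       (assign ''h'' (pred (NRead ''rm'' (V ''q''))) ;; PN ''rm'' (V ''q'') (V ''h'') ;;
        assign ''c'' (succ (V ''b'')) ;; assign ''y'' (V ''s'') ;; assign ''z'' (NConst 1) ;; walk)
       PSkip"

definition insert_surplus :: prog where
  "insert_surplus =
     PFor ''s'' (PFor ''i'' (assign ''b'' (pair (V ''s'') (V ''i'')) ;; PFor ''k'' insert_one))"

definition count_served :: prog where
  "count_served = assign ''c'' (NConst 0) ;;
     PFor ''v'' (PIf (nz (NRead ''bk'' (V ''v''))) (assign ''c'' (succ (V ''c''))) PSkip)"

definition copy_solution :: prog where
  "copy_solution = PFor ''v''
     (PIf (nz (NRead ''bk'' (V ''v''))) (PN ''served'' (V ''v'') (NConst 1)) (PN ''served'' (V ''v'') (NConst 0)) ;;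
      PN ''center'' (V ''v'') (NRead ''fa'' (pred (NRead ''bk'' (V ''v'')))) ;;
      PN ''copy'' (V ''v'') (NRead ''ci'' (pred (NRead ''bk'' (V ''v'')))) ;;
      PN ''copies'' (V ''v'') (NRead ''cp'' (V ''v'')))"

definition commit :: prog where
  "commit = count_served ;;
     PIf (Conj (Neg (NLess (V ''c'') (V ''p'')))
          (orb (eqb (V ''found'') (NConst 0)) (RLess radius_exp (RRead ''best'' (NConst 0)))))
       (assign ''found'' (NConst 1) ;; PR ''best'' (NConst 0) radius_exp ;; copy_solution)
       PSkip"

definition try_radius :: prog where
  "try_radius = prepare ;; select ;; find_homes ;; push_clients ;; pass_up ;; make_blocks ;;
     open_blocks ;; insert_surplus"

text \<open>The value of a solution that serves someone is a distance between two points, so the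
  entries of \<open>''d''\<close> are all the radii needed. Quota 0 is separate because the optimum
  is then 0, which need not occur among the distances; the zero-initialised output already is the
  empty solution.\<close>

definition algorithm :: prog where
  "algorithm =
     PIf (nz (V ''L'')) (assign ''l'' (V ''L'')) (assign ''l'' (NConst 1)) ;;
     PIf (nz (V ''p''))
       (PFor ''f'' (PFor ''g''
         (PR ''r'' (NConst 0) (RRead ''d'' (pair (V ''f'') (V ''g''))) ;; try_radius ;; commit)))
       PSkip"

lemmas program_defs = count_clients_def find_best_def prepare_def find_candidate_def cover_def
  link_node_def grow_tree_def select_one_def select_def nearest_good_def nearest_core_def find_home_def find_homes_def push_def push_home_def
  push_clients_def move_client_def pass_one_def pass_node_def pass_up_def make_blocks_def find_location_def open_block_def open_blocks_def
  walk_step_def walk_def insert_one_def insert_surplus_def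
  count_served_def copy_solution_def commit_def try_radius_def algorithm_def

lemma wf_algorithm: "wf_prog algorithm"
  unfolding program_defs by simp

section \<open>Good facilities\<close>

text \<open>Computed once, these sets discharge the frame conditions of all later arguments without
  unfolding the programs.\<close>

lemma nwrites_simps [simp]:
  "nwrites count_clients = {''v'', ''c''}"
  "nwrites find_best = {''w'', ''m''}"
  "nwrites prepare = {''u'', ''v'', ''w'', ''c'', ''m'', ''good'', ''cov'', ''near'', ''len'', ''cp''}"
  "nwrites find_candidate = {''u'', ''x''}"
  "nwrites cover = {''w'', ''cov'', ''near''}"
  "nwrites grow_tree = {''w'', ''y'', ''pa'', ''ro'', ''cov'', ''near''}"
  "nwrites select_one = {''u'', ''w'', ''x'', ''y'', ''order'', ''pa'', ''ro'', ''cov'', ''near''}"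
  "nwrites select = {''t'', ''u'', ''w'', ''x'', ''y'', ''order'', ''pa'', ''ro'', ''cov'', ''near''}"
  "nwrites nearest_good = {''u'', ''x''}"
  "nwrites nearest_core = {''u'', ''hm'', ''core''}"
  "nwrites find_home = {''u'', ''x'', ''st'', ''hm'', ''core''}"
  "nwrites find_homes = {''v'', ''u'', ''x'', ''st'', ''hm'', ''core''}"
  "nwrites push = {''st'', ''sp'', ''len''}"
  "nwrites push_home = {''q'', ''ca'', ''st'', ''sp'', ''len''}"
  "nwrites push_clients = {''v'', ''q'', ''ca'', ''st'', ''sp'', ''len''}"
  "nwrites move_client = {''v'', ''q'', ''st'', ''sp'', ''len''}"
  "nwrites pass_node = {''x'', ''y'', ''rm'', ''k'', ''v'', ''q'', ''st'', ''sp'', ''len''}"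
  "nwrites pass_one = {''k'', ''v'', ''q'', ''st'', ''sp'', ''len''}"
  "nwrites pass_up = {''t'', ''x'', ''y'', ''rm'', ''k'', ''v'', ''q'', ''st'', ''sp'', ''len''}"
  "nwrites make_blocks = {''v'', ''q'', ''bk''}"
  "nwrites find_location = {''v'', ''x''}"
  "nwrites open_block = {''b'', ''v'', ''x'', ''y'', ''fa'', ''ci'', ''cp'', ''ex''}"
  "nwrites open_blocks = {''s'', ''i'', ''b'', ''v'', ''x'', ''y'', ''fa'', ''ci'', ''cp'', ''ex''}"
  "nwrites walk_step = {''v'', ''x'', ''bk'', ''c'', ''z'', ''y''}"
  "nwrites insert_one = {''q'', ''h'', ''rm'', ''j'', ''v'', ''x'', ''bk'', ''c'', ''z'', ''y''}"
  "nwrites walk = {''j'', ''v'', ''x'', ''bk'', ''c'', ''z'', ''y''}"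
  "nwrites insert_surplus =
     {''s'', ''i'', ''b'', ''k'', ''q'', ''h'', ''rm'', ''j'', ''v'', ''x'', ''bk'', ''c'', ''z'', ''y''}"
  unfolding program_defs by auto

lemma rwrites_simps [simp]:
  "rwrites count_clients = {}" "rwrites find_best = {}" "rwrites prepare = {}"
  "rwrites find_candidate = {}" "rwrites cover = {}" "rwrites select = {}"
  "rwrites nearest_good = {}" "rwrites nearest_core = {}" "rwrites find_homes = {}"
  "rwrites push = {}" "rwrites push_home = {}" "rwrites push_clients = {}"
  "rwrites pass_one = {}" "rwrites pass_up = {}" "rwrites make_blocks = {}"
  "rwrites find_location = {}" "rwrites open_blocks = {}" "rwrites walk = {}"
  "rwrites insert_surplus = {}" "rwrites grow_tree = {}" "rwrites select_one = {}"
  "rwrites find_home = {}" "rwrites move_client = {}" "rwrites pass_node = {}"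
  "rwrites open_block = {}" "rwrites walk_step = {}" "rwrites insert_one = {}"
  unfolding program_defs by auto

definition inputs :: "nat supplier \<Rightarrow> real \<Rightarrow> mem \<Rightarrow> bool" where
  "inputs I r s \<longleftrightarrow>
     fst s ''n'' 0 = card (points I) \<and> fst s ''l'' 0 = lb I \<and> snd s ''r'' 0 = r \<and>
     (\<forall>v. 0 < fst s ''client'' v \<longleftrightarrow> v \<in> clients I) \<and>
     (\<forall>u. 0 < fst s ''facility'' u \<longleftrightarrow> u \<in> facilities I) \<and>
     (\<forall>u\<in>facilities I. fst s ''U'' u = upper I u) \<and>
     (\<forall>a<card (points I). \<forall>b<card (points I). snd s ''d'' (a * card (points I) + b) = distance I a b)"

lemma inputsD:
  assumes "inputs I r s"
  shows "fst s ''n'' 0 = card (points I)" "fst s ''l'' 0 = lb I" "snd s ''r'' 0 = r"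
    "0 < fst s ''client'' v \<longleftrightarrow> v \<in> clients I"
    "0 < fst s ''facility'' u \<longleftrightarrow> u \<in> facilities I"
    "u \<in> facilities I \<Longrightarrow> fst s ''U'' u = upper I u"
    "a < card (points I) \<Longrightarrow> b < card (points I) \<Longrightarrow>
      snd s ''d'' (a * card (points I) + b) = distance I a b"
  using assms by (auto simp: inputs_def)

lemma inputs_frame:
  assumes "inputs I r s"
    and "\<And>x. x \<in> {''n'', ''l'', ''client'', ''facility'', ''U''} \<Longrightarrow> fst t x = fst s x"
    and "\<And>x. x \<in> {''r'', ''d''} \<Longrightarrow> snd t x = snd s x"
  shows "inputs I r t"
  using assms by (simp add: inputs_def)

lemma inputs_sem:
  assumes "inputs I r s"
    and "nwrites p \<inter> {''n'', ''l'', ''client'', ''facility'', ''U''} = {}"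
    and "rwrites p \<inter> {''r'', ''d''} = {}"
  shows "inputs I r (sem p s)"
  using assms by (auto intro!: inputs_frame[of I r s] sem_frame_fst sem_frame_snd)

locale input = radius I r for I :: "nat supplier" and r +
  assumes input: "input_instance I"
begin

abbreviation "n \<equiv> card (points I)"

lemma points_iff: "u \<in> points I \<longleftrightarrow> u < n"
  using input by (auto simp: input_instance_def)

lemma client_less: "v \<in> clients I \<Longrightarrow> v < n"
  using points_iff by (auto simp: points_def)

lemma facility_less: "u \<in> facilities I \<Longrightarrow> u < n"
  using points_iff by (auto simp: points_def)

lemma good_less: "good I r u \<Longrightarrow> u < n"
  using good_points points_iff by auto

lemma reach_less: "v \<in> reach I r \<Longrightarrow> v < n"
  using reach_points points_iff by auto

lemma Collect_less_Suc:
  "{v \<in> A. v < Suc k \<and> P v} = (if k \<in> A \<and> P k then insert k {v \<in> A. v < k \<and> P v} else {v \<in> A. v < k \<and> P v})"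
  by (auto simp: less_Suc_eq)

lemma sem_count_clients:
  assumes s: "inputs I r s" and u: "fst s ''u'' 0 = u" "u < n" and c: "fst s ''c'' 0 = 0"
  shows "fst (sem count_clients s) ''c'' 0 = card {v \<in> clients I. D v u \<le> r}"
proof -
  let ?P = "\<lambda>k t. fst t ''c'' 0 = card {v \<in> clients I. v < k \<and> D v u \<le> r}"
  have "?P (fst s ''n'' 0) (sem count_clients s)"
    unfolding count_clients_def
  proof (rule sem_For_invariant[where P = ?P], goal_cases)
    case (3 k t)
    have t: "inputs I r t" using s by (rule inputs_frame) (auto simp: 3)
    have k: "k < n" using 3 inputsD[OF s] by simp
    have "finite {v \<in> clients I. v < k \<and> D v u \<le> r}" using fin by auto
    then show ?case
      using 3(2,5) u k inputsD[OF t] 3(3)[of "''u''"] by (auto simp: fst_nwrite Collect_less_Suc)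
  qed (auto simp: c fst_nwrite)
  moreover have "{v \<in> clients I. v < n \<and> D v u \<le> r} = {v \<in> clients I. D v u \<le> r}"
    using client_less by auto
  ultimately show ?thesis using inputsD[OF s] by simp
qed

lemma sem_find_best:
  assumes s: "inputs I r s" and u: "fst s ''u'' 0 = u" "u \<in> facilities I" "D u u \<le> 2 * r"
    and m: "fst s ''m'' u = u"
  shows "fst (sem find_best s) ''m'' u \<in> facilities I \<and> D u (fst (sem find_best s) ''m'' u) \<le> 2 * r \<and>
    (\<forall>w\<in>facilities I. D u w \<le> 2 * r \<longrightarrow> U w \<le> U (fst (sem find_best s) ''m'' u))"
proof -
  let ?P = "\<lambda>k t. fst t ''m'' u \<in> facilities I \<and> D u (fst t ''m'' u) \<le> 2 * r \<and>
    (\<forall>w\<in>facilities I. w < k \<longrightarrow> D u w \<le> 2 * r \<longrightarrow> U w \<le> U (fst t ''m'' u))"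
  have "?P (fst s ''n'' 0) (sem find_best s)"
    unfolding find_best_def
  proof (rule sem_For_invariant[where P = ?P], goal_cases)
    case (3 k t)
    have t: "inputs I r t" using s by (rule inputs_frame) (auto simp: 3)
    have k: "k < n" using 3 inputsD[OF s] by simp
    have u': "u < n" using u facility_less by simp
    show ?case
      using 3(2,5) u u' k inputsD[OF t] 3(3)[of "''u''"]
      by (auto simp: fst_nwrite less_Suc_eq intro: order_trans less_imp_le)
  qed (use m u in \<open>auto simp: fst_nwrite\<close>)
  then show ?thesis using inputsD[OF s] facility_less by auto
qed

lemma sem_find_best_other: "x \<noteq> fst s ''u'' 0 \<Longrightarrow> fst (sem find_best s) ''m'' x = fst s ''m'' x"
proof -
  assume x: "x \<noteq> fst s ''u'' 0"
  let ?P = "\<lambda>k t. fst t ''m'' x = fst s ''m'' x"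
  have "?P (fst s ''n'' 0) (sem find_best s)"
    unfolding find_best_def
  proof (rule sem_For_invariant[where P = ?P], goal_cases)
    case (3 k t)
    then show ?case using x 3(3)[of "''u''"] by (auto simp: fst_nwrite)
  qed (auto simp: fst_nwrite)
  then show ?thesis by simp
qed

definition prepared :: "nat \<Rightarrow> mem \<Rightarrow> bool" where
  "prepared k s \<longleftrightarrow> (\<forall>u<k. (0 < fst s ''good'' u \<longleftrightarrow> good I r u) \<and>
     fst s ''cov'' u = 0 \<and> fst s ''near'' u = 0 \<and> fst s ''len'' u = 0 \<and> fst s ''cp'' u = 0 \<and>
     (good I r u \<longrightarrow> fst s ''m'' u \<in> facilities I \<and> D u (fst s ''m'' u) \<le> 2 * r \<and>
        (\<forall>w\<in>facilities I. D u w \<le> 2 * r \<longrightarrow> U w \<le> U (fst s ''m'' u))))"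

lemma sem_prepare:
  assumes s: "inputs I r s"
  shows "prepared n (sem prepare s)"
proof -
  have "prepared (fst s ''n'' 0) (sem prepare s)"
    unfolding prepare_def
  proof (rule sem_For_invariant[where P = prepared], goal_cases)
    case (3 k t)
    have t: "inputs I r t" using s by (rule inputs_frame) (auto simp: 3)
    have k: "k < n" using 3 inputsD[OF s] by simp
    define t1 where "t1 = sem (assign ''c'' (NConst 0)) t"
    define t2 where "t2 = sem count_clients t1"
    define t3 where "t3 = sem (PN ''m'' (V ''u'') (V ''u'')) t2"
    define t4 where "t4 = sem find_best t3"
    have t1: "inputs I r t1" using t unfolding t1_def by (rule inputs_sem) auto
    have t3: "inputs I r t3" unfolding t3_def t2_def by (rule inputs_sem, rule inputs_sem[OF t1]) auto
    have t4: "inputs I r t4" unfolding t4_def by (rule inputs_sem[OF t3]) auto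
    have u1: "fst t1 ''u'' 0 = k" "fst t1 ''c'' 0 = 0" using 3(2) by (auto simp: t1_def fst_nwrite)
    have u2: "fst t2 ''u'' 0 = k" "fst t2 ''c'' 0 = card {v \<in> clients I. D v k \<le> r}"
      using u1 sem_count_clients[OF t1 u1(1) k u1(2)] by (auto simp: t2_def sem_frame_fst)
    have u3: "fst t3 ''u'' 0 = k" "fst t3 ''c'' 0 = card {v \<in> clients I. D v k \<le> r}" "fst t3 ''m'' k = k"
      "\<And>x. x \<noteq> k \<Longrightarrow> fst t3 ''m'' x = fst t ''m'' x"
      using u2 by (auto simp: t3_def fst_nwrite t2_def t1_def sem_frame_fst)
    have u4: "fst t4 ''u'' 0 = k" "fst t4 ''c'' 0 = card {v \<in> clients I. D v k \<le> r}"
      "\<And>x. x \<noteq> k \<Longrightarrow> fst t4 ''m'' x = fst t ''m'' x"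
      using u3 sem_find_best_other[of _ t3] by (auto simp: t4_def sem_frame_fst)
    have other: "fst t4 x = fst t x" if "x \<in> {''good'', ''cov'', ''near'', ''len'', ''cp''}" for x
      using that by (auto simp: t4_def t3_def t2_def t1_def sem_frame_fst fst_nwrite)
    have m: "fst t4 ''m'' k \<in> facilities I \<and> D k (fst t4 ''m'' k) \<le> 2 * r \<and>
        (\<forall>w\<in>facilities I. D k w \<le> 2 * r \<longrightarrow> U w \<le> U (fst t4 ''m'' k))" if "good I r k"
      unfolding t4_def using good_points(2)[OF that] good_refl[OF that] u3 by (intro sem_find_best[OF t3]) auto
    show ?case
      unfolding sem.simps(4) t1_def[symmetric] t2_def[symmetric] t3_def[symmetric] t4_def[symmetric]
      using 3(5) u4 other m inputsD[OF t4]
      by (auto simp: prepared_def fst_nwrite less_Suc_eq good_def[of I r k])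
  qed (auto simp: prepared_def fst_nwrite program_defs)
  then show ?thesis using inputsD[OF s] by simp
qed

end

section \<open>Growing the trees\<close>

definition uncovered :: "nat supplier \<Rightarrow> real \<Rightarrow> (nat \<Rightarrow> nat) \<Rightarrow> nat \<Rightarrow> bool" where
  "uncovered I r cv u \<longleftrightarrow> good I r u \<and> cv u = 0"

definition chosen_by :: "nat supplier \<Rightarrow> real \<Rightarrow> (nat \<Rightarrow> nat) \<Rightarrow> nat \<Rightarrow> bool" where
  "chosen_by I r cv i \<longleftrightarrow> good I r i \<and> cv i = Suc i"

context input
begin

abbreviation "unc \<equiv> uncovered I r"
abbreviation "chosen \<equiv> chosen_by I r"

text \<open>The entry 0 stands for a round without a candidate. That parents precede their children
  later justifies the processing order and the ranking of the nodes. The last clause counts down: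
  each round with a candidate covers at least that candidate.\<close>

definition listed :: "nat \<Rightarrow> (nat \<Rightarrow> nat) \<Rightarrow> (nat \<Rightarrow> nat) \<Rightarrow> (nat \<Rightarrow> nat) \<Rightarrow> (nat \<Rightarrow> nat) \<Rightarrow> bool" where
  "listed t cv pa ro od \<longleftrightarrow>
     (\<forall>k<t. od k \<noteq> 0 \<longrightarrow> chosen cv (od k - 1)) \<and>
     (\<forall>i. chosen cv i \<longrightarrow> (\<exists>k<t. od k = Suc i)) \<and>
     (\<forall>k<t. \<forall>k'<t. od k = od k' \<longrightarrow> od k \<noteq> 0 \<longrightarrow> k = k') \<and>
     (\<forall>k<t. \<forall>i. od k = Suc i \<longrightarrow> ro i \<noteq> i \<longrightarrow> (\<exists>k'<k. od k' = Suc (pa i))) \<and>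
     card {u. unc cv u} \<le> n - t"

lemma finite_unc: "finite {u. unc cv u}"
  by (rule finite_subset[of _ "{..<n}"]) (auto simp: uncovered_def good_less)

lemma good_sym: "good I r u \<Longrightarrow> good I r w \<Longrightarrow> D u w = D w u"
  by (intro D_sym good_points)

lemma good_tri: "good I r u \<Longrightarrow> good I r w \<Longrightarrow> good I r x \<Longrightarrow> D u x \<le> D u w + D w x"
  by (intro D_tri good_points)

end

text \<open>\<open>q\<close> is the root of the tree that is being grown.\<close>

locale growing = input I r for I :: "nat supplier" and r +
  fixes m cv nr pa ro :: "nat \<Rightarrow> nat" and q :: nat
  assumes covered: "good I r u \<Longrightarrow> cv u \<noteq> 0 \<Longrightarrow> chosen_by I r cv (cv u - 1) \<and> distance I u (cv u - 1) \<le> 2 * r"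
    and apart: "chosen_by I r cv i \<Longrightarrow> chosen_by I r cv j \<Longrightarrow> i \<noteq> j \<Longrightarrow> 2 * r < distance I i j"
    and uncovered_apart: "uncovered I r cv u \<Longrightarrow> chosen_by I r cv i \<Longrightarrow> 2 * r < distance I u i"
    and not_near: "uncovered I r cv u \<Longrightarrow> nr u = 0 \<Longrightarrow> chosen_by I r cv i \<Longrightarrow> 4 * r < distance I u i"
    and near_tree: "uncovered I r cv u \<Longrightarrow> nr u \<noteq> 0 \<Longrightarrow> chosen_by I r cv (nr u - 1) \<and> distance I u (nr u - 1) \<le> 4 * r \<and> ro (nr u - 1) = q"
    and root: "chosen_by I r cv i \<Longrightarrow> chosen_by I r cv (ro i) \<and> ro (ro i) = ro i \<and> upper I (m (ro i)) \<le> upper I (m i)"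
    and parent: "chosen_by I r cv i \<Longrightarrow> ro i \<noteq> i \<Longrightarrow> chosen_by I r cv (pa i) \<and> distance I i (pa i) \<le> 4 * r \<and> ro (pa i) = ro i"
    and frontier: "good I r u \<Longrightarrow> cv u \<noteq> 0 \<Longrightarrow> uncovered I r cv w \<Longrightarrow> distance I u w \<le> 2 * r \<Longrightarrow> ro (cv u - 1) = q"
    and root_least: "uncovered I r cv u \<Longrightarrow> chosen_by I r cv i \<Longrightarrow> ro i = q \<Longrightarrow> upper I (m q) \<le> upper I (m u)"
    and same_tree: "good I r u \<Longrightarrow> cv u \<noteq> 0 \<Longrightarrow> good I r w \<Longrightarrow> cv w \<noteq> 0 \<Longrightarrow> distance I u w \<le> 2 * r \<Longrightarrow>
        ro (cv u - 1) = ro (cv w - 1)"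

locale growing_step = growing I r m cv nr pa ro q for I :: "nat supplier" and r m cv nr pa ro q +
  fixes y :: nat
  assumes y: "unc cv y"
    and cand: "nr y \<noteq> 0 \<or> (\<forall>u. unc cv u \<longrightarrow> nr u = 0 \<and> U (m y) \<le> U (m u))"
begin

definition cv' where "cv' w = (if unc cv w \<and> D w y \<le> 2 * r then Suc y else cv w)"
definition nr' where "nr' w = (if unc cv w \<and> \<not> D w y \<le> 2 * r \<and> D w y \<le> 4 * r then Suc y else nr w)"
definition pa' where "pa' = pa(y := if nr y \<noteq> 0 then nr y - 1 else y)"
definition ro' where "ro' = ro(y := if nr y \<noteq> 0 then ro (nr y - 1) else y)"
definition q' where "q' = (if nr y \<noteq> 0 then q else y)"

lemma good_y: "good I r y" using y by (simp add: uncovered_def)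

lemma chosen_cv': "chosen cv' i \<longleftrightarrow> chosen cv i \<or> i = y"
  using y good_refl[OF good_y] by (auto simp: chosen_by_def cv'_def uncovered_def)

lemma unc_cv': "unc cv' u \<longleftrightarrow> unc cv u \<and> 2 * r < D u y"
  by (auto simp: uncovered_def cv'_def)

lemma chosen_ne: "chosen cv i \<Longrightarrow> i \<noteq> y" using y by (auto simp: chosen_by_def uncovered_def)

lemma ro'_y: "ro' y = q'"
  using near_tree[OF y] by (simp add: ro'_def q'_def)

lemma ro'_old: "chosen cv i \<Longrightarrow> ro' i = ro i" "chosen cv i \<Longrightarrow> pa' i = pa i"
  using chosen_ne by (auto simp: ro'_def pa'_def)

text \<open>If a covered facility has an uncovered one within \<open>2 * r\<close>, the latter is
  within \<open>2 * r + 2 * r\<close> of the center of the former and hence marked. So no new root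
  is chosen while a tree still touches uncovered facilities; this is the origin of the edge length
  \<open>4 * r\<close>.\<close>

lemma old_tree:
  assumes "good I r u" "cv u \<noteq> 0" "unc cv w" "D u w \<le> 2 * r"
  shows "ro' (cv' u - 1) = q'"
proof -
  have u: "cv' u = cv u" using assms by (simp add: cv'_def uncovered_def)
  note c = covered[OF assms(1,2)]
  have "nr y \<noteq> 0"
  proof
    assume "nr y = 0"
    then have "nr w = 0" using cand assms(3) by blast
    from not_near[OF assms(3) this] c have "4 * r < D w (cv u - 1)" by blast
    moreover have "D w (cv u - 1) \<le> D w u + D u (cv u - 1)"
      using assms c by (intro good_tri) (auto simp: uncovered_def chosen_by_def)
    moreover have "D w u = D u w" using assms by (intro good_sym) (auto simp: uncovered_def)
    ultimately show False using assms c by linarith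
  qed
  then show ?thesis using frontier[OF assms] ro'_old[of "cv u - 1"] c u by (simp add: q'_def)
qed

lemma tree_step:
  assumes i: "chosen cv' i"
  shows "chosen cv' (ro' i) \<and> ro' (ro' i) = ro' i \<and> U (m (ro' i)) \<le> U (m i) \<and>
     (ro' i \<noteq> i \<longrightarrow> chosen cv' (pa' i) \<and> D i (pa' i) \<le> 4 * r \<and> ro' (pa' i) = ro' i)"
  proof (cases "i = y")
  case False
  then have c: "chosen cv i" using i chosen_cv' by simp
  show ?thesis using root[OF c] parent[OF c] ro'_old c chosen_cv' by simp
next
  case True
  show ?thesis
  proof (cases "nr y = 0")
    case True
    then show ?thesis using \<open>i = y\<close> chosen_cv' by (simp add: ro'_def)
  next
    case False
    note p = near_tree[OF y False]
    have "chosen cv q" "ro q = q" using root[of "nr y - 1"] p by auto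
    moreover have "U (m q) \<le> U (m y)" using root_least[OF y] p by blast
    ultimately show ?thesis
      using p \<open>i = y\<close> False ro'_old chosen_cv' by (simp add: ro'_y q'_def) (simp add: pa'_def ro'_old)
  qed
qed

text \<open>The clauses about the current tree survive for two different reasons: if
  \<open>y\<close> is marked, the tree continues with the same root; if not, there are no marks at
  all and \<open>y\<close> is minimal among the uncovered facilities, so a new tree starts
  cleanly.\<close>

lemma growing_next: "growing I r m cv' nr' pa' ro' q'"
proof (unfold_locales)
  fix u assume u: "good I r u" "cv' u \<noteq> 0"
  show "chosen cv' (cv' u - 1) \<and> D u (cv' u - 1) \<le> 2 * r"
    using u covered[OF u(1)] unfolding chosen_cv' by (auto simp: cv'_def)
next
  fix i j assume ij: "chosen cv' i" "chosen cv' j" "i \<noteq> j"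
  have "D i y = D y i" "D j y = D y j" using ij good_y by (auto intro!: good_sym simp: chosen_by_def)
  then show "2 * r < D i j"
    using ij apart uncovered_apart[OF y] unfolding chosen_cv' by auto
next
  fix u i assume "unc cv' u" "chosen cv' i"
  then show "2 * r < D u i" using uncovered_apart unfolding chosen_cv' unc_cv' by auto
next
  fix u i assume "unc cv' u" "nr' u = 0" "chosen cv' i"
  then show "4 * r < D u i" using not_near[of u] unfolding chosen_cv' unc_cv'
    by (auto simp: nr'_def split: if_splits)
next
  fix u assume u: "unc cv' u" "nr' u \<noteq> 0"
  then have u': "unc cv u" unfolding unc_cv' by simp
  show "chosen cv' (nr' u - 1) \<and> D u (nr' u - 1) \<le> 4 * r \<and> ro' (nr' u - 1) = q'"
  proof (cases "nr' u = Suc y")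
    case True
    show ?thesis
    proof (cases "nr u = Suc y")
      case True
      then have "chosen cv y" using near_tree[OF u'] by simp
      then show ?thesis using chosen_ne by blast
    next
      case False
      then have "D u y \<le> 4 * r" using \<open>nr' u = Suc y\<close> by (auto simp: nr'_def split: if_splits)
      then show ?thesis using True ro'_y chosen_cv' by simp
    qed
  next
    case False
    then have nr: "nr' u = nr u" "nr u \<noteq> 0" using u by (auto simp: nr'_def split: if_splits)
    \<comment> \<open>An older mark on an uncovered facility excludes a new root, so
      \<open>y\<close> extends the current tree and the mark still points into it.\<close>
    have "nr y \<noteq> 0" using cand u' nr(2) by metis
    note g = near_tree[OF u' nr(2)]
    then have "ro' (nr u - 1) = q"
      using ro'_old(1)[of "nr u - 1"] by simp
    then show ?thesis using g nr \<open>nr y \<noteq> 0\<close> unfolding chosen_cv' q'_def by auto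
  qed
next
  fix i assume "chosen cv' i"
  then show "chosen cv' (ro' i) \<and> ro' (ro' i) = ro' i \<and> U (m (ro' i)) \<le> U (m i)"
    using tree_step by blast
next
  fix i assume "chosen cv' i" "ro' i \<noteq> i"
  then show "chosen cv' (pa' i) \<and> D i (pa' i) \<le> 4 * r \<and> ro' (pa' i) = ro' i"
    using tree_step by blast
next
  fix u w assume u: "good I r u" "cv' u \<noteq> 0" and w: "unc cv' w" and d: "D u w \<le> 2 * r"
  show "ro' (cv' u - 1) = q'"
  proof (cases "cv u = 0")
    case True
    then have "cv' u = Suc y" using u by (auto simp: cv'_def split: if_splits)
    then show ?thesis by (simp add: ro'_y)
  next
    case False
    then show ?thesis using old_tree[OF u(1) False _ d] w unc_cv' by blast
  qed
next
  fix u i assume u: "unc cv' u" and i: "chosen cv' i" "ro' i = q'"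
  show "U (m q') \<le> U (m u)"
  proof (cases "nr y = 0")
    case True
    then show ?thesis using cand u unc_cv' by (auto simp: q'_def)
  next
    case False
    then show ?thesis using root_least[of u "nr y - 1"] near_tree[OF y False] u unc_cv' by (auto simp: q'_def)
  qed
next
  fix u w assume u: "good I r u" "cv' u \<noteq> 0" and w: "good I r w" "cv' w \<noteq> 0" and d: "D u w \<le> 2 * r"
  \<comment> \<open>What is covered in this round belongs to the tree \<open>q'\<close>. A pair of
    an old and a new facility is settled by \<open>old_tree\<close>, because the new one was
    uncovered before.\<close>
  have new: "ro' (cv' x - 1) = q'" if "cv x = 0" "cv' x \<noteq> 0" for x
    using that ro'_y by (auto simp: cv'_def split: if_splits)
  consider "cv u = 0" "cv w = 0" | "cv u = 0" "cv w \<noteq> 0" | "cv u \<noteq> 0" "cv w = 0" | "cv u \<noteq> 0" "cv w \<noteq> 0"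
    by blast
  then show "ro' (cv' u - 1) = ro' (cv' w - 1)"
  proof cases
    case 1
    then show ?thesis using new u w by simp
  next
    case 2
    have "D w u \<le> 2 * r" using d good_sym[OF u(1) w(1)] by simp
    then have "ro' (cv' w - 1) = q'" using old_tree[OF w(1) 2(2), of u] 2 u by (auto simp: uncovered_def)
    then show ?thesis using new 2 u by simp
  next
    case 3
    then have "ro' (cv' u - 1) = q'" using old_tree[OF u(1) 3(1), of w] w d by (auto simp: uncovered_def)
    then show ?thesis using new 3 w by simp
  next
    case 4
    then have "cv' u = cv u" "cv' w = cv w" by (auto simp: cv'_def uncovered_def)
    then show ?thesis using 4 same_tree[of u w] u w d covered ro'_old by simp
  qed
qed

lemma listed_step:
  assumes l: "listed t cv pa ro od"
  shows "listed (Suc t) cv' pa' ro' (od(t := Suc y))"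
proof -
  have l1: "\<And>k. k < t \<Longrightarrow> od k \<noteq> 0 \<Longrightarrow> chosen cv (od k - 1)"
    and l2: "\<And>i. chosen cv i \<Longrightarrow> \<exists>k<t. od k = Suc i"
    and l3: "\<And>k k'. k < t \<Longrightarrow> k' < t \<Longrightarrow> od k = od k' \<Longrightarrow> od k \<noteq> 0 \<Longrightarrow> k = k'"
    and l4: "\<And>k i. k < t \<Longrightarrow> od k = Suc i \<Longrightarrow> ro i \<noteq> i \<Longrightarrow> \<exists>k'<k. od k' = Suc (pa i)"
    and l5: "card {u. unc cv u} \<le> n - t"
    using l unfolding listed_def by ((elim conjE, simp)+)
  have ny: "od k \<noteq> Suc y" if "k < t" for k using l1[OF that] chosen_ne by fastforce
  show ?thesis
    unfolding listed_def
  proof (intro conjI allI impI)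
    fix k assume "k < Suc t" "(od(t := Suc y)) k \<noteq> 0"
    then show "chosen cv' ((od(t := Suc y)) k - 1)"
      using l1[of k] unfolding chosen_cv' by (cases "k = t") simp_all
  next
    fix i assume "chosen cv' i"
    then have "chosen cv i \<or> i = y" using chosen_cv' by simp
    then show "\<exists>k<Suc t. (od(t := Suc y)) k = Suc i"
    proof
      assume "chosen cv i"
      then obtain k where "k < t" "od k = Suc i" using l2 by blast
      then show ?thesis by (intro exI[of _ k]) auto
    qed (auto intro: exI[of _ t])
  next
    fix k k' assume "k < Suc t" "k' < Suc t" "(od(t := Suc y)) k = (od(t := Suc y)) k'" "(od(t := Suc y)) k \<noteq> 0"
    then show "k = k'" using l3[of k k'] ny[of k] ny[of k']
      by (cases "k = t"; cases "k' = t") simp_all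
  next
    fix k i assume k: "k < Suc t" and i: "(od(t := Suc y)) k = Suc i" and ro: "ro' i \<noteq> i"
    show "\<exists>k'<k. (od(t := Suc y)) k' = Suc (pa' i)"
    proof (cases "k = t")
      case True
      then have "i = y" using i by simp
      then have nr: "nr y \<noteq> 0" using ro by (auto simp: ro'_def split: if_splits)
      then obtain k' where "k' < t" "od k' = Suc (nr y - 1)" using near_tree[OF y] l2[of "nr y - 1"] by blast
      then show ?thesis using True \<open>i = y\<close> nr by (intro exI[of _ k']) (simp add: pa'_def)
    next
      case False
      then have kt: "k < t" "od k = Suc i" using k i by auto
      then have c: "chosen cv i" using l1[of k] by simp
      then obtain k' where "k' < k" "od k' = Suc (pa i)" using l4[OF kt] ro ro'_old by auto
      then show ?thesis using kt ro'_old(2)[OF c] by (intro exI[of _ k']) auto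
    qed
  next
    \<comment> \<open>\<open>y\<close> covers itself by \<open>good_refl\<close>, even if
      \<open>D y y\<close> is positive.\<close>
    have "{u. unc cv' u} \<subseteq> {u. unc cv u} - {y}"
      using good_refl[OF good_y] unfolding unc_cv' by auto
    then have "card {u. unc cv' u} \<le> card ({u. unc cv u} - {y})"
      using finite_unc by (intro card_mono) auto
    also have "\<dots> = card {u. unc cv u} - 1" using y finite_unc by simp
    finally show "card {u. unc cv' u} \<le> n - Suc t" using l5 by simp
  qed
qed

end

section \<open>The selection loop\<close>

context input
begin

definition ready :: "mem \<Rightarrow> bool" where
  "ready s \<longleftrightarrow> inputs I r s \<and> (\<forall>u<n. 0 < fst s ''good'' u \<longleftrightarrow> good I r u) \<and>
     (\<forall>u. good I r u \<longrightarrow> fst s ''m'' u \<in> facilities I \<and> D u (fst s ''m'' u) \<le> 2 * r \<and>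
        (\<forall>w\<in>facilities I. D u w \<le> 2 * r \<longrightarrow> U w \<le> U (fst s ''m'' u)))"

lemma readyD:
  assumes "ready s"
  shows "inputs I r s" "u < n \<Longrightarrow> 0 < fst s ''good'' u \<longleftrightarrow> good I r u"
    "good I r u \<Longrightarrow> fst s ''m'' u \<in> facilities I \<and> D u (fst s ''m'' u) \<le> 2 * r"
    "good I r u \<Longrightarrow> w \<in> facilities I \<Longrightarrow> D u w \<le> 2 * r \<Longrightarrow> U w \<le> U (fst s ''m'' u)"
    "good I r u \<Longrightarrow> fst s ''U'' (fst s ''m'' u) = U (fst s ''m'' u)"
  using assms inputsD(6)[of I r s] by (auto simp: ready_def)

lemma ready_frame:
  assumes "ready s"
    and "\<And>x. x \<in> {''n'', ''l'', ''client'', ''facility'', ''U'', ''good'', ''m''} \<Longrightarrow> fst t x = fst s x"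
    and "\<And>x. x \<in> {''r'', ''d''} \<Longrightarrow> snd t x = snd s x"
  shows "ready t"
proof -
  have "inputs I r t"
    by (rule inputs_frame[of I r s]) (use assms in \<open>auto simp: ready_def\<close>)
  then show ?thesis using assms(1,2) by (simp add: ready_def)
qed

lemma ready_sem:
  assumes "ready s"
    and "nwrites p \<inter> {''n'', ''l'', ''client'', ''facility'', ''U'', ''good'', ''m''} = {}"
    and "rwrites p \<inter> {''r'', ''d''} = {}"
  shows "ready (sem p s)"
  using assms by (auto intro!: ready_frame[of s] sem_frame_fst sem_frame_snd)

lemma unc_less: "unc cv u \<Longrightarrow> u < n"
  by (simp add: uncovered_def good_less)

definition candidate :: "nat \<Rightarrow> (nat \<Rightarrow> nat) \<Rightarrow> (nat \<Rightarrow> nat) \<Rightarrow> (nat \<Rightarrow> nat) \<Rightarrow> nat \<Rightarrow> bool" where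
  "candidate k m cv nr x \<longleftrightarrow>
     (if x = 0 then \<forall>u<k. \<not> unc cv u
      else unc cv (x - 1) \<and>
        (nr (x - 1) \<noteq> 0 \<or> (\<forall>u<k. unc cv u \<longrightarrow> nr u = 0 \<and> U (m (x - 1)) \<le> U (m u))))"

lemma sem_find_candidate:
  assumes s: "ready s" and x: "fst s ''x'' 0 = 0"
  shows "candidate n (fst s ''m'') (fst s ''cov'') (fst s ''near'') (fst (sem find_candidate s) ''x'' 0)"
proof -
  let ?P = "\<lambda>k t. candidate k (fst s ''m'') (fst s ''cov'') (fst s ''near'') (fst t ''x'' 0)"
  have "?P (fst s ''n'' 0) (sem find_candidate s)"
    unfolding find_candidate_def
  proof (rule sem_For_invariant[where P = ?P], goal_cases)
    case (3 k t)
    have t: "ready t" using s by (rule ready_frame) (auto simp: 3)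
    have k: "k < n" using 3 inputsD[OF readyD(1)[OF s]] by simp
    have eq: "fst t ''m'' = fst s ''m''" "fst t ''cov'' = fst s ''cov''" "fst t ''near'' = fst s ''near''"
      by (auto simp: 3)
    have open_k: "0 < fst t ''good'' k \<and> fst t ''cov'' k = 0 \<longleftrightarrow> unc (fst s ''cov'') k"
      using readyD(2)[OF t k] eq by (simp add: uncovered_def)
    have Uk: "fst t ''U'' (fst s ''m'' u) = U (fst s ''m'' u)" if "unc (fst s ''cov'') u" for u
      using readyD(5)[OF t, of u] that eq by (simp add: uncovered_def)
    define x where "x = fst t ''x'' 0"
    let ?better = "x = 0 \<or> fst s ''near'' (x - 1) = 0 \<and>
        (0 < fst s ''near'' k \<or> fst t ''U'' (fst s ''m'' k) < fst t ''U'' (fst s ''m'' (x - 1)))"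
    have new: "fst (nwrite ''u'' 0 (Suc k) (sem (PIf (Conj (nz (NRead ''good'' (V ''u''))) (eqb (NRead ''cov'' (V ''u'')) (NConst 0)))
       (PIf (orb (eqb (V ''x'') (NConst 0))
            (Conj (eqb (NRead ''near'' (pred (V ''x''))) (NConst 0))
              (orb (nz (NRead ''near'' (V ''u'')))
                (NLess (NRead ''U'' (NRead ''m'' (V ''u''))) (NRead ''U'' (NRead ''m'' (pred (V ''x''))))))))
         (assign ''x'' (succ (V ''u''))) PSkip)
       PSkip) t)) ''x'' 0 = (if unc (fst s ''cov'') k \<and> ?better then Suc k else x)"
      using 3(2) open_k eq by (auto simp: fst_nwrite x_def)
    have P: "candidate k (fst s ''m'') (fst s ''cov'') (fst s ''near'') x" using 3(5) by (simp add: x_def)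
    show ?case
      unfolding new
    proof (cases "unc (fst s ''cov'') k \<and> ?better")
      case True
      then have "candidate (Suc k) (fst s ''m'') (fst s ''cov'') (fst s ''near'') (Suc k)"
        using P Uk[of k] Uk[of "x - 1"]
        by (auto simp: candidate_def less_Suc_eq split: if_splits intro: order_trans less_imp_le)
      then show "candidate (Suc k) (fst s ''m'') (fst s ''cov'') (fst s ''near'')
          (if unc (fst s ''cov'') k \<and> ?better then Suc k else x)" by (simp only: if_P[OF True])
    next
      case False
      then have "candidate (Suc k) (fst s ''m'') (fst s ''cov'') (fst s ''near'') x"
        using P Uk[of k] Uk[of "x - 1"]
        by (auto simp: candidate_def less_Suc_eq split: if_splits)
      then show "candidate (Suc k) (fst s ''m'') (fst s ''cov'') (fst s ''near'')
          (if unc (fst s ''cov'') k \<and> ?better then Suc k else x)" by (simp only: if_not_P[OF False])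
    qed
  qed (auto simp: fst_nwrite candidate_def x)
  then show ?thesis using inputsD[OF readyD(1)[OF s]] by simp
qed

lemma sem_cover:
  assumes s: "ready s" and y: "fst s ''y'' 0 = y" "y < n"
  shows "fst (sem cover s) ''cov'' = (\<lambda>w. if unc (fst s ''cov'') w \<and> D w y \<le> 2 * r then Suc y else fst s ''cov'' w)"
    and "fst (sem cover s) ''near'' = (\<lambda>w. if unc (fst s ''cov'') w \<and> \<not> D w y \<le> 2 * r \<and> D w y \<le> 4 * r
      then Suc y else fst s ''near'' w)"
proof -
  let ?P = "\<lambda>k t.
    fst t ''cov'' = (\<lambda>w. if w < k \<and> unc (fst s ''cov'') w \<and> D w y \<le> 2 * r then Suc y else fst s ''cov'' w) \<and>
    fst t ''near'' = (\<lambda>w. if w < k \<and> unc (fst s ''cov'') w \<and> \<not> D w y \<le> 2 * r \<and> D w y \<le> 4 * r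
      then Suc y else fst s ''near'' w)"
  have "?P (fst s ''n'' 0) (sem cover s)"
    unfolding cover_def
  proof (rule sem_For_invariant[where P = ?P], goal_cases)
    case (3 k t)
    have t: "ready t" using s by (rule ready_frame) (auto simp: 3)
    have k: "k < n" using 3 inputsD[OF readyD(1)[OF s]] by simp
    have y': "fst t ''y'' 0 = y" using y by (simp add: 3)
    have c: "fst t ''cov'' k = fst s ''cov'' k" using 3(5) by simp
    show ?case
      using 3(2,5) y y' k inputsD[OF readyD(1)[OF t]] readyD(2)[OF t k]
      by (auto simp: fst_nwrite uncovered_def less_Suc_eq fun_eq_iff)
  qed (auto simp: fst_nwrite)
  then have P: "?P n (sem cover s)" using inputsD[OF readyD(1)[OF s]] by simp
  show "fst (sem cover s) ''cov'' = (\<lambda>w. if unc (fst s ''cov'') w \<and> D w y \<le> 2 * r then Suc y else fst s ''cov'' w)"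
    unfolding conjunct1[OF P] by (rule ext) (use unc_less in auto)
  show "fst (sem cover s) ''near'' = (\<lambda>w. if unc (fst s ''cov'') w \<and> \<not> D w y \<le> 2 * r \<and> D w y \<le> 4 * r
      then Suc y else fst s ''near'' w)"
    unfolding conjunct2[OF P] by (rule ext) (use unc_less in auto)
qed

definition selecting :: "nat \<Rightarrow> mem \<Rightarrow> bool" where
  "selecting k s \<longleftrightarrow>
     (\<exists>q. growing I r (fst s ''m'') (fst s ''cov'') (fst s ''near'') (fst s ''pa'') (fst s ''ro'') q) \<and>
     listed k (fst s ''cov'') (fst s ''pa'') (fst s ''ro'') (fst s ''order'')"

lemma selecting_stop:
  assumes "listed k cv pa ro od" "\<And>u. \<not> unc cv u"
  shows "listed (Suc k) cv pa ro (od(k := 0))"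
proof -
  have l1: "\<And>j. j < k \<Longrightarrow> od j \<noteq> 0 \<Longrightarrow> chosen cv (od j - 1)"
    and l2: "\<And>i. chosen cv i \<Longrightarrow> \<exists>j<k. od j = Suc i"
    and l3: "\<And>j j'. j < k \<Longrightarrow> j' < k \<Longrightarrow> od j = od j' \<Longrightarrow> od j \<noteq> 0 \<Longrightarrow> j = j'"
    and l4: "\<And>j i. j < k \<Longrightarrow> od j = Suc i \<Longrightarrow> ro i \<noteq> i \<Longrightarrow> \<exists>j'<j. od j' = Suc (pa i)"
    using assms(1) unfolding listed_def by ((elim conjE, simp)+)
  show ?thesis
    unfolding listed_def
  proof (intro conjI allI impI)
    fix i assume "chosen cv i"
    then obtain j where "j < k" "od j = Suc i" using l2 by blast
    then show "\<exists>j<Suc k. (od(k := 0)) j = Suc i" by (intro exI[of _ j]) auto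
  next
    fix j i assume j: "j < Suc k" "(od(k := 0)) j = Suc i" "ro i \<noteq> i"
    then have jk: "j < k" "od j = Suc i" by (cases "j = k"; simp)+
    then obtain j' where "j' < j" "od j' = Suc (pa i)" using l4[OF jk j(3)] by blast
    then show "\<exists>j'<j. (od(k := 0)) j' = Suc (pa i)" using jk by (intro exI[of _ j']) auto
  next
    fix j assume "j < Suc k" "(od(k := 0)) j \<noteq> 0"
    then show "chosen cv ((od(k := 0)) j - 1)" using l1[of j] by (cases "j = k") auto
  next
    fix j j' assume "j < Suc k" "j' < Suc k" "(od(k := 0)) j = (od(k := 0)) j'" "(od(k := 0)) j \<noteq> 0"
    then show "j = j'" using l3[of j j'] by (cases "j = k"; cases "j' = k") simp_all
  next
    have "{u. unc cv u} = {}" using assms(2) by blast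
    then show "card {u. unc cv u} \<le> n - Suc k" by (simp only: card.empty zero_le)
  qed
qed

lemma sem_select_step:
  assumes t: "ready t" and k: "fst t ''t'' 0 = k" and sel: "selecting k t"
  shows "selecting (Suc k) (sem select_one t)"
proof -
  define t1 where "t1 = sem (assign ''x'' (NConst 0)) t"
  define t2 where "t2 = sem find_candidate t1"
  define t3 where "t3 = sem (PN ''order'' (V ''t'') (V ''x'')) t2"
  define t4 where "t4 = sem (assign ''y'' (pred (V ''x''))) t3"
  define t5 where "t5 = sem link_node t4"
  define t6 where "t6 = sem cover t5"
  note defs = t1_def t2_def t3_def t4_def t5_def t6_def
  have run: "sem select_one t = (if bval (nz (V ''x'')) t3 then t6 else t3)"
    by (simp only: select_one_def grow_tree_def sem.simps defs)
  have r1: "ready t1" unfolding t1_def by (rule ready_sem[OF t]) auto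
  have r2: "ready t2" unfolding t2_def by (rule ready_sem[OF r1]) auto
  have r3: "ready t3" unfolding t3_def by (rule ready_sem[OF r2]) auto
  have r4: "ready t4" unfolding t4_def by (rule ready_sem[OF r3]) auto
  have r5: "ready t5" unfolding t5_def by (rule ready_sem[OF r4]) (auto simp: link_node_def)
  define m cv nr pa ro od where "m = fst t ''m''" "cv = fst t ''cov''" "nr = fst t ''near''"
    "pa = fst t ''pa''" "ro = fst t ''ro''" "od = fst t ''order''"
  note arr = this
  define x where "x = fst t2 ''x'' 0"
  have e1: "fst t1 z = fst t z" if "z \<noteq> ''x''" for z using that by (simp add: t1_def fst_nwrite)
  have e2: "fst t2 z = fst t z" if "z \<notin> {''x'', ''u''}" for z using that e1 by (simp add: t2_def sem_frame_fst)
  have c: "candidate n m cv nr x"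
    using sem_find_candidate[OF r1] e1 unfolding x_def t2_def arr by (simp add: t1_def fst_nwrite)
  have od3: "fst t3 ''order'' = od(k := x)" using e2 k by (simp add: t3_def fst_nwrite arr x_def)
  have e3: "fst t3 z = fst t z" if "z \<notin> {''x'', ''u'', ''order''}" for z
    using that e2 by (simp add: t3_def fst_nwrite)
  have x3: "fst t3 ''x'' 0 = x" by (simp add: t3_def fst_nwrite x_def)
  obtain q where gr: "growing I r m cv nr pa ro q" and li: "listed k cv pa ro od"
    using sel unfolding selecting_def arr by blast
  show ?thesis
  proof (cases "x = 0")
    case True
    then have "\<not> unc cv u" for u using c unc_less[of cv u] by (auto simp: candidate_def)
    then have "listed (Suc k) cv pa ro (od(k := x))" using selecting_stop[OF li] True by simp
    then have "selecting (Suc k) t3" using gr unfolding selecting_def od3 by (auto simp: e3 arr[symmetric])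
    then show ?thesis using True x3 unfolding run by simp
  next
    case False
    define y where "y = x - 1"
    have xy: "x = Suc y" using False by (simp add: y_def)
    have y: "unc cv y" and cand: "nr y \<noteq> 0 \<or> (\<forall>u. unc cv u \<longrightarrow> nr u = 0 \<and> U (m y) \<le> U (m u))"
      using c xy unc_less unfolding candidate_def by auto
    interpret st: growing_step I r m cv nr pa ro q y
      using gr y cand by (intro growing_step.intro growing_step_axioms.intro)
    have y4: "fst t4 ''y'' 0 = y" using x3 by (simp add: t4_def fst_nwrite xy)
    have e4: "fst t4 z = fst t z" if "z \<notin> {''x'', ''u'', ''order'', ''y''}" for z
      using that e3 by (simp add: t4_def fst_nwrite)
    have e5: "fst t5 z = fst t4 z" if "z \<notin> {''pa'', ''ro''}" for z
      unfolding t5_def using that by (intro sem_frame_fst) (auto simp: link_node_def)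
    have ny: "nr y - 1 \<noteq> y" if "nr y \<noteq> 0"
      using st.near_tree[OF y that] st.chosen_ne by blast
    have p5: "fst t5 ''pa'' = st.pa'" "fst t5 ''ro'' = st.ro'"
      using y4 e4 unfolding t5_def link_node_def st.pa'_def st.ro'_def by (auto simp: fst_nwrite arr)
    have y5: "fst t5 ''y'' 0 = y" using y4 e5 by simp
    note cov = sem_cover[OF r5 y5 unc_less[OF y]]
    have "fst t6 ''cov'' = st.cv'" "fst t6 ''near'' = st.nr'"
      unfolding t6_def cov by (auto simp: fun_eq_iff e5 e4 arr[symmetric] st.cv'_def st.nr'_def)
    moreover have "fst t6 ''pa'' = st.pa'" "fst t6 ''ro'' = st.ro'" "fst t6 ''m'' = m"
        "fst t6 ''order'' = od(k := Suc y)"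
      using p5 e5 e4 od3 by (auto simp: t6_def sem_frame_fst arr t4_def fst_nwrite xy)
    ultimately have "selecting (Suc k) t6"
      using st.growing_next st.listed_step[OF li] unfolding selecting_def by auto
    then show ?thesis using False x3 unfolding run by simp
  qed
qed

lemma selecting_init:
  assumes "\<And>u. good I r u \<Longrightarrow> fst s ''cov'' u = 0 \<and> fst s ''near'' u = 0"
  shows "selecting 0 s"
proof -
  have c: "\<not> chosen (fst s ''cov'') i" for i using assms[of i] by (auto simp: chosen_by_def)
  \<comment> \<open>The root \<open>0\<close> is arbitrary: as long as nothing is covered or marked,
    every clause about the current tree is vacuous.\<close>
  have "growing I r (fst s ''m'') (fst s ''cov'') (fst s ''near'') (fst s ''pa'') (fst s ''ro'') 0"
    by unfold_locales (use c assms in \<open>auto simp: uncovered_def\<close>)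
  moreover have "card {u. unc (fst s ''cov'') u} \<le> n"
    using card_mono[of "{..<n}" "{u. unc (fst s ''cov'') u}"] unc_less by auto
  ultimately show ?thesis unfolding selecting_def listed_def using c by auto
qed

lemma sem_select:
  assumes s: "ready s" and init: "\<And>u. good I r u \<Longrightarrow> fst s ''cov'' u = 0 \<and> fst s ''near'' u = 0"
  shows "selecting n (sem select s)"
proof -
  have "selecting (fst s ''n'' 0) (sem select s)"
    unfolding select_def
  proof (rule sem_For_invariant[where P = selecting], goal_cases)
    case 2
    show ?case by (rule selecting_init) (use init in \<open>simp add: fst_nwrite\<close>)
  next
    case (3 k t)
    have t: "ready t" using s by (rule ready_frame) (auto simp: 3)
    from sem_select_step[OF t 3(2,5)] show ?case
      unfolding selecting_def by (simp add: fst_nwrite)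
  qed (simp add: program_defs)
  then show ?thesis using inputsD[OF readyD(1)[OF s]] by simp
qed

lemma selecting_clustering:
  assumes s: "ready s" and sel: "selecting n s"
  shows "clustering I r (fst s ''m'') (\<lambda>u. fst s ''cov'' u - 1) (fst s ''pa'') (fst s ''ro'')"
    and "good I r u \<Longrightarrow> fst s ''cov'' u \<noteq> 0"
proof -
  let ?cv = "fst s ''cov''"
  obtain q where "growing I r (fst s ''m'') ?cv (fst s ''near'') (fst s ''pa'') (fst s ''ro'') q"
    using sel unfolding selecting_def by blast
  then interpret growing I r "fst s ''m''" ?cv "fst s ''near''" "fst s ''pa''" "fst s ''ro''" q .
  \<comment> \<open>The counting clause of \<open>listed\<close> leaves no uncovered facility after
    \<open>n\<close> rounds.\<close>
  have "card {u. unc ?cv u} = 0" using sel unfolding selecting_def listed_def by auto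
  then have nu: "\<not> unc ?cv u" for u using finite_unc by auto
  then show nz: "good I r u \<Longrightarrow> ?cv u \<noteq> 0" for u by (auto simp: uncovered_def)
  have c: "good I r i \<Longrightarrow> ?cv i - 1 = i \<Longrightarrow> chosen ?cv i" for i
    using nz[of i] by (auto simp: chosen_by_def)
  have c': "chosen ?cv i \<Longrightarrow> good I r i \<and> ?cv i - 1 = i" for i by (auto simp: chosen_by_def)
  show "clustering I r (fst s ''m'') (\<lambda>u. ?cv u - 1) (fst s ''pa'') (fst s ''ro'')"
  proof unfold_locales
    fix u assume u: "good I r u"
    show "fst s ''m'' u \<in> facilities I \<and> D u (fst s ''m'' u) \<le> 2 * r" using readyD(3)[OF s u] .
    show "U w \<le> U (fst s ''m'' u)" if "w \<in> facilities I" "D u w \<le> 2 * r" for w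
      using readyD(4)[OF s u that] .
    show "good I r (?cv u - 1) \<and> ?cv (?cv u - 1) - 1 = ?cv u - 1 \<and> D u (?cv u - 1) \<le> 2 * r"
      using covered[OF u nz[OF u]] c' by blast
    show "fst s ''ro'' (?cv u - 1) = fst s ''ro'' (?cv w - 1)" if "good I r w" "D u w \<le> 2 * r" for w
      using same_tree[OF u nz[OF u] that(1) nz[OF that(1)] that(2)] .
    assume "?cv u - 1 = u"
    then have cu: "chosen ?cv u" using c u by blast
    show "2 * r < D u j" if "good I r j" "?cv j - 1 = j" "u \<noteq> j" for j
      using apart[OF cu c] that by blast
    show "good I r (fst s ''ro'' u) \<and> ?cv (fst s ''ro'' u) - 1 = fst s ''ro'' u \<and>
        fst s ''ro'' (fst s ''ro'' u) = fst s ''ro'' u"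
      using root[OF cu] c' by blast
    show "U (fst s ''m'' (fst s ''ro'' u)) \<le> U (fst s ''m'' u)" using root[OF cu] by blast
    assume "fst s ''ro'' u \<noteq> u"
    then show "good I r (fst s ''pa'' u) \<and> ?cv (fst s ''pa'' u) - 1 = fst s ''pa'' u \<and>
        D u (fst s ''pa'' u) \<le> 4 * r \<and> fst s ''ro'' (fst s ''pa'' u) = fst s ''ro'' u"
      using parent[OF cu] c' by blast
  qed
qed

end

section \<open>Homes of the clients\<close>

context input
begin

definition placed :: "mem \<Rightarrow> nat \<Rightarrow> bool" where
  "placed s v \<longleftrightarrow> fst s ''st'' v = 0 \<and>
     (v \<in> reach I r \<longleftrightarrow> fst s ''hm'' v \<noteq> 0) \<and>
     (0 < fst s ''core'' v \<longleftrightarrow> v \<in> reach I r \<and> D v (fst s ''hm'' v - 1) \<le> r) \<and>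
     (v \<in> reach I r \<longrightarrow>
       (\<forall>i. chosen (fst s ''cov'') i \<longrightarrow> D v i \<le> r \<longrightarrow> fst s ''hm'' v = Suc i) \<and>
       (chosen (fst s ''cov'') (fst s ''hm'' v - 1) \<and> D v (fst s ''hm'' v - 1) \<le> r \<or>
        (\<exists>u. good I r u \<and> D v u \<le> r \<and> fst s ''hm'' v = fst s ''cov'' u \<and>
          (\<forall>w. good I r w \<longrightarrow> D v w \<le> r \<longrightarrow> U w \<le> U u))))"

lemma sem_nearest_good:
  assumes s: "ready s" and x: "fst s ''x'' 0 = 0" and v: "fst s ''v'' 0 = v" "v < n"
  defines "x \<equiv> fst (sem nearest_good s) ''x'' 0"
  shows "if x = 0 then \<forall>u. good I r u \<longrightarrow> r < D v u
    else good I r (x - 1) \<and> D v (x - 1) \<le> r \<and> (\<forall>w. good I r w \<longrightarrow> D v w \<le> r \<longrightarrow> U w \<le> U (x - 1))"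
proof -
  let ?P = "\<lambda>k t. if fst t ''x'' 0 = 0 then \<forall>u<k. good I r u \<longrightarrow> r < D v u
    else good I r (fst t ''x'' 0 - 1) \<and> D v (fst t ''x'' 0 - 1) \<le> r \<and>
      (\<forall>w<k. good I r w \<longrightarrow> D v w \<le> r \<longrightarrow> U w \<le> U (fst t ''x'' 0 - 1))"
  have "?P (fst s ''n'' 0) (sem nearest_good s)"
    unfolding nearest_good_def
  proof (rule sem_For_invariant[where P = ?P], goal_cases)
    case (3 k t)
    have t: "ready t" using s by (rule ready_frame) (auto simp: 3)
    note i = inputsD[OF readyD(1)[OF t]]
    have k: "k < n" using 3 inputsD[OF readyD(1)[OF s]] by simp
    have vt: "fst t ''v'' 0 = v" using v by (simp add: 3)
    have cond: "bval (Conj (nz (NRead ''good'' (V ''u''))) (close (V ''v'') (V ''u'') radius_exp)) t \<longleftrightarrow>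
        good I r k \<and> D v k \<le> r"
      using 3(2) vt i v k readyD(2)[OF t k] by auto
    have Uk: "fst t ''U'' u = U u" if "good I r u" for u using i(6) good_points(2)[OF that] by simp
    show ?case
    proof (cases "good I r k \<and> D v k \<le> r")
      case False
      then have "?P (Suc k) t" using 3(5) by (auto simp: less_Suc_eq split: if_splits)
      then show ?thesis unfolding sem.simps(1,5) cond if_not_P[OF False]
        by (cases "fst t ''x'' 0 = 0") (simp_all add: fst_nwrite)
    next
      case True
      define x where "x = fst t ''x'' 0"
      let ?t = "sem (PIf (orb (eqb (V ''x'') (NConst 0)) (NLess (NRead ''U'' (pred (V ''x''))) (NRead ''U'' (V ''u''))))
         (assign ''x'' (succ (V ''u''))) PSkip) t"
      have x': "fst ?t ''x'' 0 = (if x = 0 \<or> fst t ''U'' (x - 1) < fst t ''U'' k then Suc k else x)"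
        using 3(2) by (simp add: fst_nwrite x_def)
      have P: "?P k t" using 3(5) .
      have "?P (Suc k) ?t"
      proof (cases "x = 0 \<or> fst t ''U'' (x - 1) < fst t ''U'' k")
        case c: True
        have "U w \<le> U k" if "w < k" "good I r w" "D v w \<le> r" for w
        proof (cases "x = 0")
          case True
          then show ?thesis using P that unfolding x_def[symmetric] by auto
        next
          case False
          then have "good I r (x - 1)" "U w \<le> U (x - 1)" using P that unfolding x_def[symmetric] by auto
          then show ?thesis using c False Uk[of k] Uk[of "x - 1"] True by simp
        qed
        then show ?thesis unfolding x' if_P[OF c] using True by (simp add: less_Suc_eq)
      next
        case c: False
        then have "good I r (x - 1)" "U k \<le> U (x - 1)"
          using P Uk[of k] Uk[of "x - 1"] True unfolding x_def[symmetric] by auto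
        then show ?thesis unfolding x' if_not_P[OF c] using c P unfolding x_def[symmetric]
          by (simp add: less_Suc_eq)
      qed
      then show ?thesis unfolding sem.simps(5)[of "Conj a b" for a b] cond if_P[OF True]
        by (cases "fst ?t ''x'' 0 = 0") (simp_all only: fst_nwrite, simp_all)
    qed
  qed (auto simp: fst_nwrite x)
  then show ?thesis using inputsD[OF readyD(1)[OF s]] good_less unfolding x_def
    by (auto split: if_splits)
qed

lemma sem_nearest_core:
  assumes s: "ready s" and v: "fst s ''v'' 0 = v" "v < n" and c0: "fst s ''core'' v = 0"
  defines "t \<equiv> sem nearest_core s"
  shows "if \<exists>i. chosen (fst s ''cov'') i \<and> D v i \<le> r
    then fst t ''hm'' v \<noteq> 0 \<and> chosen (fst s ''cov'') (fst t ''hm'' v - 1) \<and> D v (fst t ''hm'' v - 1) \<le> r \<and> fst t ''core'' v = 1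
    else fst t ''hm'' v = fst s ''hm'' v \<and> fst t ''core'' v = 0"
    and "w \<noteq> v \<Longrightarrow> fst t ''hm'' w = fst s ''hm'' w \<and> fst t ''core'' w = fst s ''core'' w"
proof -
  let ?P = "\<lambda>k t. (if \<exists>i<k. chosen (fst s ''cov'') i \<and> D v i \<le> r
    then fst t ''hm'' v \<noteq> 0 \<and> chosen (fst s ''cov'') (fst t ''hm'' v - 1) \<and> D v (fst t ''hm'' v - 1) \<le> r \<and> fst t ''core'' v = 1
    else fst t ''hm'' v = fst s ''hm'' v \<and> fst t ''core'' v = 0) \<and>
    (\<forall>w. w \<noteq> v \<longrightarrow> fst t ''hm'' w = fst s ''hm'' w \<and> fst t ''core'' w = fst s ''core'' w)"
  have "?P (fst s ''n'' 0) (sem nearest_core s)"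
    unfolding nearest_core_def
  proof (rule sem_For_invariant[where P = ?P], goal_cases)
    case (3 k t)
    have t: "ready t" using s by (rule ready_frame) (auto simp: 3)
    note i = inputsD[OF readyD(1)[OF t]]
    have k: "k < n" using 3 inputsD[OF readyD(1)[OF s]] by simp
    have vt: "fst t ''v'' 0 = v" "fst t ''cov'' = fst s ''cov''" using v by (auto simp: 3)
    have cond: "bval (Conj (nz (NRead ''good'' (V ''u'')))
          (Conj (eqb (NRead ''cov'' (V ''u'')) (succ (V ''u''))) (close (V ''v'') (V ''u'') radius_exp))) t \<longleftrightarrow>
        chosen (fst s ''cov'') k \<and> D v k \<le> r"
      using 3(2) vt i v k readyD(2)[OF t k] by (auto simp: chosen_by_def)
    have ex: "(\<exists>i<Suc k. chosen (fst s ''cov'') i \<and> D v i \<le> r) \<longleftrightarrow>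
        chosen (fst s ''cov'') k \<and> D v k \<le> r \<or> (\<exists>i<k. chosen (fst s ''cov'') i \<and> D v i \<le> r)"
      by (auto simp: less_Suc_eq)
    show ?case
    proof (cases "chosen (fst s ''cov'') k \<and> D v k \<le> r")
      case True
      then show ?thesis using 3(2,5) vt unfolding ex sem.simps cond by (auto simp: fst_nwrite)
    next
      case False
      then show ?thesis using 3(2,5) vt unfolding ex sem.simps cond
        by (cases "\<exists>i<k. chosen (fst s ''cov'') i \<and> D v i \<le> r") (auto simp: fst_nwrite)
    qed
  qed (auto simp: fst_nwrite c0)
  then have P: "?P n t" unfolding inputsD(1)[OF readyD(1)[OF s]] t_def .
  have less: "chosen (fst s ''cov'') i \<Longrightarrow> i < n" for i by (simp add: chosen_by_def good_less)
  have eq: "(\<exists>i<n. chosen (fst s ''cov'') i \<and> D v i \<le> r) \<longleftrightarrow> (\<exists>i. chosen (fst s ''cov'') i \<and> D v i \<le> r)"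
    using less by blast
  show "if \<exists>i. chosen (fst s ''cov'') i \<and> D v i \<le> r
    then fst t ''hm'' v \<noteq> 0 \<and> chosen (fst s ''cov'') (fst t ''hm'' v - 1) \<and> D v (fst t ''hm'' v - 1) \<le> r \<and> fst t ''core'' v = 1
    else fst t ''hm'' v = fst s ''hm'' v \<and> fst t ''core'' v = 0"
    unfolding eq[symmetric] by (rule conjunct1[OF P])
  show "w \<noteq> v \<Longrightarrow> fst t ''hm'' w = fst s ''hm'' w \<and> fst t ''core'' w = fst s ''core'' w"
    using conjunct2[OF P] by blast
qed

definition separated_centers :: "(nat \<Rightarrow> nat) \<Rightarrow> bool" where
  "separated_centers cv \<longleftrightarrow>
     (\<forall>u. good I r u \<longrightarrow> cv u \<noteq> 0 \<and> chosen cv (cv u - 1)) \<and>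
     (\<forall>i j. chosen cv i \<longrightarrow> chosen cv j \<longrightarrow> i \<noteq> j \<longrightarrow> 2 * r < D i j)"

lemma sem_find_home:
  assumes t: "ready t" and v: "fst t ''v'' 0 = v" "v < n" and sep: "separated_centers (fst t ''cov'')"
  shows "placed (sem find_home t) v"
    and "w \<noteq> v \<Longrightarrow> x \<in> {''st'', ''hm'', ''core''} \<Longrightarrow> fst (sem find_home t) x w = fst t x w"
proof -
  let ?cv = "fst t ''cov''"
  define t1 where "t1 = sem (PN ''st'' (V ''v'') (NConst 0) ;; PN ''hm'' (V ''v'') (NConst 0) ;;
    PN ''core'' (V ''v'') (NConst 0)) t"
  define t2 where "t2 = sem (assign ''x'' (NConst 0)) t1"
  define t3 where "t3 = sem nearest_good t2"
  define t4 where "t4 = sem (PIf (nz (V ''x'')) (PN ''hm'' (V ''v'') (NRead ''cov'' (pred (V ''x'')))) PSkip) t3"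
  define t5 where "t5 = sem nearest_core t4"
  have run: "sem find_home t = (if bval (nz (NRead ''client'' (V ''v''))) t1 then t5 else t1)"
    by (simp only: find_home_def sem.simps t1_def t2_def t3_def t4_def t5_def)
  have r1: "ready t1" unfolding t1_def by (rule ready_sem[OF t]) auto
  have r2: "ready t2" unfolding t2_def by (rule ready_sem[OF r1]) auto
  have r3: "ready t3" unfolding t3_def by (rule ready_sem[OF r2]) auto
  have r4: "ready t4" unfolding t4_def by (rule ready_sem[OF r3]) auto
  have e1: "fst t1 ''st'' v = 0" "fst t1 ''hm'' v = 0" "fst t1 ''core'' v = 0" "fst t1 ''v'' 0 = v"
    "fst t1 ''cov'' = ?cv"
    using v by (auto simp: t1_def fst_nwrite)
  have o1: "w \<noteq> v \<Longrightarrow> x \<in> {''st'', ''hm'', ''core''} \<Longrightarrow> fst t1 x w = fst t x w" for x w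
    using v by (auto simp: t1_def fst_nwrite)
  have e2: "fst t2 ''x'' 0 = 0" "x \<noteq> ''x'' \<Longrightarrow> fst t2 x = fst t1 x" for x
    by (auto simp: t2_def fst_nwrite)
  have e3: "x \<notin> {''x'', ''u''} \<Longrightarrow> fst t3 x = fst t1 x" for x
    using e2 by (auto simp: t3_def sem_frame_fst)
  define x where "x = fst t3 ''x'' 0"
  have ng: "if x = 0 then \<forall>u. good I r u \<longrightarrow> r < D v u
    else good I r (x - 1) \<and> D v (x - 1) \<le> r \<and> (\<forall>w. good I r w \<longrightarrow> D v w \<le> r \<longrightarrow> U w \<le> U (x - 1))"
    unfolding x_def t3_def by (rule sem_nearest_good[OF r2]) (use e2 e1 v in auto)
  have e4: "y \<notin> {''x'', ''u'', ''hm''} \<Longrightarrow> fst t4 y = fst t1 y" for y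
    using e3 by (simp add: t4_def fst_nwrite)
  have h4: "fst t4 ''hm'' w = (if w = v \<and> x \<noteq> 0 then ?cv (x - 1) else fst t1 ''hm'' w)" for w
    using e1 e3 by (auto simp: t4_def fst_nwrite x_def)
  have v4: "fst t4 ''v'' 0 = v" "fst t4 ''core'' v = 0" using e1 e4 by auto
  note nc = sem_nearest_core[OF r4 v4(1) v(2) v4(2), folded t5_def]
  have e5: "y \<notin> {''x'', ''u'', ''hm'', ''core''} \<Longrightarrow> fst t5 y = fst t1 y" for y
    using e4 by (simp add: t5_def sem_frame_fst)
  have cl: "bval (nz (NRead ''client'' (V ''v''))) t1 \<longleftrightarrow> v \<in> clients I"
    using inputsD(4)[OF readyD(1)[OF r1]] e1 by simp
  show "w \<noteq> v \<Longrightarrow> x \<in> {''st'', ''hm'', ''core''} \<Longrightarrow> fst (sem find_home t) x w = fst t x w" for x w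
    unfolding run using o1 e5 e4 nc(2) h4 by auto
  show "placed (sem find_home t) v"
  proof (cases "v \<in> clients I")
    case False
    then show ?thesis unfolding run cl placed_def using e1 by (auto simp: reach_def)
  next
    case True
    have run5: "sem find_home t = t5" using run cl True by simp
    have vr: "v \<in> reach I r \<longleftrightarrow> x \<noteq> 0"
      using ng True by (auto simp: reach_def split: if_splits)
    have cov5: "fst t5 ''cov'' = ?cv" using e5 e1 by simp
    have st5: "fst t5 ''st'' v = 0" using e5 e1 by simp
    have c4: "fst t4 ''cov'' = ?cv" using e4 e1 by simp
    \<comment> \<open>Two selected facilities within \<open>r\<close> of one client would be within
      \<open>2 * r\<close> of each other. So the outcome does not depend on which write of
      \<open>nearest_core\<close> comes last.\<close>
    have uniq: "i = j" if "chosen ?cv i" "D v i \<le> r" "chosen ?cv j" "D v j \<le> r" for i j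
    proof (rule ccontr)
      assume "i \<noteq> j"
      then have "2 * r < D i j" using sep that unfolding separated_centers_def by blast
      moreover have "D i j \<le> 2 * r"
        using close_facilities[OF True, of i j] that good_points by (auto simp: chosen_by_def)
      ultimately show False by simp
    qed
    show ?thesis
    proof (cases "\<exists>i. chosen ?cv i \<and> D v i \<le> r")
      case ex: True
      then have h: "fst t5 ''hm'' v \<noteq> 0" "chosen ?cv (fst t5 ''hm'' v - 1)"
        "D v (fst t5 ''hm'' v - 1) \<le> r" "fst t5 ''core'' v = 1"
        using nc(1) unfolding c4 if_P[OF ex] by simp_all
      have "v \<in> reach I r" using True h by (auto simp: reach_def chosen_by_def)
      moreover have "fst t5 ''hm'' v = Suc i" if "chosen ?cv i" "D v i \<le> r" for i
        using uniq[OF that h(2,3)] h(1) by simp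
      ultimately show ?thesis unfolding run5 placed_def cov5 st5 using h by (metis zero_less_one)
    next
      case nex: False
      then have h: "fst t5 ''hm'' v = (if x \<noteq> 0 then ?cv (x - 1) else 0)" "fst t5 ''core'' v = 0"
        using nc(1) h4[of v] e1 unfolding c4 if_not_P[OF nex] by simp_all
      show ?thesis
      proof (cases "x = 0")
        case True
        then have "fst t5 ''hm'' v = 0" "v \<notin> reach I r" using h(1) vr by auto
        then show ?thesis unfolding run5 placed_def st5 h(2) by blast
      next
        case False
        have g: "good I r (x - 1)" "D v (x - 1) \<le> r" "\<forall>w. good I r w \<longrightarrow> D v w \<le> r \<longrightarrow> U w \<le> U (x - 1)"
          using ng unfolding if_not_P[OF False] by blast+
        have c: "?cv (x - 1) \<noteq> 0" "chosen ?cv (?cv (x - 1) - 1)"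
          using sep g(1) unfolding separated_centers_def by blast+
        then have "\<not> D v (?cv (x - 1) - 1) \<le> r" using nex by blast
        moreover have h': "fst t5 ''hm'' v = ?cv (x - 1)" using h(1) False by simp
        ultimately show ?thesis
          unfolding run5 placed_def cov5 st5 h(2) h' using vr g c(1) nex False by blast
      qed
    qed
  qed
qed

lemma sem_find_homes:
  assumes s: "ready s" and sep: "separated_centers (fst s ''cov'')" and v: "v < n"
  shows "placed (sem find_homes s) v"
proof -
  let ?P = "\<lambda>k t. \<forall>v<k. placed t v"
  have "?P (fst s ''n'' 0) (sem find_homes s)"
    unfolding find_homes_def
  proof (rule sem_For_invariant[where P = ?P], goal_cases)
    case (3 k t)
    have t: "ready t" using s by (rule ready_frame) (auto simp: 3)
    have k: "k < n" using 3 inputsD[OF readyD(1)[OF s]] by simp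
    have c: "fst t ''cov'' = fst s ''cov''" by (simp add: 3)
    have sep': "separated_centers (fst t ''cov'')" using sep c by simp
    let ?t = "sem find_home t"
    have c': "fst ?t ''cov'' = fst t ''cov''" by (simp add: sem_frame_fst)
    note h = sem_find_home[OF t 3(2) k sep']
    show ?case
    proof (intro allI impI)
      fix v assume "v < Suc k"
      have "placed ?t v"
      proof (cases "v = k")
        case False
        then have "fst ?t ''st'' v = fst t ''st'' v" "fst ?t ''hm'' v = fst t ''hm'' v"
          "fst ?t ''core'' v = fst t ''core'' v" using h(2) by auto
        moreover have "placed t v" using 3(5) False \<open>v < Suc k\<close> by simp
        ultimately show ?thesis unfolding placed_def c' by simp
      qed (use h(1) in simp)
      then show "placed (nwrite ''v'' 0 (Suc k) ?t) v" by (simp add: placed_def fst_nwrite)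
    qed
  qed (auto simp: program_defs)
  then show ?thesis using v inputsD[OF readyD(1)[OF s]] by simp
qed

lemma selecting_separated:
  assumes s: "ready s" and sel: "selecting n s"
  shows "separated_centers (fst s ''cov'')"
proof -
  obtain q where "growing I r (fst s ''m'') (fst s ''cov'') (fst s ''near'') (fst s ''pa'') (fst s ''ro'') q"
    using sel unfolding selecting_def by blast
  then interpret growing I r "fst s ''m''" "fst s ''cov''" "fst s ''near''" "fst s ''pa''" "fst s ''ro''" q .
  show ?thesis using covered apart selecting_clustering(2)[OF s sel] unfolding separated_centers_def by blast
qed

lemma homes_locale:
  assumes s: "ready s" and sel: "selecting n s" and pl: "\<And>v. v < n \<Longrightarrow> placed s v"
  shows "homes I r (fst s ''m'') (\<lambda>u. fst s ''cov'' u - 1) (fst s ''pa'') (fst s ''ro'') (\<lambda>v. fst s ''hm'' v - 1)"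
proof -
  interpret clustering I r "fst s ''m''" "\<lambda>u. fst s ''cov'' u - 1" "fst s ''pa''" "fst s ''ro''"
    using selecting_clustering(1)[OF s sel] .
  show ?thesis
  proof unfold_locales
    fix v assume v: "v \<in> reach I r"
    note p = pl[OF reach_less[OF v], unfolded placed_def]
    have c: "chosen (fst s ''cov'') i \<longleftrightarrow> good I r i \<and> fst s ''cov'' i - 1 = i" for i
      using selecting_clustering(2)[OF s sel, of i] by (auto simp: chosen_by_def)
    show "fst s ''hm'' v - 1 = i" if "good I r i" "fst s ''cov'' i - 1 = i" "D v i \<le> r" for i
      using p v c that by auto
    show "(good I r (fst s ''hm'' v - 1) \<and> fst s ''cov'' (fst s ''hm'' v - 1) - 1 = fst s ''hm'' v - 1 \<and>
        D v (fst s ''hm'' v - 1) \<le> r) \<or>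
      (\<exists>u. good I r u \<and> D v u \<le> r \<and> fst s ''hm'' v - 1 = fst s ''cov'' u - 1 \<and>
         (\<forall>w. good I r w \<longrightarrow> D v w \<le> r \<longrightarrow> U w \<le> U u))"
      using p v unfolding c by auto
  qed
qed

end

section \<open>Packing the stars\<close>

locale packing = input I r + homes I r m cov pa ro hm
  for I :: "nat supplier" and r m cov pa ro hm
begin

definition static :: "mem \<Rightarrow> bool" where
  "static s \<longleftrightarrow> ready s \<and> fst s ''m'' = m \<and> fst s ''pa'' = pa \<and> fst s ''ro'' = ro \<and>
     (\<forall>v<n. (if v \<in> reach I r then fst s ''hm'' v = Suc (hm v) else fst s ''hm'' v = 0) \<and>
        (0 < fst s ''core'' v \<longleftrightarrow> v \<in> reach I r \<and> core v))"

lemma staticD: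
  assumes "static s"
  shows "ready s" "fst s ''m'' = m" "fst s ''pa'' = pa" "fst s ''ro'' = ro"
    "v \<in> reach I r \<Longrightarrow> fst s ''hm'' v = Suc (hm v)"
    "v < n \<Longrightarrow> 0 < fst s ''hm'' v \<longleftrightarrow> v \<in> reach I r"
    "v < n \<Longrightarrow> 0 < fst s ''core'' v \<longleftrightarrow> v \<in> reach I r \<and> core v"
    "fst s ''n'' 0 = n" "fst s ''l'' 0 = lb I"
  using assms reach_less inputsD(1,2)[OF readyD(1)] unfolding static_def
  by (auto split: if_splits)

lemma static_frame:
  assumes "static s"
    and "\<And>x. x \<in> {''n'', ''l'', ''client'', ''facility'', ''U'', ''good'', ''m'', ''pa'', ''ro'', ''hm'', ''core''} \<Longrightarrow>
      fst t x = fst s x"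
    and "\<And>x. x \<in> {''r'', ''d''} \<Longrightarrow> snd t x = snd s x"
  shows "static t"
proof -
  have "ready t"
  proof (rule ready_frame[of s])
    show "ready s" using assms(1) by (simp add: static_def)
    show "snd t x = snd s x" if "x \<in> {''r'', ''d''}" for x using assms(3)[OF that] .
    fix x
    show "x \<in> {''n'', ''l'', ''client'', ''facility'', ''U'', ''good'', ''m''} \<Longrightarrow> fst t x = fst s x"
      by (rule assms(2)) auto
  qed
  then show ?thesis using assms(1) assms(2)[of "''m''"] assms(2)[of "''pa''"] assms(2)[of "''ro''"]
      assms(2)[of "''hm''"] assms(2)[of "''core''"]
    by (simp add: static_def)
qed

lemma static_sem:
  assumes "static s"
    and "nwrites p \<inter> {''n'', ''l'', ''client'', ''facility'', ''U'', ''good'', ''m'', ''pa'', ''ro'', ''hm'', ''core''} = {}"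
    and "rwrites p \<inter> {''r'', ''d''} = {}"
  shows "static (sem p s)"
  using assms(1)
proof (rule static_frame)
  fix x
  show "x \<in> {''n'', ''l'', ''client'', ''facility'', ''U'', ''good'', ''m'', ''pa'', ''ro'', ''hm'', ''core''} \<Longrightarrow>
      fst (sem p s) x = fst s x"
    using assms(2) by (intro sem_frame_fst) (metis IntI empty_iff)
  show "x \<in> {''r'', ''d''} \<Longrightarrow> snd (sem p s) x = snd s x"
    using assms(3) by (intro sem_frame_snd) (metis IntI empty_iff)
qed

lemma sel_less: "sel p \<Longrightarrow> p < n"
  by (simp add: sel_def good_less)

end

section \<open>Sorting the clients into rows by home\<close>

lemma pair_inj: "a * n + b = c * n + d \<Longrightarrow> b < n \<Longrightarrow> d < n \<Longrightarrow> a = c \<and> b = (d::nat)"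
  by (metis add.commute div_mult_self1 div_less add_0 mult.commute mod_mult_self2 mod_less not_less_zero)

text \<open>\<open>A\<close> consists of the clients pushed so far. Clause \<open>pos\<close>
  records the effect of pushing core clients first: a client that is not core never gets one of the
  first \<open>lb I\<close> positions.\<close>

locale pushing = packing I r m cov pa ro hm
  for I :: "nat supplier" and r m cov pa ro hm +
  fixes A :: "nat set" and st sp len ca :: "nat \<Rightarrow> nat"
  assumes A: "A \<subseteq> reach I r"
    and sp: "sel p \<Longrightarrow> bij_betw sp {v \<in> A. hm v = p} {..<len p}"
    and st: "v < card (points I) \<Longrightarrow> st v = (if v \<in> A then Suc (hm v) else 0)"
    and ca: "v \<in> A \<Longrightarrow> ca (hm v * card (points I) + sp v) = v"
    and pos: "v \<in> A \<Longrightarrow> core v \<or> lb I \<le> sp v"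
begin

lemma len_card: "sel p \<Longrightarrow> len p = card {v \<in> A. hm v = p}"
  using bij_betw_same_card[OF sp[of p]] by simp

lemma sp_less: "v \<in> A \<Longrightarrow> sp v < len (hm v)"
  using sp[of "hm v"] A sel_hm by (auto simp: bij_betw_def)

lemma A_less: "A \<subseteq> {..<n}" using A reach_less by auto

lemma len_le: "sel p \<Longrightarrow> len p \<le> n"
  using len_card[of p] card_mono[of "{..<n}" "{v \<in> A. hm v = p}"] A_less by auto

lemma len_less:
  assumes "sel p" "v < n" "v \<notin> A"
  shows "len p < n"
proof -
  have "card {v \<in> A. hm v = p} < card {..<n}"
    using A_less assms by (intro psubset_card_mono) auto
  then show ?thesis using len_card[OF assms(1)] by simp
qed

lemma push_step:
  assumes v: "v \<in> reach I r" "v \<notin> A" and c: "core v \<or> lb I \<le> len (hm v)"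
  shows "pushing I r m cov pa ro hm (insert v A) (st(v := Suc (hm v))) (sp(v := len (hm v)))
    (len(hm v := Suc (len (hm v)))) (ca(hm v * n + len (hm v) := v))"
proof -
  let ?p = "hm v"
  have selp: "sel ?p" and vn: "v < n" using v sel_hm reach_less by auto
  \<comment> \<open>\<open>v\<close> is not in the row yet, so the row has a free cell and the new
    entry cannot run into the row of another facility.\<close>
  have lp: "len ?p < n" using len_less[OF selp vn v(2)] .
  show ?thesis
  proof unfold_locales
    show "insert v A \<subseteq> reach I r" using v A by simp
    fix w
    show "w < n \<Longrightarrow> (st(v := Suc (hm v))) w = (if w \<in> insert v A then Suc (hm w) else 0)"
      using st by auto
    assume w: "w \<in> insert v A"
    show "(ca(hm v * n + len (hm v) := v)) (hm w * n + (sp(v := len (hm v))) w) = w"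
    proof (cases "w = v")
      case False
      then have wA: "w \<in> A" using w by simp
      have "sp w < len (hm w)" using sp_less[OF wA] .
      moreover have "len (hm w) \<le> n" using len_le sel_hm wA A by blast
      ultimately have "sp w < n" by simp
      then have "hm w * n + sp w \<noteq> ?p * n + len ?p"
        using pair_inj[of "hm w" n "sp w" ?p "len ?p"] lp sp_less[OF wA] by auto
      then show ?thesis using False ca[OF wA] by simp
    qed simp
    show "core w \<or> lb I \<le> (sp(v := len (hm v))) w"
      using w pos c by auto
  next
    fix p assume p: "sel p"
    show "bij_betw (sp(v := len (hm v))) {w \<in> insert v A. hm w = p} {..<(len(hm v := Suc (len (hm v)))) p}"
    proof (cases "p = ?p")
      case True
      have "bij_betw (sp(v := len ?p)) {w \<in> A. hm w = ?p} {..<len ?p}"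
        using sp[OF selp] v(2) by (subst bij_betw_cong[of _ _ sp]) auto
      then have "bij_betw (sp(v := len ?p)) ({w \<in> A. hm w = ?p} \<union> {v}) ({..<len ?p} \<union> {(sp(v := len ?p)) v})"
        using v(2) by (subst notIn_Un_bij_betw3[symmetric]) auto
      moreover have "{w \<in> A. hm w = ?p} \<union> {v} = {w \<in> insert v A. hm w = p}" using True by auto
      moreover have "{..<len ?p} \<union> {(sp(v := len ?p)) v} = {..<(len(hm v := Suc (len (hm v)))) p}"
        using True by (auto simp: less_Suc_eq)
      ultimately show ?thesis by simp
    next
      case False
      then have "{w \<in> insert v A. hm w = p} = {w \<in> A. hm w = p}" by auto
      then show ?thesis using sp[OF p] v(2) False by (subst bij_betw_cong[of _ _ sp]) auto
    qed
  qed
qed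

end

context packing
begin

abbreviation "pushed A s \<equiv> pushing I r m cov pa ro hm A (fst s ''st'') (fst s ''sp'') (fst s ''len'') (fst s ''ca'')"

lemma sem_push_home:
  assumes s: "static s" and p: "pushed A s" and v: "fst s ''v'' 0 = v" "v \<in> reach I r" "v \<notin> A"
    and c: "core v \<or> lb I \<le> fst s ''len'' (hm v)"
  shows "pushed (insert v A) (sem push_home s)"
proof -
  note d = staticD[OF s]
  interpret pushing I r m cov pa ro hm A "fst s ''st''" "fst s ''sp''" "fst s ''len''" "fst s ''ca''"
    using p .
  from push_step[OF v(2,3) c] show ?thesis
    unfolding push_home_def push_def using v d(5)[OF v(2)] d(8) by (simp add: fst_nwrite)
qed

lemma sem_push_clients:
  assumes s: "static s" and st: "\<And>v. v < n \<Longrightarrow> fst s ''st'' v = 0" and len: "\<And>p. p < n \<Longrightarrow> fst s ''len'' p = 0"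
  shows "pushed (reach I r) (sem push_clients s)"
proof -
  note n = staticD(8)[OF s]
  let ?l1 = "PFor ''v'' (PIf (nz (NRead ''core'' (V ''v''))) push_home PSkip)"
  let ?l2 = "PFor ''v'' (PIf (Conj (nz (NRead ''hm'' (V ''v''))) (eqb (NRead ''core'' (V ''v'')) (NConst 0))) push_home PSkip)"
  define A where "A k = {v \<in> reach I r. v < k \<and> core v}" for k
  define B where "B k = {v \<in> reach I r. core v \<or> v < k}" for k
  have "pushed (A (fst s ''n'' 0)) (sem ?l1 s)"
  proof (rule sem_For_invariant[where P = "\<lambda>k. pushed (A k)"], goal_cases)
    case 2
    show ?case
      by unfold_locales (use st len sel_less in \<open>auto simp: A_def fst_nwrite bij_betw_def\<close>)
  next
    case (3 k t)
    have t: "static t" using s by (rule static_frame) (auto simp: 3)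
    have k: "k < n" using 3 n by simp
    have cond: "bval (nz (NRead ''core'' (V ''v''))) t \<longleftrightarrow> k \<in> reach I r \<and> core k"
      using 3(2) staticD(7)[OF t k] by simp
    show ?case
    proof (cases "k \<in> reach I r \<and> core k")
      case True
      have "pushed (insert k (A k)) (sem push_home t)"
        by (rule sem_push_home[OF t 3(5,2)]) (use True in \<open>auto simp: A_def\<close>)
      moreover have "insert k (A k) = A (Suc k)" using True by (auto simp: A_def less_Suc_eq)
      ultimately show ?thesis using True unfolding sem.simps cond by (simp add: fst_nwrite)
    next
      case False
      then have "A (Suc k) = A k" by (auto simp: A_def less_Suc_eq)
      then show ?thesis using 3(5) unfolding sem.simps(1,5) cond if_not_P[OF False] by (simp add: fst_nwrite)
    qed
  qed (simp add: program_defs)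
  moreover have "A n = B 0" using reach_less by (auto simp: A_def B_def)
  ultimately have start: "pushed (B 0) (sem ?l1 s)" using n by simp
  let ?s = "sem ?l1 s"
  have s1: "static ?s" by (rule static_sem[OF s]) simp_all
  have "pushed (B (fst ?s ''n'' 0)) (sem ?l2 ?s)"
  proof (rule sem_For_invariant[where P = "\<lambda>k. pushed (B k)"], goal_cases)
    case 2
    then show ?case using start by (simp add: fst_nwrite)
  next
    case (3 k t)
    have t: "static t" using s1 by (rule static_frame) (auto simp: 3)
    have k: "k < n" using 3 staticD(8)[OF s1] by simp
    have cond: "bval (Conj (nz (NRead ''hm'' (V ''v''))) (eqb (NRead ''core'' (V ''v'')) (NConst 0))) t \<longleftrightarrow>
        k \<in> reach I r \<and> \<not> core k"
      using 3(2) staticD(6,7)[OF t k] by auto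
    show ?case
    proof (cases "k \<in> reach I r \<and> \<not> core k")
      case True
      interpret p: pushing I r m cov pa ro hm "B k" "fst t ''st''" "fst t ''sp''" "fst t ''len''" "fst t ''ca''"
        using 3(5) .
      \<comment> \<open>All core clients have been pushed by the first loop, so every row is already
        long enough for a client that is not core.\<close>
      have "lb I \<le> card {v \<in> reach I r. hm v = hm k \<and> core v}"
        using core_card[of "hm k"] sel_hm True by blast
      also have "\<dots> \<le> card {v \<in> B k. hm v = hm k}"
        using fin by (intro card_mono) (auto simp: B_def)
      also have "\<dots> = fst t ''len'' (hm k)" using p.len_card[of "hm k"] sel_hm True by simp
      finally have "pushed (insert k (B k)) (sem push_home t)"
        by (intro sem_push_home[OF t 3(5,2)]) (use True in \<open>auto simp: B_def\<close>)
      moreover have "insert k (B k) = B (Suc k)" using True by (auto simp: B_def less_Suc_eq)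
      ultimately show ?thesis using True unfolding sem.simps cond by (simp add: fst_nwrite)
    next
      case False
      then have "B (Suc k) = B k" by (auto simp: B_def less_Suc_eq)
      then show ?thesis using 3(5) unfolding sem.simps(1,5) cond if_not_P[OF False] by (simp add: fst_nwrite)
    qed
  qed (simp add: program_defs)
  moreover have "B n = reach I r" using reach_less by (auto simp: B_def)
  ultimately show ?thesis using staticD(8)[OF s1] unfolding push_clients_def by simp
qed

end

text \<open>Star \<open>p\<close> consists of the clients \<open>v\<close> with \<open>st v = Suc p\<close>, at the positions \<open>lo p..<len p\<close>; the first
  \<open>lo p\<close> core clients of \<open>p\<close> have left for the parent or, at a root, are not served.\<close>

locale layout = packing I r m cov pa ro hm
  for I :: "nat supplier" and r m cov pa ro hm +
  fixes lo st sp len ca :: "nat \<Rightarrow> nat"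
  assumes sp: "sel p \<Longrightarrow> bij_betw sp {v \<in> reach I r. st v = Suc p} {lo p..<len p}"
    and st_sel: "v \<in> reach I r \<Longrightarrow> st v \<noteq> 0 \<Longrightarrow> sel (st v - 1)"
    and st_zero: "v \<in> reach I r \<Longrightarrow> st v = 0 \<longleftrightarrow> (\<exists>p k. sel p \<and> ro p = p \<and> k < lo p \<and> v = ca (p * card (points I) + k))"
    and st_home: "v \<in> reach I r \<Longrightarrow> st v \<noteq> 0 \<Longrightarrow> st v = Suc (hm v) \<or>
      core v \<and> ro (hm v) \<noteq> hm v \<and> st v = Suc (pa (hm v)) \<and> (\<exists>k<lo (hm v). v = ca (hm v * card (points I) + k))"
    and st_other: "v < card (points I) \<Longrightarrow> v \<notin> reach I r \<Longrightarrow> st v = 0"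
    and ca_core: "sel p \<Longrightarrow> k < lb I \<Longrightarrow>
      ca (p * card (points I) + k) \<in> reach I r \<and> core (ca (p * card (points I) + k)) \<and> hm (ca (p * card (points I) + k)) = p"
    and ca_inj: "sel p \<Longrightarrow> k < lb I \<Longrightarrow> k' < lb I \<Longrightarrow>
      ca (p * card (points I) + k) = ca (p * card (points I) + k') \<Longrightarrow> k = k'"
    and ca_st: "sel p \<Longrightarrow> lo p \<le> k \<Longrightarrow> k < lb I \<Longrightarrow>
      st (ca (p * card (points I) + k)) = Suc p \<and> sp (ca (p * card (points I) + k)) = k"
    and lo_less: "sel p \<Longrightarrow> lo p < lb I" and len_ge: "sel p \<Longrightarrow> lb I \<le> len p"
begin

lemma ca_inj2:
  assumes "sel p" "sel p'" "k < lb I" "k' < lb I" "ca (p * n + k) = ca (p' * n + k')"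
  shows "p = p' \<and> k = k'"
proof -
  have "p = p'" using ca_core[OF assms(1,3)] ca_core[OF assms(2,4)] assms(5) by simp
  then show ?thesis using ca_inj assms by blast
qed

context
  fixes y v
  assumes y: "sel y" and less: "Suc (lo y) < lb I" and v: "v = ca (y * n + lo y)"
begin

lemma v_facts: "v \<in> reach I r" "core v" "hm v = y" "st v = Suc y" "sp v = lo y"
  using ca_core[OF y, of "lo y"] ca_st[OF y, of "lo y"] less v by auto

lemma v_new:
  assumes "sel p" "(lo(y := Suc (lo y))) p \<le> k" "k < lb I"
  shows "ca (p * n + k) \<noteq> v" "lo p \<le> k"
proof -
  show lo: "lo p \<le> k" using assms(2) by (auto split: if_splits)
  show "ca (p * n + k) \<noteq> v"
    using ca_inj2[OF assms(1) y assms(3), of "lo y"] less v assms(2) by auto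
qed

lemma sp_left: "bij_betw sp {w \<in> reach I r. w \<noteq> v \<and> st w = Suc y} {Suc (lo y)..<len y}"
proof -
  have "bij_betw sp ({w \<in> reach I r. st w = Suc y} - {v}) ({lo y..<len y} - {sp v})"
    using sp[OF y] v_facts lo_less[OF y] len_ge[OF y] by (intro bij_betw_DiffI) (auto simp: bij_betw_def)
  moreover have "{w \<in> reach I r. st w = Suc y} - {v} = {w \<in> reach I r. w \<noteq> v \<and> st w = Suc y}" by auto
  moreover have "{lo y..<len y} - {sp v} = {Suc (lo y)..<len y}" using v_facts by auto
  ultimately show ?thesis by simp
qed

lemma drop_root:
  assumes "ro y = y"
  shows "layout I r m cov pa ro hm (lo(y := Suc (lo y))) (st(v := 0)) sp len ca"
proof unfold_locales
  fix p assume p: "sel p"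
  show "bij_betw sp {w \<in> reach I r. (st(v := 0)) w = Suc p} {(lo(y := Suc (lo y))) p..<len p}"
  proof (cases "p = y")
    case True
    have "{w \<in> reach I r. (st(v := 0)) w = Suc p} = {w \<in> reach I r. w \<noteq> v \<and> st w = Suc y}" using True by auto
    then show ?thesis using sp_left True by simp
  next
    case False
    then have "{w \<in> reach I r. (st(v := 0)) w = Suc p} = {w \<in> reach I r. st w = Suc p}" using v_facts by auto
    then show ?thesis using sp[OF p] False by simp
  qed
  show "(lo(y := Suc (lo y))) p < lb I" "lb I \<le> len p" using lo_less[OF p] len_ge[OF p] less by auto
  fix k assume k: "k < lb I"
  show "ca (p * n + k) \<in> reach I r \<and> core (ca (p * n + k)) \<and> hm (ca (p * n + k)) = p"
    using ca_core[OF p k] .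
  show "ca (p * n + k) = ca (p * n + k') \<Longrightarrow> k = k'" if "k' < lb I" for k'
    using ca_inj[OF p k that] .
  assume "(lo(y := Suc (lo y))) p \<le> k"
  from v_new[OF p this k] show "(st(v := 0)) (ca (p * n + k)) = Suc p \<and> sp (ca (p * n + k)) = k"
    using ca_st[OF p _ k] by simp
next
  fix w
  show "w < n \<Longrightarrow> w \<notin> reach I r \<Longrightarrow> (st(v := 0)) w = 0" using st_other by auto
  assume w: "w \<in> reach I r"
  have "(\<exists>p k. sel p \<and> ro p = p \<and> k < (lo(y := Suc (lo y))) p \<and> w = ca (p * n + k)) \<longleftrightarrow>
      w = v \<or> (\<exists>p k. sel p \<and> ro p = p \<and> k < lo p \<and> w = ca (p * n + k))"
    using y v assms by (auto simp: less_Suc_eq split: if_splits)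
  then show "(st(v := 0)) w = 0 \<longleftrightarrow>
      (\<exists>p k. sel p \<and> ro p = p \<and> k < (lo(y := Suc (lo y))) p \<and> w = ca (p * n + k))"
    using st_zero[OF w] by auto
  assume z: "(st(v := 0)) w \<noteq> 0"
  then show "sel ((st(v := 0)) w - 1)" using st_sel[OF w] by (auto split: if_splits)
  have "w \<noteq> v" using z by auto
  then show "(st(v := 0)) w = Suc (hm w) \<or> core w \<and> ro (hm w) \<noteq> hm w \<and> (st(v := 0)) w = Suc (pa (hm w)) \<and>
      (\<exists>k<(lo(y := Suc (lo y))) (hm w). w = ca (hm w * n + k))"
    using st_home[OF w] z by (auto intro: less_SucI)
qed

text \<open>The positions of both stars remain intervals: the star of \<open>y\<close> loses its
  first position and the star of the parent gains a new last one. \<open>ca\<close> does not change,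
  so the client keeps its index at its home.\<close>

lemma move_up:
  assumes nr: "ro y \<noteq> y" and ne: "pa y \<noteq> y"
  shows "layout I r m cov pa ro hm (lo(y := Suc (lo y))) (st(v := Suc (pa y))) (sp(v := len (pa y)))
    (len(pa y := Suc (len (pa y)))) ca"
proof unfold_locales
  have selp: "sel (pa y)" using sel_pa[OF y nr] by simp
  fix p assume p: "sel p"
  show "bij_betw (sp(v := len (pa y))) {w \<in> reach I r. (st(v := Suc (pa y))) w = Suc p}
      {(lo(y := Suc (lo y))) p..<(len(pa y := Suc (len (pa y)))) p}"
  proof (cases "p = y")
    case True
    then have "{w \<in> reach I r. (st(v := Suc (pa y))) w = Suc p} = {w \<in> reach I r. w \<noteq> v \<and> st w = Suc y}"
      using ne by auto
    then show ?thesis using sp_left True ne by (simp cong: bij_betw_cong) (subst bij_betw_cong[of _ _ sp]; auto)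
  next
    case py: False
    show ?thesis
    proof (cases "p = pa y")
      case True
      let ?S = "{w \<in> reach I r. st w = Suc (pa y)}" and ?sp = "sp(v := len (pa y))"
      have vS: "v \<notin> ?S" using v_facts ne by simp
      have "bij_betw ?sp ?S {lo (pa y)..<len (pa y)}"
        using sp[OF selp] vS by (subst bij_betw_cong[of _ _ sp]) auto
      then have "bij_betw ?sp (?S \<union> {v}) ({lo (pa y)..<len (pa y)} \<union> {?sp v})"
        using vS by (subst notIn_Un_bij_betw3[symmetric]) auto
      moreover have "?S \<union> {v} = {w \<in> reach I r. (st(v := Suc (pa y))) w = Suc p}"
        using True v_facts by auto
      moreover have "{lo (pa y)..<len (pa y)} \<union> {?sp v} = {(lo(y := Suc (lo y))) p..<(len(pa y := Suc (len (pa y)))) p}"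
        using True py len_ge[OF selp] lo_less[OF selp] by auto
      ultimately show ?thesis by simp
    next
      case False
      then have e: "{w \<in> reach I r. (st(v := Suc (pa y))) w = Suc p} = {w \<in> reach I r. st w = Suc p}"
        using py v_facts by auto
      have "v \<notin> {w \<in> reach I r. st w = Suc p}" using py v_facts by auto
      then show ?thesis unfolding e using sp[OF p] False py by (subst bij_betw_cong[of _ _ sp]) auto
    qed
  qed
  show "(lo(y := Suc (lo y))) p < lb I" "lb I \<le> (len(pa y := Suc (len (pa y)))) p"
    using lo_less[OF p] len_ge[OF p] less by auto
  fix k assume k: "k < lb I"
  show "ca (p * n + k) \<in> reach I r \<and> core (ca (p * n + k)) \<and> hm (ca (p * n + k)) = p"
    using ca_core[OF p k] .
  show "ca (p * n + k) = ca (p * n + k') \<Longrightarrow> k = k'" if "k' < lb I" for k'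
    using ca_inj[OF p k that] .
  assume "(lo(y := Suc (lo y))) p \<le> k"
  from v_new[OF p this k] show "(st(v := Suc (pa y))) (ca (p * n + k)) = Suc p \<and> (sp(v := len (pa y))) (ca (p * n + k)) = k"
    using ca_st[OF p _ k] by simp
next
  have selp: "sel (pa y)" using sel_pa[OF y nr] by simp
  fix w
  show "w < n \<Longrightarrow> w \<notin> reach I r \<Longrightarrow> (st(v := Suc (pa y))) w = 0" using st_other v_facts by auto
  assume w: "w \<in> reach I r"
  have "(\<exists>p k. sel p \<and> ro p = p \<and> k < (lo(y := Suc (lo y))) p \<and> w = ca (p * n + k)) \<longleftrightarrow>
      (\<exists>p k. sel p \<and> ro p = p \<and> k < lo p \<and> w = ca (p * n + k))"
    by (rule ex_cong1, rule ex_cong1) (use nr in auto)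
  moreover have "st v \<noteq> 0" using v_facts by simp
  ultimately show "(st(v := Suc (pa y))) w = 0 \<longleftrightarrow>
      (\<exists>p k. sel p \<and> ro p = p \<and> k < (lo(y := Suc (lo y))) p \<and> w = ca (p * n + k))"
    using st_zero[OF w] by auto
  assume z: "(st(v := Suc (pa y))) w \<noteq> 0"
  then show "sel ((st(v := Suc (pa y))) w - 1)" using st_sel[OF w] selp by (auto split: if_splits)
  show "(st(v := Suc (pa y))) w = Suc (hm w) \<or> core w \<and> ro (hm w) \<noteq> hm w \<and> (st(v := Suc (pa y))) w = Suc (pa (hm w)) \<and>
      (\<exists>k<(lo(y := Suc (lo y))) (hm w). w = ca (hm w * n + k))"
  proof (cases "w = v")
    case True
    then show ?thesis using v_facts nr v by auto
  next
    case False
    then show ?thesis using st_home[OF w] z by (auto intro: less_SucI)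
  qed
qed

end

end

text \<open>\<open>core_card\<close> makes every row at least \<open>lb I\<close> long, and
  \<open>pos\<close> turns the clients at its first \<open>lb I\<close> positions into core
  clients.\<close>

lemma (in pushing) pushing_layout:
  assumes "A = reach I r"
  shows "layout I r m cov pa ro hm (\<lambda>_. 0) st sp len ca"
proof unfold_locales
  have st': "v \<in> reach I r \<Longrightarrow> st v = Suc (hm v)" for v using st[of v] reach_less assms by simp
  fix p assume p: "sel p"
  have "{v \<in> reach I r. st v = Suc p} = {v \<in> A. hm v = p}" using st' assms by auto
  then show "bij_betw sp {v \<in> reach I r. st v = Suc p} {0..<len p}" using sp[OF p] by (simp add: atLeast0LessThan)
  show "0 < lb I" by (rule lb_pos)
  have "lb I \<le> card {v \<in> reach I r. hm v = p \<and> core v}" by (rule core_card[OF p])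
  also have "\<dots> \<le> len p" unfolding len_card[OF p] assms using fin by (intro card_mono) auto
  finally show len: "lb I \<le> len p" .
  have k: "ca (p * n + k) \<in> A \<and> hm (ca (p * n + k)) = p \<and> sp (ca (p * n + k)) = k" if "k < lb I" for k
  proof -
    have "k \<in> sp ` {v \<in> A. hm v = p}" using sp[OF p] that len by (auto simp: bij_betw_def)
    then obtain v where "v \<in> A" "hm v = p" "sp v = k" by auto
    then show ?thesis using ca[of v] by auto
  qed
  fix k assume kl: "k < lb I"
  show "ca (p * n + k) \<in> reach I r \<and> core (ca (p * n + k)) \<and> hm (ca (p * n + k)) = p"
    using k[OF kl] pos[of "ca (p * n + k)"] kl assms by auto
  show "ca (p * n + k) = ca (p * n + k') \<Longrightarrow> k = k'" if "k' < lb I" for k'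
    using k[OF kl] k[OF that] by metis
  show "st (ca (p * n + k)) = Suc p \<and> sp (ca (p * n + k)) = k"
    using k[OF kl] st' assms by auto
next
  have st': "v \<in> reach I r \<Longrightarrow> st v = Suc (hm v)" for v using st[of v] reach_less assms by simp
  fix v
  show "v < n \<Longrightarrow> v \<notin> reach I r \<Longrightarrow> st v = 0" using st assms by simp
  assume v: "v \<in> reach I r"
  show "sel (st v - 1)" using st'[OF v] sel_hm[OF v] by simp
  show "st v = 0 \<longleftrightarrow> (\<exists>p k. sel p \<and> ro p = p \<and> k < 0 \<and> v = ca (p * n + k))" using st'[OF v] by simp
  show "st v = Suc (hm v) \<or> core v \<and> ro (hm v) \<noteq> hm v \<and> st v = Suc (pa (hm v)) \<and> (\<exists>k<0. v = ca (hm v * n + k))"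
    using st'[OF v] by simp
qed

section \<open>Passing clients up the trees\<close>

context packing
begin

abbreviation "laid lo s \<equiv> layout I r m cov pa ro hm lo (fst s ''st'') (fst s ''sp'') (fst s ''len'') (fst s ''ca'')"

lemma sem_pass_one:
  assumes s: "static s" and l: "laid lo s" and y: "fst s ''y'' 0 = y" "sel y" "lo y = 0" "ro y \<noteq> y \<Longrightarrow> pa y \<noteq> y"
    and q: "fst s ''rm'' y = q" "q < lb I"
  shows "laid (lo(y := q)) (sem pass_one s)"
    and "\<And>p. p \<noteq> y \<Longrightarrow> ro y \<noteq> y \<longrightarrow> p \<noteq> pa y \<Longrightarrow> fst (sem pass_one s) ''len'' p = fst s ''len'' p"
    and "fst (sem pass_one s) ''len'' y = fst s ''len'' y"
proof -
  note n = staticD(8)[OF s]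
  interpret l0: layout I r m cov pa ro hm lo "fst s ''st''" "fst s ''sp''" "fst s ''len''" "fst s ''ca''"
    using l .
  \<comment> \<open>The loop always runs \<open>n\<close> rounds, but only the first
    \<open>q\<close> of them move a client, hence \<open>min k q\<close>. All \<open>q\<close> moves
    take place because \<open>q < lb I\<close> and the core of \<open>y\<close> alone has
    \<open>lb I\<close> clients.\<close>
  let ?P = "\<lambda>k t. laid (lo(y := min k q)) t \<and>
    (\<forall>p. (ro y \<noteq> y \<longrightarrow> p \<noteq> pa y) \<longrightarrow> fst t ''len'' p = fst s ''len'' p)"
  have "?P (fst s ''n'' 0) (sem pass_one s)"
    unfolding pass_one_def
  proof (rule sem_For_invariant[where P = ?P], goal_cases)
    case 2
    have "lo(y := 0) = lo" using y(3) by auto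
    then show ?case using l by (simp add: fst_nwrite)
  next
    case (3 k t)
    have t: "static t" using s by (rule static_frame) (auto simp: 3)
    note d = staticD[OF t]
    have y': "fst t ''y'' 0 = y" "fst t ''rm'' y = q" "fst t ''k'' 0 = k" using 3 y q by auto
    interpret l: layout I r m cov pa ro hm "lo(y := min k q)" "fst t ''st''" "fst t ''sp''" "fst t ''len''" "fst t ''ca''"
      by (rule conjunct1[OF 3(5)])
    show ?case
    proof (cases "k < q")
      case False
      then show ?thesis using 3(5) y' by (simp add: move_client_def fst_nwrite)
    next
      case True
      let ?v = "fst t ''ca'' (y * n + k)"
      have lo: "(lo(y := min k q)) y = k" "(lo(y := min k q))(y := Suc k) = lo(y := min (Suc k) q)"
        using True by auto
      show ?thesis
      proof (cases "ro y = y")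
        case ro: True
        have "layout I r m cov pa ro hm (lo(y := min (Suc k) q)) ((fst t ''st'')(?v := 0)) (fst t ''sp'') (fst t ''len'') (fst t ''ca'')"
          using l.drop_root[OF y(2) _ refl ro] True q(2) unfolding lo by simp
        then show ?thesis using 3(5) True ro y' d(3,4,8) by (simp add: move_client_def fst_nwrite)
      next
        case ro: False
        have "layout I r m cov pa ro hm (lo(y := min (Suc k) q)) ((fst t ''st'')(?v := Suc (pa y)))
            ((fst t ''sp'')(?v := fst t ''len'' (pa y))) ((fst t ''len'')(pa y := Suc (fst t ''len'' (pa y)))) (fst t ''ca'')"
          using l.move_up[OF y(2) _ refl ro y(4)[OF ro]] True q(2) unfolding lo by simp
        then show ?thesis using 3(5) True ro y' d(3,4,8)
          by (simp add: move_client_def push_def fst_nwrite)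
      qed
    qed
  qed (simp add: program_defs)
  moreover have "q \<le> n"
  proof -
    have "lb I \<le> card {v \<in> reach I r. hm v = y \<and> core v}" by (rule core_card[OF y(2)])
    also have "\<dots> \<le> card {..<n}" using reach_less by (intro card_mono) auto
    finally show ?thesis using q(2) by simp
  qed
  ultimately have P: "?P n (sem pass_one s)" "min n q = q" using n by auto
  show "laid (lo(y := q)) (sem pass_one s)" using P by simp
  show "\<And>p. p \<noteq> y \<Longrightarrow> ro y \<noteq> y \<longrightarrow> p \<noteq> pa y \<Longrightarrow> fst (sem pass_one s) ''len'' p = fst s ''len'' p"
    using P by blast
  show "fst (sem pass_one s) ''len'' y = fst s ''len'' y" using P y(4) by metis
qed

definition ordered :: "(nat \<Rightarrow> nat) \<Rightarrow> bool" where
  "ordered od \<longleftrightarrow>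
     (\<forall>k<n. od k \<noteq> 0 \<longrightarrow> sel (od k - 1)) \<and>
     (\<forall>i. sel i \<longrightarrow> (\<exists>k<n. od k = Suc i)) \<and>
     (\<forall>k<n. \<forall>k'<n. od k = od k' \<longrightarrow> od k \<noteq> 0 \<longrightarrow> k = k') \<and>
     (\<forall>k<n. \<forall>i. od k = Suc i \<longrightarrow> ro i \<noteq> i \<longrightarrow> (\<exists>k'<k. od k' = Suc (pa i)))"

definition handled :: "(nat \<Rightarrow> nat) \<Rightarrow> nat \<Rightarrow> nat \<Rightarrow> bool" where
  "handled od t p \<longleftrightarrow> (\<exists>k. n - t \<le> k \<and> k < n \<and> od k = Suc p)"

text \<open>\<open>rm\<close> of a node that has not been handled may still hold a value from an
  earlier radius, hence the default 0. Divisibility persists once it is reached, because the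
  children of a handled node have been handled before and nothing is added to its star any
  more.\<close>

definition passing :: "nat \<Rightarrow> mem \<Rightarrow> bool" where
  "passing t s \<longleftrightarrow> laid (\<lambda>p. if handled (fst s ''order'') t p then fst s ''rm'' p else 0) s \<and>
     (\<forall>p. handled (fst s ''order'') t p \<longrightarrow> lb I dvd (fst s ''len'' p - fst s ''rm'' p))"

lemma sem_pass_node:
  assumes s: "static s" and od: "ordered (fst s ''order'')" and t: "fst s ''t'' 0 = t" "t < n" and p: "passing t s"
  shows "passing (Suc t) (sem pass_node s)"
proof -
  let ?od = "fst s ''order''"
  have o1: "\<And>k. k < n \<Longrightarrow> ?od k \<noteq> 0 \<Longrightarrow> sel (?od k - 1)"
    and o3: "\<And>k k'. k < n \<Longrightarrow> k' < n \<Longrightarrow> ?od k = ?od k' \<Longrightarrow> ?od k \<noteq> 0 \<Longrightarrow> k = k'"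
    and o4: "\<And>k i. k < n \<Longrightarrow> ?od k = Suc i \<Longrightarrow> ro i \<noteq> i \<Longrightarrow> \<exists>k'<k. ?od k' = Suc (pa i)"
    using od unfolding ordered_def by ((elim conjE, simp)+)
  define j where "j = n - Suc t"
  have j: "j < n" "n - Suc t = j" "n - t = Suc j" using t by (auto simp: j_def)
  define x where "x = ?od j"
  define s1 where "s1 = sem (assign ''x'' (NRead ''order'' (NSub (V ''n'') (succ (V ''t''))))) s"
  define s2 where "s2 = sem (assign ''y'' (pred (V ''x''))) s1"
  define s3 where "s3 = sem (PN ''rm'' (V ''y'') (NMod (NRead ''len'' (V ''y'')) (V ''l''))) s2"
  define s4 where "s4 = sem pass_one s3"
  have run: "sem pass_node s = (if bval (nz (V ''x'')) s1 then s4 else s1)"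
    by (simp only: pass_node_def sem.simps s1_def s2_def s3_def s4_def)
  note d = staticD[OF s]
  have x1: "fst s1 ''x'' 0 = x" using t d(8) j by (simp add: s1_def fst_nwrite x_def)
  have e1: "z \<noteq> ''x'' \<Longrightarrow> fst s1 z = fst s z" for z by (simp add: s1_def fst_nwrite)
  have handled_Suc: "handled ?od (Suc t) p \<longleftrightarrow> handled ?od t p \<or> x = Suc p" for p
  proof
    assume "handled ?od (Suc t) p"
    then obtain k where k: "j \<le> k" "k < n" "?od k = Suc p" unfolding handled_def j(2) by blast
    then show "handled ?od t p \<or> x = Suc p"
      unfolding handled_def j(3) x_def by (cases "k = j") (auto intro!: exI[of _ k])
  next
    assume "handled ?od t p \<or> x = Suc p"
    then show "handled ?od (Suc t) p"
      unfolding handled_def j(2,3) x_def using j(1) by (auto intro: Suc_leD)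
  qed
  show ?thesis
  proof (cases "x = 0")
    case True
    then have "handled ?od (Suc t) p \<longleftrightarrow> handled ?od t p" for p using handled_Suc by simp
    then show ?thesis using p x1 True e1 unfolding run passing_def by (simp cong: if_cong)
  next
    case False
    define y where "y = x - 1"
    have xy: "x = Suc y" using False by (simp add: y_def)
    have sely: "sel y" using o1[OF j(1)] xy unfolding x_def by simp
    have y2: "fst s2 ''y'' 0 = y" using x1 xy by (simp add: s2_def fst_nwrite)
    have e2: "z \<notin> {''x'', ''y''} \<Longrightarrow> fst s2 z = fst s z" for z using e1 by (simp add: s2_def fst_nwrite)
    define q where "q = fst s ''len'' y mod lb I"
    have rm3: "fst s3 ''rm'' = (fst s ''rm'')(y := q)"
      using y2 e2 d(9) by (simp add: s3_def fst_nwrite q_def)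
    have e3: "z \<notin> {''x'', ''y'', ''rm''} \<Longrightarrow> fst s3 z = fst s z" for z using e2 by (simp add: s3_def fst_nwrite)
    have y3: "fst s3 ''y'' 0 = y" using y2 by (simp add: s3_def fst_nwrite)
    have q: "q < lb I" using lb_pos by (simp add: q_def)
    have st3: "static s3"
      using s by (rule static_frame) (auto simp: s3_def s2_def s1_def fst_nwrite)
    let ?lo = "\<lambda>p. if handled ?od t p then fst s ''rm'' p else 0"
    have l3: "laid ?lo s3" using p unfolding passing_def by (simp add: e3)
    have nd: "\<not> handled ?od t y"
      using o3[OF j(1)] xy unfolding handled_def x_def j by (metis Suc_n_not_le_n nat.distinct(1))
    have lo0: "?lo y = 0" using nd by simp
    \<comment> \<open>The parent occurs earlier in \<open>order\<close> and is therefore handled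
      later, so its star may still grow.\<close>
    have pay: "pa y \<noteq> y \<and> \<not> handled ?od t (pa y)" if ro: "ro y \<noteq> y"
    proof -
      obtain k where k: "k < j" "?od k = Suc (pa y)" using o4[OF j(1) _ ro] xy unfolding x_def by blast
      have "pa y \<noteq> y" using o3[of k j] k j xy unfolding x_def by auto
      moreover have "\<not> handled ?od t (pa y)"
      proof
        assume "handled ?od t (pa y)"
        then obtain k' where "Suc j \<le> k'" "k' < n" "?od k' = Suc (pa y)" unfolding handled_def j by blast
        then show False using o3[of k k'] k j by simp
      qed
      ultimately show ?thesis by blast
    qed
    note po = sem_pass_one[OF st3 l3 y3 sely lo0 _ _ q, folded s4_def]
    have l4: "laid (?lo(y := q)) s4"
      by (rule po(1)) (use pay rm3 in auto)
    have len4: "fst s4 ''len'' p = fst s ''len'' p" if "p = y \<or> (ro y \<noteq> y \<longrightarrow> p \<noteq> pa y)" for p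
      using that po(2)[of p] po(3) pay rm3 e3 by (cases "p = y") auto
    have e4: "fst s4 ''order'' = ?od" "fst s4 ''rm'' = (fst s ''rm'')(y := q)"
      using e3 rm3 by (auto simp: s4_def sem_frame_fst)
    have "(\<lambda>p. if handled ?od (Suc t) p then fst s4 ''rm'' p else 0) = ?lo(y := q)"
      using handled_Suc xy e4 by auto
    moreover have "lb I dvd fst s4 ''len'' p - fst s4 ''rm'' p" if dn: "handled ?od (Suc t) p" for p
    proof (cases "p = y")
      case True
      then show ?thesis using len4[of y] e4 by (simp add: q_def dvd_minus_mod)
    next
      case False
      then have dt: "handled ?od t p" using dn handled_Suc xy by simp
      then have "ro y \<noteq> y \<longrightarrow> p \<noteq> pa y" using pay by blast
      then show ?thesis using len4[of p] e4 False p dt unfolding passing_def by simp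
    qed
    ultimately have "passing (Suc t) s4" using l4 e4 unfolding passing_def by simp
    then show ?thesis using x1 xy unfolding run by simp
  qed
qed

lemma sem_pass_up:
  assumes s: "static s" and od: "ordered (fst s ''order'')" and p: "pushed (reach I r) s"
  defines "t \<equiv> sem pass_up s"
  shows "laid (fst t ''rm'') t" and "sel p \<Longrightarrow> lb I dvd (fst t ''len'' p - fst t ''rm'' p)"
proof -
  have "passing (fst s ''n'' 0) t"
    unfolding t_def pass_up_def
  proof (rule sem_For_invariant[where P = passing], goal_cases)
    case 2
    interpret pushing I r m cov pa ro hm "reach I r" "fst s ''st''" "fst s ''sp''" "fst s ''len''" "fst s ''ca''"
      using p .
    have "\<not> handled od 0 p" for od p by (auto simp: handled_def)
    then show ?case using pushing_layout[OF refl] by (simp add: passing_def fst_nwrite)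
  next
    case (3 k t)
    have t: "static t" using s by (rule static_frame) (auto simp: 3)
    have k: "k < n" using 3 staticD(8)[OF s] by simp
    have o: "ordered (fst t ''order'')" using od by (simp add: 3)
    show ?case using sem_pass_node[OF t o 3(2) k 3(5)] by (simp add: passing_def fst_nwrite cong: if_cong)
  qed (simp add: program_defs)
  then have P: "passing n t" unfolding staticD(8)[OF s] .
  have "fst t ''order'' = fst s ''order''" by (simp add: t_def sem_frame_fst)
  then have d: "sel p \<Longrightarrow> handled (fst t ''order'') n p" for p
    using od unfolding ordered_def handled_def by auto
  interpret l: layout I r m cov pa ro hm "\<lambda>p. if handled (fst t ''order'') n p then fst t ''rm'' p else 0"
      "fst t ''st''" "fst t ''sp''" "fst t ''len''" "fst t ''ca''"
    using P unfolding passing_def by blast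
  show "laid (fst t ''rm'') t"
  proof unfold_locales
    fix p assume p: "sel p"
    note dp = d[OF p]
    show "bij_betw (fst t ''sp'') {v \<in> reach I r. fst t ''st'' v = Suc p} {fst t ''rm'' p..<fst t ''len'' p}"
      using l.sp[OF p] dp by simp
    show "fst t ''rm'' p < lb I" "lb I \<le> fst t ''len'' p" using l.lo_less[OF p] l.len_ge[OF p] dp by auto
    fix k assume k: "k < lb I"
    show "fst t ''ca'' (p * n + k) \<in> reach I r \<and> core (fst t ''ca'' (p * n + k)) \<and> hm (fst t ''ca'' (p * n + k)) = p"
      using l.ca_core[OF p k] .
    show "k = k'" if "k' < lb I" "fst t ''ca'' (p * n + k) = fst t ''ca'' (p * n + k')" for k'
      using l.ca_inj[OF p k that] .
    show "fst t ''st'' (fst t ''ca'' (p * n + k)) = Suc p \<and> fst t ''sp'' (fst t ''ca'' (p * n + k)) = k"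
      if "fst t ''rm'' p \<le> k" using l.ca_st[OF p _ k] that dp by simp
  next
    fix v
    show "v < n \<Longrightarrow> v \<notin> reach I r \<Longrightarrow> fst t ''st'' v = 0" using l.st_other .
    assume v: "v \<in> reach I r"
    show "fst t ''st'' v \<noteq> 0 \<Longrightarrow> sel (fst t ''st'' v - 1)" using l.st_sel[OF v] .
    show "fst t ''st'' v = 0 \<longleftrightarrow> (\<exists>p k. sel p \<and> ro p = p \<and> k < fst t ''rm'' p \<and> v = fst t ''ca'' (p * n + k))"
      unfolding l.st_zero[OF v] by (rule ex_cong1, rule ex_cong1) (use d in auto)
    show "fst t ''st'' v \<noteq> 0 \<Longrightarrow> fst t ''st'' v = Suc (hm v) \<or>
      core v \<and> ro (hm v) \<noteq> hm v \<and> fst t ''st'' v = Suc (pa (hm v)) \<and> (\<exists>k<fst t ''rm'' (hm v). v = fst t ''ca'' (hm v * n + k))"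
      using l.st_home[OF v] d[OF sel_hm[OF v]] by simp
  qed
  show "sel p \<Longrightarrow> lb I dvd (fst t ''len'' p - fst t ''rm'' p)"
    using P d unfolding passing_def by blast
qed

end

section \<open>Blocks and their facilities\<close>

context layout
begin

definition block :: "nat \<Rightarrow> nat" where
  "block v = (if st v = 0 then 0 else Suc ((st v - 1) * n + (sp v - lo (st v - 1)) div lb I))"

lemma index_less:
  assumes v: "v \<in> reach I r" "st v = Suc p"
  shows "lo p \<le> sp v" "sp v < len p" "(sp v - lo p) div lb I < n"
proof -
  have p: "sel p" using st_sel[OF v(1)] v(2) by simp
  have "sp v \<in> {lo p..<len p}" using sp[OF p] v by (auto simp: bij_betw_def)
  then show *: "lo p \<le> sp v" "sp v < len p" by auto
  have "len p - lo p = card {v \<in> reach I r. st v = Suc p}" using bij_betw_same_card[OF sp[OF p]] by simp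
  also have "\<dots> \<le> card {..<n}" using reach_less by (intro card_mono) auto
  finally have "sp v - lo p < n" using * by auto
  then show "(sp v - lo p) div lb I < n" by (meson div_le_dividend le_less_trans)
qed

text \<open>The number of a block can be decoded by \<open>div\<close> and \<open>mod\<close>
  because the index within a star is below \<open>n\<close>.\<close>

lemma block_eq:
  assumes "v \<in> reach I r"
  shows "block v = Suc b \<longleftrightarrow> st v = Suc (b div n) \<and> (sp v - lo (b div n)) div lb I = b mod n"
proof
  assume b: "block v = Suc b"
  then obtain p where p: "st v = Suc p" by (cases "st v") (auto simp: block_def)
  have "b = p * n + (sp v - lo p) div lb I" using b p by (simp add: block_def)
  then show "st v = Suc (b div n) \<and> (sp v - lo (b div n)) div lb I = b mod n"
    using index_less(3)[OF assms p] p by simp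
qed (simp add: block_def)

lemma block_star:
  assumes "v \<in> reach I r" "block v = Suc b"
  shows "sel (b div n)" and "hm v = b div n \<or> core v \<and> ro (hm v) \<noteq> hm v \<and> pa (hm v) = b div n"
proof -
  have "st v = Suc (b div n)" using assms block_eq by blast
  then show "sel (b div n)" "hm v = b div n \<or> core v \<and> ro (hm v) \<noteq> hm v \<and> pa (hm v) = b div n"
    using st_sel[OF assms(1)] st_home[OF assms(1)] by auto
qed

lemma block_card:
  assumes dvd: "\<And>p. sel p \<Longrightarrow> lb I dvd (len p - lo p)" and v: "v \<in> reach I r" "block v = Suc b"
  shows "card {v \<in> reach I r. block v = Suc b} = lb I"
proof -
  define p i where "p = b div n" "i = b mod n"
  note pi = this
  have p: "sel p" using block_star[OF v] pi by simp
  have vb: "st v = Suc p" "(sp v - lo p) div lb I = i" using v block_eq pi by auto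
  \<comment> \<open>The interval of positions is a multiple of \<open>lb I\<close> long, so even the
    last block of the star is complete.\<close>
  obtain c where c: "len p - lo p = lb I * c" using dvd[OF p] by blast
  have "sp v - lo p < lb I * c" using index_less[OF v(1) vb(1)] c by linarith
  then have "i < c" using vb(2) lb_pos by (metis less_mult_imp_div_less mult.commute)
  then have "lb I * Suc i \<le> lb I * c" by (intro mult_left_mono) auto
  then have ic: "lb I * i + lb I \<le> len p - lo p" using c by simp
  let ?J = "{lo p + lb I * i..<lo p + lb I * i + lb I}"
  have J: "?J \<subseteq> {lo p..<len p}" using ic len_ge[OF p] lo_less[OF p] by auto
  have div_eq: "(x - lo p) div lb I = i \<longleftrightarrow> x \<in> ?J" if "lo p \<le> x" for x
  proof
    assume "(x - lo p) div lb I = i"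
    moreover have "x - lo p = lb I * ((x - lo p) div lb I) + (x - lo p) mod lb I" by simp
    moreover have "(x - lo p) mod lb I < lb I" using lb_pos by simp
    ultimately show "x \<in> ?J" using that by (metis add_less_cancel_left atLeastLessThan_iff le_add1 le_add_diff_inverse add.assoc)
  next
    assume "x \<in> ?J"
    then have "x - lo p = i * lb I + (x - lo p - i * lb I)" "x - lo p - i * lb I < lb I"
      by (auto simp: mult.commute)
    then show "(x - lo p) div lb I = i" by (metis add.right_neutral div_less div_mult_self3 lb_pos less_not_refl)
  qed
  have "{v \<in> reach I r. block v = Suc b} = {v \<in> {v \<in> reach I r. st v = Suc p}. sp v \<in> ?J}"
    using block_eq div_eq index_less(1) pi by auto
  moreover have "bij_betw sp {v \<in> {v \<in> reach I r. st v = Suc p}. sp v \<in> ?J} ?J"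
    using sp[OF p] J unfolding bij_betw_def inj_on_def by (auto simp: set_eq_iff)
  ultimately show ?thesis using bij_betw_same_card by fastforce
qed

lemma block_rest:
  assumes "v \<in> reach I r" "block v = 0"
  shows "ro (hm v) = hm v \<and> (\<exists>k<lo (hm v). v = ca (hm v * n + k))"
proof -
  have "st v = 0" using assms(2) by (simp add: block_def split: if_splits)
  then obtain p k where p: "sel p" "ro p = p" "k < lo p" "v = ca (p * n + k)"
    using st_zero[OF assms(1)] by blast
  then have "hm v = p" using ca_core[OF p(1), of k] lo_less[OF p(1)] by auto
  then show ?thesis using p by auto
qed

lemma rest_card:
  assumes "sel q"
  shows "card {v \<in> reach I r. block v = 0 \<and> hm v = q} < lb I"
proof -
  have "{v \<in> reach I r. block v = 0 \<and> hm v = q} \<subseteq> (\<lambda>k. ca (q * n + k)) ` {..<lo q}"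
    using block_rest by auto
  then have "card {v \<in> reach I r. block v = 0 \<and> hm v = q} \<le> card ((\<lambda>k. ca (q * n + k)) ` {..<lo q})"
    by (intro card_mono) auto
  also have "\<dots> \<le> lo q" using card_image_le[of "{..<lo q}"] by simp
  finally show ?thesis using lo_less[OF assms] by simp
qed

end

section \<open>Computing the blocks and opening copies\<close>

context packing
begin

lemma sem_make_blocks:
  assumes s: "static s" and l: "laid (fst s ''rm'') s" and v: "v < n"
  shows "fst (sem make_blocks s) ''bk'' v =
    layout.block I (fst s ''rm'') (fst s ''st'') (fst s ''sp'') v"
proof -
  interpret layout I r m cov pa ro hm "fst s ''rm''" "fst s ''st''" "fst s ''sp''" "fst s ''len''" "fst s ''ca''"
    using l .
  let ?P = "\<lambda>k t. \<forall>v<k. fst t ''bk'' v = block v"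
  have "?P (fst s ''n'' 0) (sem make_blocks s)"
    unfolding make_blocks_def
  proof (rule sem_For_invariant[where P = ?P], goal_cases)
    case (3 k t)
    have t: "static t" using s by (rule static_frame) (auto simp: 3)
    have e: "fst t ''st'' = fst s ''st''" "fst t ''sp'' = fst s ''sp''" "fst t ''rm'' = fst s ''rm''"
      by (auto simp: 3)
    show ?case using 3(2,5) e staticD(8,9)[OF t] by (auto simp: fst_nwrite less_Suc_eq block_def)
  qed (auto simp: fst_nwrite)
  then show ?thesis using v staticD(8)[OF s] by simp
qed

definition block_ok :: "(nat \<Rightarrow> nat) \<Rightarrow> bool" where
  "block_ok bk \<longleftrightarrow> (\<forall>v<n. bk v \<noteq> 0 \<longrightarrow> v \<in> reach I r)"

definition nonvoid :: "(nat \<Rightarrow> nat) \<Rightarrow> nat \<Rightarrow> bool" where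
  "nonvoid bk b \<longleftrightarrow> (\<exists>v\<in>reach I r. bk v = Suc b)"

lemma sem_find_location:
  assumes s: "static s" and ok: "block_ok (fst s ''bk'')" and x: "fst s ''x'' 0 = 0" and b: "fst s ''b'' 0 = b"
  defines "bk \<equiv> fst s ''bk''" and "x \<equiv> fst (sem find_location s) ''x'' 0"
  shows "if x = 0 then \<not> nonvoid bk b
    else x - 1 \<in> reach I r \<and> bk (x - 1) = Suc b \<and>
      (\<forall>v\<in>reach I r. bk v = Suc b \<longrightarrow> U (m (hm v)) \<le> U (m (hm (x - 1))))"
proof -
  let ?Q = "\<lambda>k x. if x = 0 then \<forall>v<k. bk v \<noteq> Suc b
    else x - 1 < n \<and> bk (x - 1) = Suc b \<and> (\<forall>v<k. bk v = Suc b \<longrightarrow> U (m (hm v)) \<le> U (m (hm (x - 1))))"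
  let ?P = "\<lambda>k t. ?Q k (fst t ''x'' 0)"
  have "?P (fst s ''n'' 0) (sem find_location s)"
    unfolding find_location_def
  proof (rule sem_For_invariant[where P = ?P], goal_cases)
    case (3 k t)
    have t: "static t" using s by (rule static_frame) (auto simp: 3)
    note d = staticD[OF t]
    have k: "k < n" using 3 staticD(8)[OF s] by simp
    have bt: "fst t ''b'' 0 = b" "fst t ''bk'' = bk" using b by (auto simp: 3 bk_def)
    have Um: "fst t ''U'' (fst t ''m'' (fst t ''hm'' v - 1)) = U (m (hm v))" if "v < n" "bk v \<noteq> 0" for v
    proof -
      have v: "v \<in> reach I r" using ok that by (auto simp: block_ok_def bk_def)
      have "m (hm v) \<in> facilities I" using sel_points(3)[OF sel_hm[OF v]] .
      then show ?thesis using d(2) d(5)[OF v] inputsD(6)[OF readyD(1)[OF d(1)]] by simp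
    qed
    define x where "x = fst t ''x'' 0"
    have Q: "?Q k x" using 3(5) unfolding x_def .
    have e: "fst (nwrite ''v'' 0 (Suc k) u) ''x'' = fst u ''x''" for u by (simp add: fst_nwrite)
    show ?case
    proof (cases "bk k = Suc b \<and> (x = 0 \<or> U (m (hm (x - 1))) < U (m (hm k)))")
      case True
      have "fst t ''U'' (fst t ''m'' (fst t ''hm'' (x - 1) - 1)) = U (m (hm (x - 1)))" if "x \<noteq> 0"
        using Um[of "x - 1"] Q that by simp
      then have eq: "fst (sem (PIf (eqb (NRead ''bk'' (V ''v'')) (succ (V ''b'')))
       (PIf (orb (eqb (V ''x'') (NConst 0))
            (NLess (NRead ''U'' (NRead ''m'' (pred (NRead ''hm'' (pred (V ''x''))))))
              (NRead ''U'' (NRead ''m'' (pred (NRead ''hm'' (V ''v'')))))))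
         (assign ''x'' (succ (V ''v''))) PSkip)
       PSkip) t) ''x'' 0 = Suc k"
        using True 3(2) bt Um[OF k] by (auto simp: fst_nwrite x_def[symmetric])
      have "?Q (Suc k) (Suc k)"
      proof -
        have "U (m (hm v)) \<le> U (m (hm k))" if "v < k" "bk v = Suc b" for v
          using True Q that by (cases "x = 0") (auto intro: order_trans less_imp_le)
        then show ?thesis using True k by (auto simp: less_Suc_eq)
      qed
      then show ?thesis unfolding e eq .
    next
      case False
      have "fst t ''U'' (fst t ''m'' (fst t ''hm'' (x - 1) - 1)) = U (m (hm (x - 1)))" if "x \<noteq> 0"
        using Um[of "x - 1"] Q that by simp
      then have eq: "fst (sem (PIf (eqb (NRead ''bk'' (V ''v'')) (succ (V ''b'')))
       (PIf (orb (eqb (V ''x'') (NConst 0))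
            (NLess (NRead ''U'' (NRead ''m'' (pred (NRead ''hm'' (pred (V ''x''))))))
              (NRead ''U'' (NRead ''m'' (pred (NRead ''hm'' (V ''v'')))))))
         (assign ''x'' (succ (V ''v''))) PSkip)
       PSkip) t) ''x'' 0 = x"
        using False 3(2) bt Um[OF k] by (auto simp: fst_nwrite x_def[symmetric])
      have "?Q (Suc k) x"
        using Q False by (cases "x = 0") (auto simp: less_Suc_eq)
      then show ?thesis unfolding e eq .
    qed
  qed (auto simp: fst_nwrite x)
  then have Q: "?Q n x" unfolding staticD(8)[OF s] x_def .
  show ?thesis
  proof (cases "x = 0")
    case True
    then show ?thesis using Q reach_less by (auto simp: nonvoid_def)
  next
    case False
    then have "x - 1 \<in> reach I r" using Q ok by (auto simp: block_ok_def bk_def)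
    then show ?thesis using Q False reach_less by auto
  qed
qed

text \<open>\<open>cp u\<close> is both the number of copies of \<open>u\<close> opened so far and
  the next free copy index; the last two clauses make \<open>(fa, ci)\<close> a bijection onto these
  copies. Void blocks get \<open>ex\<close> 0 so that the insertion phase passes over them.\<close>

definition opened_upto :: "nat \<Rightarrow> mem \<Rightarrow> bool" where
  "opened_upto B s \<longleftrightarrow> (let bk = fst s ''bk''; fa = fst s ''fa''; ci = fst s ''ci''; cp = fst s ''cp''; ex = fst s ''ex'' in
     (\<forall>b<B. nonvoid bk b \<longrightarrow>
        (\<exists>w\<in>reach I r. bk w = Suc b \<and> fa b = m (hm w) \<and>
          (\<forall>v\<in>reach I r. bk v = Suc b \<longrightarrow> U (m (hm v)) \<le> U (m (hm w)))) \<and>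
        ci b < cp (fa b) \<and> ex b = U (fa b) - lb I) \<and>
     (\<forall>b<B. \<not> nonvoid bk b \<longrightarrow> ex b = 0) \<and>
     (\<forall>b<B. \<forall>b'<B. nonvoid bk b \<longrightarrow> nonvoid bk b' \<longrightarrow> fa b = fa b' \<longrightarrow> ci b = ci b' \<longrightarrow> b = b') \<and>
     (\<forall>u<n. \<forall>k<cp u. \<exists>b<B. nonvoid bk b \<and> fa b = u \<and> ci b = k))"

lemma sem_open_block:
  assumes s: "static s" and ok: "block_ok (fst s ''bk'')" and b: "fst s ''s'' 0 * n + fst s ''i'' 0 = B"
    and o: "opened_upto B s"
  shows "opened_upto (Suc B) (sem open_block s)"
proof -
  define bk where "bk = fst s ''bk''"
  define s1 where "s1 = sem (assign ''b'' (pair (V ''s'') (V ''i''))) s"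
  define s2 where "s2 = sem (assign ''x'' (NConst 0)) s1"
  define s3 where "s3 = sem find_location s2"
  define s4 where "s4 = sem (assign ''y'' (NRead ''m'' (pred (NRead ''hm'' (pred (V ''x'')))))) s3"
  define s5 where "s5 = sem (PN ''fa'' (V ''b'') (V ''y'') ;; PN ''ci'' (V ''b'') (NRead ''cp'' (V ''y'')) ;;
         PN ''cp'' (V ''y'') (succ (NRead ''cp'' (V ''y''))) ;;
         PN ''ex'' (V ''b'') (NSub (NRead ''U'' (V ''y'')) (V ''l''))) s4"
  define s6 where "s6 = sem (PN ''ex'' (V ''b'') (NConst 0)) s3"
  have run: "sem open_block s = (if bval (nz (V ''x'')) s3 then s5 else s6)"
    by (simp only: open_block_def sem.simps s1_def s2_def s3_def s4_def s5_def s6_def)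
  have st2: "static s2" unfolding s2_def s1_def by (intro static_sem s) simp_all
  have st3: "static s3" unfolding s3_def by (intro static_sem st2) simp_all
  have e2: "z \<notin> {''b'', ''x''} \<Longrightarrow> fst s2 z = fst s z" for z by (simp add: s2_def s1_def fst_nwrite)
  have b2: "fst s2 ''b'' 0 = B" "fst s2 ''x'' 0 = 0"
    using b staticD(8)[OF s] by (simp_all add: s2_def s1_def fst_nwrite)
  have e3: "z \<notin> {''b'', ''x'', ''v''} \<Longrightarrow> fst s3 z = fst s z" for z using e2 by (simp add: s3_def sem_frame_fst)
  have b3: "fst s3 ''b'' 0 = B" using b2 by (simp add: s3_def sem_frame_fst)
  define x where "x = fst s3 ''x'' 0"
  have ok2: "block_ok (fst s2 ''bk'')" using ok e2 by simp
  have bk2: "fst s2 ''bk'' = fst s ''bk''" using e2 by simp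
  have loc: "if x = 0 then \<not> nonvoid bk B
    else x - 1 \<in> reach I r \<and> bk (x - 1) = Suc B \<and>
      (\<forall>v\<in>reach I r. bk v = Suc B \<longrightarrow> U (m (hm v)) \<le> U (m (hm (x - 1))))"
    using sem_find_location[OF st2 ok2 b2(2,1)] unfolding x_def s3_def bk_def bk2 .
  let ?fa = "fst s ''fa''" and ?ci = "fst s ''ci''" and ?cp = "fst s ''cp''" and ?ex = "fst s ''ex''"
  have o1: "\<And>b. b < B \<Longrightarrow> nonvoid bk b \<Longrightarrow>
        (\<exists>w\<in>reach I r. bk w = Suc b \<and> ?fa b = m (hm w) \<and>
          (\<forall>v\<in>reach I r. bk v = Suc b \<longrightarrow> U (m (hm v)) \<le> U (m (hm w)))) \<and>
        ?ci b < ?cp (?fa b) \<and> ?ex b = U (?fa b) - lb I"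
    and o2: "\<And>b. b < B \<Longrightarrow> \<not> nonvoid bk b \<Longrightarrow> ?ex b = 0"
    and o3: "\<And>b b'. b < B \<Longrightarrow> b' < B \<Longrightarrow> nonvoid bk b \<Longrightarrow> nonvoid bk b' \<Longrightarrow> ?fa b = ?fa b' \<Longrightarrow> ?ci b = ?ci b' \<Longrightarrow> b = b'"
    and o4: "\<And>u k. u < n \<Longrightarrow> k < ?cp u \<Longrightarrow> \<exists>b<B. nonvoid bk b \<and> ?fa b = u \<and> ?ci b = k"
    using o unfolding opened_upto_def Let_def bk_def[symmetric] by ((elim conjE, simp)+)
  show ?thesis
  proof (cases "x = 0")
    case True
    have nv: "\<not> nonvoid bk B" using loc True by simp
    have e6: "z \<notin> {''b'', ''x'', ''v'', ''ex''} \<Longrightarrow> fst s6 z = fst s z" for z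
      using e3 by (simp add: s6_def fst_nwrite)
    have ex6: "fst s6 ''ex'' = ?ex(B := 0)" using e3 b3 by (simp add: s6_def fst_nwrite)
    have e6': "fst s6 ''fa'' = ?fa" "fst s6 ''ci'' = ?ci" "fst s6 ''cp'' = ?cp" "fst s6 ''bk'' = bk"
      using e6 by (auto simp: bk_def)
    have "opened_upto (Suc B) s6"
      unfolding opened_upto_def Let_def ex6 e6'
    proof (intro conjI allI impI)
      fix b assume b: "b < Suc B" "nonvoid bk b"
      then have "b < B" using nv by (metis less_antisym)
      from o1[OF this b(2)] this
      show "\<exists>w\<in>reach I r. bk w = Suc b \<and> ?fa b = m (hm w) \<and>
          (\<forall>v\<in>reach I r. bk v = Suc b \<longrightarrow> U (m (hm v)) \<le> U (m (hm w)))"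
        "?ci b < ?cp (?fa b)" "(?ex(B := 0)) b = U (?fa b) - lb I" by auto
    next
      fix b assume "b < Suc B" "\<not> nonvoid bk b"
      then show "(?ex(B := 0)) b = 0" using o2[of b] by (cases "b = B") auto
    next
      fix b b' assume a: "b < Suc B" "b' < Suc B" "nonvoid bk b" "nonvoid bk b'" "?fa b = ?fa b'" "?ci b = ?ci b'"
      then have "b < B" "b' < B" using nv by (metis less_antisym)+
      then show "b = b'" using o3 a by blast
    next
      fix u k assume "u < n" "k < ?cp u"
      then obtain b where "b < B" "nonvoid bk b" "?fa b = u" "?ci b = k" using o4 by blast
      then show "\<exists>b<Suc B. nonvoid bk b \<and> ?fa b = u \<and> ?ci b = k" by (intro exI[of _ b]) auto
    qed
    then show ?thesis using True unfolding run x_def by simp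
  next
    case False
    define w where "w = x - 1"
    have w: "w \<in> reach I r" "bk w = Suc B" "\<And>v. v \<in> reach I r \<Longrightarrow> bk v = Suc B \<Longrightarrow> U (m (hm v)) \<le> U (m (hm w))"
      using loc False by (auto simp: w_def)
    define y where "y = m (hm w)"
    have yF: "y \<in> facilities I" using sel_points(3)[OF sel_hm[OF w(1)]] by (simp add: y_def)
    note d3 = staticD[OF st3]
    have "fst s3 ''x'' 0 - 1 = w" using w_def x_def by simp
    then have y4: "fst s4 ''y'' 0 = y"
      using d3(5)[OF w(1)] d3(2) by (simp add: s4_def fst_nwrite y_def)
    have e4: "z \<notin> {''b'', ''x'', ''v'', ''y''} \<Longrightarrow> fst s4 z = fst s z" for z
      using e3 by (simp add: s4_def fst_nwrite)
    have b4: "fst s4 ''b'' 0 = B" using b3 by (simp add: s4_def fst_nwrite)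
    have "fst s4 ''U'' y = U y" "fst s4 ''l'' 0 = lb I"
      using e4 inputsD(6)[OF readyD(1)[OF staticD(1)[OF s]] yF] staticD(9)[OF s] by auto
    then have e5: "fst s5 ''fa'' = ?fa(B := y)" "fst s5 ''ci'' = ?ci(B := ?cp y)"
      "fst s5 ''cp'' = ?cp(y := Suc (?cp y))" "fst s5 ''ex'' = ?ex(B := U y - lb I)" "fst s5 ''bk'' = bk"
      using e4 y4 b4 by (auto simp: s5_def fst_nwrite bk_def)
    have nv: "nonvoid bk B" using w by (auto simp: nonvoid_def)
    have fa_less: "?fa b < n" if "b < B" "nonvoid bk b" for b
      using o1[OF that] sel_points(3)[OF sel_hm] facility_less by auto
    have "opened_upto (Suc B) s5"
      unfolding opened_upto_def Let_def e5
    proof (intro conjI allI impI)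
      fix b assume b: "b < Suc B" "nonvoid bk b"
      have "(\<exists>w\<in>reach I r. bk w = Suc b \<and> (?fa(B := y)) b = m (hm w) \<and>
          (\<forall>v\<in>reach I r. bk v = Suc b \<longrightarrow> U (m (hm v)) \<le> U (m (hm w)))) \<and>
        (?ci(B := ?cp y)) b < (?cp(y := Suc (?cp y))) ((?fa(B := y)) b) \<and>
        (?ex(B := U y - lb I)) b = U ((?fa(B := y)) b) - lb I"
      proof (cases "b = B")
        case True
        then show ?thesis using w by (auto simp: y_def)
      next
        case False
        then have "b < B" using b by simp
        from o1[OF this b(2)] False show ?thesis by auto
      qed
      then show "\<exists>w\<in>reach I r. bk w = Suc b \<and> (?fa(B := y)) b = m (hm w) \<and>
          (\<forall>v\<in>reach I r. bk v = Suc b \<longrightarrow> U (m (hm v)) \<le> U (m (hm w)))"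
        "(?ci(B := ?cp y)) b < (?cp(y := Suc (?cp y))) ((?fa(B := y)) b)"
        "(?ex(B := U y - lb I)) b = U ((?fa(B := y)) b) - lb I" by blast+
    next
      fix b assume "b < Suc B" "\<not> nonvoid bk b"
      then show "(?ex(B := U y - lb I)) b = 0" using o2[of b] nv by (cases "b = B") auto
    next
      \<comment> \<open>Every copy index in use at \<open>y\<close> is below \<open>cp y\<close>, so
        the index given to the new block is fresh.\<close>
      have fresh: False if "b < B" "nonvoid bk b" "?fa b = y" "?ci b = ?cp y" for b
        using o1[OF that(1,2)] that by auto
      fix b b' assume a: "b < Suc B" "b' < Suc B" "nonvoid bk b" "nonvoid bk b'"
        "(?fa(B := y)) b = (?fa(B := y)) b'" "(?ci(B := ?cp y)) b = (?ci(B := ?cp y)) b'"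
      then show "b = b'"
        using o3[of b b'] fresh[of b] fresh[of b'] by (cases "b = B"; cases "b' = B") simp_all
    next
      fix u k assume u: "u < n" and k: "k < (?cp(y := Suc (?cp y))) u"
      show "\<exists>b<Suc B. nonvoid bk b \<and> (?fa(B := y)) b = u \<and> (?ci(B := ?cp y)) b = k"
      proof (cases "u = y \<and> k = ?cp y")
        case True
        then show ?thesis using nv by (intro exI[of _ B]) auto
      next
        case False
        then have "k < ?cp u" using k by (auto split: if_splits)
        then obtain b where "b < B" "nonvoid bk b" "?fa b = u" "?ci b = k" using o4[OF u] by blast
        then show ?thesis by (intro exI[of _ b]) auto
      qed
    qed
    then show ?thesis using False unfolding run x_def by simp
  qed
qed

lemma sem_open_blocks:
  assumes s: "static s" and ok: "block_ok (fst s ''bk'')" and cp: "\<And>u. u < n \<Longrightarrow> fst s ''cp'' u = 0"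
  shows "opened_upto (n * n) (sem open_blocks s)"
proof -
  have "opened_upto (fst s ''n'' 0 * n) (sem open_blocks s)"
    unfolding open_blocks_def
  proof (rule sem_For_invariant[where P = "\<lambda>k. opened_upto (k * n)"], goal_cases)
    case 2
    show ?case using cp by (simp add: opened_upto_def fst_nwrite)
  next
    case (3 k t)
    have t: "static t" using s by (rule static_frame) (auto simp: 3)
    have okt: "block_ok (fst t ''bk'')" using ok by (simp add: 3)
    have "opened_upto (k * n + fst t ''n'' 0) (sem (PFor ''i'' open_block) t)"
    proof (rule sem_For_invariant[where P = "\<lambda>j. opened_upto (k * n + j)"], goal_cases)
      case 2
      then show ?case using 3(5) by (simp add: opened_upto_def fst_nwrite)
    next
      case h: (3 j u)
      have u: "static u" using t by (rule static_frame) (auto simp: h)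
      have oku: "block_ok (fst u ''bk'')" using okt by (simp add: h)
      have "fst u ''s'' 0 * n + fst u ''i'' 0 = k * n + j" using h(2,3) 3(2) by simp
      from sem_open_block[OF u oku this h(5)] show ?case
        by (simp add: opened_upto_def fst_nwrite)
    qed (simp add: program_defs)
    then show ?case unfolding staticD(8)[OF t] by (simp add: opened_upto_def fst_nwrite add.commute)
  qed (simp add: program_defs)
  then show ?thesis unfolding staticD(8)[OF s] .
qed

end

section \<open>Inserting the surplus clients\<close>

text \<open>\<open>R0\<close> counts the clients left out at each root. \<open>rk\<close> is a
  ranking below \<open>n\<close> that decreases towards the root: it shows that a walk ends within
  \<open>n\<close> steps and visits no node twice.\<close>

locale surplus = packing I r m cov pa ro hm
  for I :: "nat supplier" and r m cov pa ro hm +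
  fixes ca R0 bk0 ex rk :: "nat \<Rightarrow> nat"
  assumes ca_core: "sel p \<Longrightarrow> k < lb I \<Longrightarrow>
      ca (p * card (points I) + k) \<in> reach I r \<and> core (ca (p * card (points I) + k)) \<and> hm (ca (p * card (points I) + k)) = p"
    and ca_inj: "sel p \<Longrightarrow> k < lb I \<Longrightarrow> k' < lb I \<Longrightarrow>
      ca (p * card (points I) + k) = ca (p * card (points I) + k') \<Longrightarrow> k = k'"
    and R0_less: "sel q \<Longrightarrow> R0 q < lb I"
    and star0: "v \<in> reach I r \<Longrightarrow> bk0 v = Suc b \<Longrightarrow> sel (b div card (points I)) \<and>
      (hm v = b div card (points I) \<or> core v \<and> ro (hm v) \<noteq> hm v \<and> pa (hm v) = b div card (points I))"
    and card0: "nonvoid bk0 b \<Longrightarrow> card {v \<in> reach I r. bk0 v = Suc b} = lb I"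
    and rest0: "v \<in> reach I r \<Longrightarrow>
      bk0 v = 0 \<longleftrightarrow> (\<exists>q k. sel q \<and> ro q = q \<and> k < R0 q \<and> v = ca (q * card (points I) + k))"
    and bk0_outside: "v < card (points I) \<Longrightarrow> v \<notin> reach I r \<Longrightarrow> bk0 v = 0"
    and ex_void: "b < card (points I) * card (points I) \<Longrightarrow> \<not> nonvoid bk0 b \<Longrightarrow> ex b = 0"
    and rk: "sel p \<Longrightarrow> rk p < card (points I)"
    and rk_pa: "sel p \<Longrightarrow> ro p \<noteq> p \<Longrightarrow> rk (pa p) < rk p"
begin

lemma ca_inj2:
  assumes "sel p" "sel p'" "k < lb I" "k' < lb I" "ca (p * n + k) = ca (p' * n + k')"
  shows "p = p' \<and> k = k'"
proof -
  have "p = p'" using ca_core[OF assms(1,3)] ca_core[OF assms(2,4)] assms(5) by simp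
  then show ?thesis using ca_inj assms by blast
qed

abbreviation "cnt bk b \<equiv> card {v \<in> reach I r. bk v = Suc b}"

text \<open>The last alternative, a core client in the star of a child of its home, is created only
  by walks: the core client of the parent takes over the place which that of the child had in the
  child's star.\<close>

definition near_star :: "nat \<Rightarrow> nat \<Rightarrow> bool" where
  "near_star v p \<longleftrightarrow> hm v = p \<or>
     core v \<and> (ro (hm v) \<noteq> hm v \<and> pa (hm v) = p \<or> ro p \<noteq> p \<and> pa p = hm v)"

lemma nonvoid_less:
  assumes "nonvoid bk0 b"
  shows "b < n * n" "sel (b div n)"
proof -
  obtain v where "v \<in> reach I r" "bk0 v = Suc b" using assms by (auto simp: nonvoid_def)
  then show s: "sel (b div n)" using star0 by blast
  then have "b div n < n" by (rule sel_less)
  then show "b < n * n" by (metis div_less_iff_less_mult gr0I mult_0_right not_less_zero)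
qed

text \<open>\<open>rem q\<close> clients of the tree with root \<open>q\<close> are not served; the core clients with an index below
  \<open>rem q\<close> have not been moved by a walk.\<close>

definition filling :: "(nat \<Rightarrow> nat) \<Rightarrow> (nat \<Rightarrow> nat) \<Rightarrow> bool" where
  "filling bk rem \<longleftrightarrow>
     (\<forall>v\<in>reach I r. \<forall>b. bk v = Suc b \<longrightarrow> nonvoid bk0 b \<and> near_star v (b div n)) \<and>
     (\<forall>p h. sel p \<longrightarrow> h < rem (ro p) \<longrightarrow> bk (ca (p * n + h)) = bk0 (ca (p * n + h))) \<and>
     (\<forall>v\<in>reach I r. bk v = 0 \<longleftrightarrow> (\<exists>q k. sel q \<and> ro q = q \<and> k < rem q \<and> v = ca (q * n + k))) \<and>
     (\<forall>q. sel q \<longrightarrow> ro q = q \<longrightarrow> rem q \<le> R0 q) \<and>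
     (\<forall>b. nonvoid bk0 b \<longrightarrow> lb I \<le> cnt bk b \<and> cnt bk b \<le> lb I + ex b) \<and>
     (\<forall>v<n. v \<notin> reach I r \<longrightarrow> bk v = 0)"

lemma fillingD:
  assumes "filling bk rem"
  shows "v \<in> reach I r \<Longrightarrow> bk v = Suc b \<Longrightarrow> nonvoid bk0 b \<and> near_star v (b div n)"
    and "sel p \<Longrightarrow> h < rem (ro p) \<Longrightarrow> bk (ca (p * n + h)) = bk0 (ca (p * n + h))"
    and "v \<in> reach I r \<Longrightarrow> bk v = 0 \<longleftrightarrow> (\<exists>q k. sel q \<and> ro q = q \<and> k < rem q \<and> v = ca (q * n + k))"
    and "sel q \<Longrightarrow> ro q = q \<Longrightarrow> rem q \<le> R0 q"
    and "nonvoid bk0 b \<Longrightarrow> lb I \<le> cnt bk b \<and> cnt bk b \<le> lb I + ex b"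
    and "v < n \<Longrightarrow> v \<notin> reach I r \<Longrightarrow> bk v = 0"
  using assms unfolding filling_def by simp_all

lemma filling_init: "filling bk0 R0"
  unfolding filling_def near_star_def nonvoid_def using star0 rest0 card0 bk0_outside
  by (auto simp: nonvoid_def)

text \<open>State of a walk that inserts a client into block \<open>b\<close>: \<open>c\<close> is the block that has given up a
  client, and \<open>y\<close> the node whose core client replaces it.\<close>

definition walking :: "(nat \<Rightarrow> nat) \<Rightarrow> nat \<Rightarrow> nat \<Rightarrow> nat \<Rightarrow> nat \<Rightarrow> (nat \<Rightarrow> nat) \<Rightarrow> nat \<Rightarrow> nat \<Rightarrow> nat \<Rightarrow> bool" where
  "walking bk q h b t bk' c y z \<longleftrightarrow>
     (z \<noteq> 0 \<longrightarrow> sel y \<and> ro y = q \<and> rk y + t < n \<and>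
        (\<exists>b'. c = Suc b' \<and> nonvoid bk0 b' \<and>
          (b' div n = y \<or> ro (b' div n) \<noteq> b' div n \<and> pa (b' div n) = y))) \<and>
     (\<forall>b'. cnt bk' b' + (if z \<noteq> 0 \<and> c = Suc b' then 1 else 0) = cnt bk b' + (if b' = b then 1 else 0)) \<and>
     (\<forall>v\<in>reach I r. \<forall>b. bk' v = Suc b \<longrightarrow> nonvoid bk0 b \<and> near_star v (b div n)) \<and>
     (\<forall>v. bk' v \<noteq> bk v \<longrightarrow> (\<exists>p. sel p \<and> ro p = q \<and> v = ca (p * n + h) \<and> (z \<noteq> 0 \<longrightarrow> rk y < rk p))) \<and>
     (\<forall>v\<in>reach I r. bk' v = 0 \<longleftrightarrow> bk v = 0 \<and> (z \<noteq> 0 \<or> v \<noteq> ca (q * n + h)))"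

lemma walkingD:
  assumes "walking bk q h b t bk' c y z"
  shows "z \<noteq> 0 \<Longrightarrow> sel y \<and> ro y = q \<and> rk y + t < n \<and>
        (\<exists>b'. c = Suc b' \<and> nonvoid bk0 b' \<and>
          (b' div n = y \<or> ro (b' div n) \<noteq> b' div n \<and> pa (b' div n) = y))"
    and "cnt bk' b' + (if z \<noteq> 0 \<and> c = Suc b' then 1 else 0) = cnt bk b' + (if b' = b then 1 else 0)"
    and "v \<in> reach I r \<Longrightarrow> bk' v = Suc b'' \<Longrightarrow> nonvoid bk0 b'' \<and> near_star v (b'' div n)"
    and "bk' v \<noteq> bk v \<Longrightarrow> \<exists>p. sel p \<and> ro p = q \<and> v = ca (p * n + h) \<and> (z \<noteq> 0 \<longrightarrow> rk y < rk p)"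
    and "v \<in> reach I r \<Longrightarrow> bk' v = 0 \<longleftrightarrow> bk v = 0 \<and> (z \<noteq> 0 \<or> v \<noteq> ca (q * n + h))"
  using assms unfolding walking_def by ((elim conjE, simp)+)

text \<open>The form of a balance avoids truncated subtraction and adds up over the steps of a
  walk.\<close>

lemma cnt_update:
  assumes "v \<in> reach I r"
  shows "cnt (bk(v := c)) b + (if bk v = Suc b then 1 else 0) = cnt bk b + (if c = Suc b then 1 else 0)"
proof -
  let ?S = "{w \<in> reach I r. w \<noteq> v \<and> bk w = Suc b}"
  have fS: "finite ?S" using fin by simp
  have "{w \<in> reach I r. (bk(v := c)) w = Suc b} = (if c = Suc b then insert v ?S else ?S)"
    using assms by auto
  moreover have "{w \<in> reach I r. bk w = Suc b} = (if bk v = Suc b then insert v ?S else ?S)"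
    using assms by auto
  ultimately show ?thesis using fS by auto
qed

context
  fixes bk rem :: "nat \<Rightarrow> nat" and q h b :: nat
  assumes fill: "filling bk rem" and q: "sel q" "ro q = q" and h: "h < rem q"
begin

lemma h_less: "h < lb I"
  using h fillingD(4)[OF fill q] R0_less[OF q(1)] by simp

text \<open>The client \<open>v\<close> has kept its original block: its node was not visited by
  this walk, as visited nodes have larger rank, and not with index \<open>h\<close> by an earlier
  one, as \<open>h < rem q\<close>. So \<open>bk' v\<close> is a block at \<open>y\<close> or at its
  parent, the only stars from which the walk can go on. At the root \<open>v\<close> is one of the
  clients that are not served, and nothing has to be replaced any more.\<close>

lemma walking_step:
  assumes w: "walking bk q h b t bk' c y z" and z: "z \<noteq> 0"
  defines "v \<equiv> ca (y * n + h)"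
  shows "if ro y = y then walking bk q h b (Suc t) (bk'(v := c)) (bk' v) y 0
    else walking bk q h b (Suc t) (bk'(v := c)) (bk' v) (pa y) z"
proof -
  note wd = walkingD[OF w]
  obtain b1 where y: "sel y" "ro y = q" "rk y + t < n" and c: "c = Suc b1" "nonvoid bk0 b1"
    "b1 div n = y \<or> ro (b1 div n) \<noteq> b1 div n \<and> pa (b1 div n) = y"
    using wd(1)[OF z] by blast
  have v: "v \<in> reach I r" "core v" "hm v = y" using ca_core[OF y(1) h_less] by (auto simp: v_def)
  have same: "bk' v = bk v"
  proof (rule ccontr)
    assume "bk' v \<noteq> bk v"
    from wd(4)[OF this] z obtain p where p: "sel p" "v = ca (p * n + h)" "rk y < rk p" by blast
    then have "p = y" using ca_inj2[OF p(1) y(1) h_less h_less] by (simp add: v_def)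
    then show False using p by simp
  qed
  have bk0v: "bk v = bk0 v" using fillingD(2)[OF fill y(1)] y(2) h by (simp add: v_def)
  have near: "near_star v (b1 div n)" using c(3) v by (auto simp: near_star_def)
  have cnt: "cnt (bk'(v := c)) b' + (if bk' v = Suc b' then 1 else 0) = cnt bk b' + (if b' = b then 1 else 0)" for b'
    using cnt_update[OF v(1), of bk' c b'] wd(2)[of b'] z by auto
  have near': "nonvoid bk0 b'' \<and> near_star w (b'' div n)" if "w \<in> reach I r" "(bk'(v := c)) w = Suc b''" for w b''
    using that wd(3)[of w b''] near c by (auto split: if_splits)
  show ?thesis
  proof (cases "ro y = y")
    case True
    then have yq: "y = q" using y by simp
    have "bk v = 0" using fillingD(3)[OF fill v(1)] q h yq v_def by blast
    have "walking bk q h b (Suc t) (bk'(v := c)) (bk' v) y 0"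
      unfolding walking_def
    proof (intro conjI allI ballI impI)
      fix b'
      show "cnt (bk'(v := c)) b' + (if 0 \<noteq> (0::nat) \<and> bk' v = Suc b' then 1 else 0) = cnt bk b' + (if b' = b then 1 else 0)"
        using cnt[of b'] same \<open>bk v = 0\<close> by simp
    next
      fix w b'' assume "w \<in> reach I r" "(bk'(v := c)) w = Suc b''"
      then show "nonvoid bk0 b''" "near_star w (b'' div n)" using near' by blast+
    next
      fix w assume "(bk'(v := c)) w \<noteq> bk w"
      then show "\<exists>p. sel p \<and> ro p = q \<and> w = ca (p * n + h) \<and> (0 \<noteq> (0::nat) \<longrightarrow> rk y < rk p)"
        using wd(4)[of w] y v_def by (cases "w = v") auto
    next
      fix w assume "w \<in> reach I r"
      then show "(bk'(v := c)) w = 0 \<longleftrightarrow> bk w = 0 \<and> (0 \<noteq> (0::nat) \<or> w \<noteq> ca (q * n + h))"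
        using wd(5)[of w] z c v_def yq by (cases "w = v") auto
    qed simp_all
    then show ?thesis using True by simp
  next
    case False
    have "bk0 v \<noteq> 0"
    proof
      assume "bk0 v = 0"
      then obtain p k where p: "sel p" "ro p = p" "k < R0 p" "v = ca (p * n + k)" using rest0[OF v(1)] by blast
      then have "p = y" using ca_inj2[OF p(1) y(1) _ h_less, of k] R0_less[OF p(1)] by (simp add: v_def)
      then show False using p False by simp
    qed
    then obtain b2 where b2: "bk0 v = Suc b2" by (cases "bk0 v") auto
    have nv2: "nonvoid bk0 b2" using v b2 by (auto simp: nonvoid_def)
    have star2: "b2 div n = y \<or> b2 div n = pa y" using star0[OF v(1) b2] v by auto
    have selpa: "sel (pa y)" "ro (pa y) = q" using sel_pa[OF y(1) False] y by auto
    have "walking bk q h b (Suc t) (bk'(v := c)) (bk' v) (pa y) z"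
      unfolding walking_def
    proof (intro conjI allI ballI impI)
      show "sel (pa y)" "ro (pa y) = q" using selpa by auto
      show "rk (pa y) + Suc t < n" using rk_pa[OF y(1) False] y(3) by simp
      show "\<exists>b'. bk' v = Suc b' \<and> nonvoid bk0 b' \<and>
          (b' div n = pa y \<or> ro (b' div n) \<noteq> b' div n \<and> pa (b' div n) = pa y)"
        using same bk0v b2 nv2 star2 False by auto
    next
      fix b'
      show "cnt (bk'(v := c)) b' + (if z \<noteq> 0 \<and> bk' v = Suc b' then 1 else 0) = cnt bk b' + (if b' = b then 1 else 0)"
        using cnt[of b'] z by simp
    next
      fix w b'' assume "w \<in> reach I r" "(bk'(v := c)) w = Suc b''"
      then show "nonvoid bk0 b''" "near_star w (b'' div n)" using near' by blast+
    next
      fix w assume a: "(bk'(v := c)) w \<noteq> bk w"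
      show "\<exists>p. sel p \<and> ro p = q \<and> w = ca (p * n + h) \<and> (z \<noteq> 0 \<longrightarrow> rk (pa y) < rk p)"
      proof (cases "w = v")
        case True
        then show ?thesis using y v_def rk_pa[OF y(1) False] by blast
      next
        case nv: False
        then obtain p where "sel p" "ro p = q" "w = ca (p * n + h)" "rk y < rk p" using wd(4)[of w] a z by auto
        then show ?thesis using rk_pa[OF y(1) False] by (intro exI[of _ p]) auto
      qed
    next
      fix w assume "w \<in> reach I r"
      then show "(bk'(v := c)) w = 0 \<longleftrightarrow> bk w = 0 \<and> (z \<noteq> 0 \<or> w \<noteq> ca (q * n + h))"
        using wd(5)[of w] z c same bk0v b2 by (cases "w = v") auto
    qed
    then show ?thesis using False by simp
  qed
qed

lemma walking_start:
  assumes "nonvoid bk0 b" "ro (b div n) = q"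
  shows "walking bk q h b 0 bk (Suc b) (b div n) 1"
  unfolding walking_def using assms nonvoid_less(2)[OF assms(1)] rk fillingD(1)[OF fill] by auto

lemma walking_stop: "walking bk q h b t bk' c y 0 \<Longrightarrow> walking bk q h b (Suc t) bk' c y 0"
  unfolding walking_def by simp

lemma walking_end:
  assumes w: "walking bk q h b n bk' c y z" and h1: "Suc h = rem q" and room: "cnt bk b < lb I + ex b"
    and nv: "nonvoid bk0 b"
  shows "filling bk' (rem(q := h))" and "cnt bk' b' = cnt bk b' + (if b' = b then 1 else 0)"
proof -
  \<comment> \<open>A walk that is still active after \<open>n\<close> steps would satisfy
    \<open>rk y + n < n\<close>.\<close>
  have z: "z = 0" using walkingD(1)[OF w] by (cases "z = 0") auto
  note wd = walkingD[OF w, unfolded z]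
  show cnt: "cnt bk' b' = cnt bk b' + (if b' = b then 1 else 0)" for b'
    using wd(2)[of b'] by simp
  show "filling bk' (rem(q := h))"
    unfolding filling_def
  proof (intro conjI allI ballI impI)
    fix v b'' assume "v \<in> reach I r" "bk' v = Suc b''"
    then show "nonvoid bk0 b''" "near_star v (b'' div n)" using wd(3) by blast+
  next
    fix p h' assume p: "sel p" and h': "h' < (rem(q := h)) (ro p)"
    then have less: "h' < rem (ro p)" using h1 by (auto split: if_splits)
    have "rem (ro p) < lb I"
      using fillingD(4)[OF fill, of "ro p"] sel_ro[OF p] R0_less[of "ro p"] by auto
    then have h'l: "h' < lb I" using less by simp
    \<comment> \<open>Clients moved by the walk have index \<open>h\<close> and root
      \<open>q\<close>, whereas in the tree of \<open>q\<close> the indices below the new bound are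
      smaller than \<open>h\<close>.\<close>
    have "bk' (ca (p * n + h')) = bk (ca (p * n + h'))"
    proof (rule ccontr)
      assume "bk' (ca (p * n + h')) \<noteq> bk (ca (p * n + h'))"
      from wd(4)[OF this] obtain p' where p': "sel p'" "ro p' = q" "ca (p * n + h') = ca (p' * n + h)" by blast
      then have "p = p' \<and> h' = h" using ca_inj2[OF p p'(1) h'l h_less] by blast
      then show False using h' p' by simp
    qed
    then show "bk' (ca (p * n + h')) = bk0 (ca (p * n + h'))" using fillingD(2)[OF fill p less] by simp
  next
    fix v assume v: "v \<in> reach I r"
    have "(\<exists>q' k. sel q' \<and> ro q' = q' \<and> k < (rem(q := h)) q' \<and> v = ca (q' * n + k)) \<longleftrightarrow>
        (\<exists>q' k. sel q' \<and> ro q' = q' \<and> k < rem q' \<and> v = ca (q' * n + k)) \<and> v \<noteq> ca (q * n + h)"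
    proof
      assume "\<exists>q' k. sel q' \<and> ro q' = q' \<and> k < (rem(q := h)) q' \<and> v = ca (q' * n + k)"
      then obtain q' k where k: "sel q'" "ro q' = q'" "k < (rem(q := h)) q'" "v = ca (q' * n + k)" by blast
      then have less: "k < rem q'" using h1 by (auto split: if_splits)
      then have "k < lb I" using fillingD(4)[OF fill k(1,2)] R0_less[OF k(1)] by simp
      have "v \<noteq> ca (q * n + h)"
      proof
        assume "v = ca (q * n + h)"
        then have "q' = q \<and> k = h"
          using ca_inj2[OF k(1) q(1) \<open>k < lb I\<close> h_less] k(4) by simp
        then show False using k(3) by simp
      qed
      then show "(\<exists>q' k. sel q' \<and> ro q' = q' \<and> k < rem q' \<and> v = ca (q' * n + k)) \<and> v \<noteq> ca (q * n + h)"
        using k less by blast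
    next
      assume "(\<exists>q' k. sel q' \<and> ro q' = q' \<and> k < rem q' \<and> v = ca (q' * n + k)) \<and> v \<noteq> ca (q * n + h)"
      then obtain q' k where k: "sel q'" "ro q' = q'" "k < rem q'" "v = ca (q' * n + k)" "v \<noteq> ca (q * n + h)" by blast
      then have "k < (rem(q := h)) q'" using h1 by (cases "q' = q"; cases "k = h") auto
      then show "\<exists>q' k. sel q' \<and> ro q' = q' \<and> k < (rem(q := h)) q' \<and> v = ca (q' * n + k)" using k by blast
    qed
    then show "bk' v = 0 \<longleftrightarrow> (\<exists>q' k. sel q' \<and> ro q' = q' \<and> k < (rem(q := h)) q' \<and> v = ca (q' * n + k))"
      using wd(5)[OF v] fillingD(3)[OF fill v] by simp
  next
    fix q' assume "sel q'" "ro q' = q'"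
    then show "(rem(q := h)) q' \<le> R0 q'" using fillingD(4)[OF fill, of q'] h by (auto split: if_splits)
  next
    fix b' assume "nonvoid bk0 b'"
    then show "lb I \<le> cnt bk' b'" "cnt bk' b' \<le> lb I + ex b'"
      using fillingD(5)[OF fill, of b'] cnt[of b'] room by auto
  next
    fix v assume v: "v < n" "v \<notin> reach I r"
    have "bk' v = bk v"
    proof (rule ccontr)
      assume "bk' v \<noteq> bk v"
      from wd(4)[OF this] obtain p where "sel p" "v = ca (p * n + h)" by blast
      then show False using ca_core[of p h] h_less v by auto
    qed
    then show "bk' v = 0" using fillingD(6)[OF fill v] by simp
  qed
qed

end

text \<open>A block stops growing when it is full or when its tree has no unserved client left; the
  second reason persists because \<open>rem\<close> never increases. Blocks after \<open>B\<close>
  keep their original size, since a walk changes the size of its target block only.\<close>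

definition progress :: "nat \<Rightarrow> nat \<Rightarrow> (nat \<Rightarrow> nat) \<Rightarrow> (nat \<Rightarrow> nat) \<Rightarrow> bool" where
  "progress B k bk rem \<longleftrightarrow> filling bk rem \<and>
     (\<forall>b. nonvoid bk0 b \<longrightarrow> (b < B \<longrightarrow> cnt bk b = lb I + ex b \<or> rem (ro (b div n)) = 0) \<and>
       (b = B \<longrightarrow> cnt bk b = lb I + min k (ex b) \<or> rem (ro (b div n)) = 0) \<and>
       (B < b \<longrightarrow> cnt bk b = lb I))"

definition frozen :: "mem \<Rightarrow> bool" where
  "frozen s \<longleftrightarrow> static s \<and> fst s ''ca'' = ca \<and> fst s ''ex'' = ex"

lemma frozen_sem:
  assumes "frozen s"
    and "nwrites p \<inter> {''n'', ''l'', ''client'', ''facility'', ''U'', ''good'', ''m'', ''pa'', ''ro'', ''hm'', ''core''} = {}"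
    and "rwrites p \<inter> {''r'', ''d''} = {}" "''ca'' \<notin> nwrites p" "''ex'' \<notin> nwrites p"
  shows "frozen (sem p s)"
  using assms static_sem[of s p] by (simp add: frozen_def sem_frame_fst)

lemma sem_walk:
  assumes s: "frozen s" and fill: "filling bk rem" and q: "sel q" "ro q = q" and h: "h < rem q"
    and b: "nonvoid bk0 b" "ro (b div n) = q"
    and vals: "fst s ''bk'' = bk" "fst s ''h'' 0 = h" "fst s ''c'' 0 = Suc b" "fst s ''y'' 0 = b div n" "fst s ''z'' 0 = 1"
  shows "\<exists>c y z. walking bk q h b n (fst (sem walk s) ''bk'') c y z"
proof -
  let ?P = "\<lambda>t u. walking bk q h b t (fst u ''bk'') (fst u ''c'' 0) (fst u ''y'' 0) (fst u ''z'' 0)"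
  have n: "fst s ''n'' 0 = n" using s staticD(8) by (simp add: frozen_def)
  have "?P (fst s ''n'' 0) (sem walk s)"
    unfolding walk_def
  proof (rule sem_For_invariant[where P = ?P], goal_cases)
    case 2
    then show ?case using walking_start[OF fill q h b] vals by (simp add: fst_nwrite)
  next
    case (3 t u)
    have u: "fst u ''n'' 0 = n" "fst u ''ca'' = ca" "fst u ''ro'' = ro" "fst u ''pa'' = pa" "fst u ''h'' 0 = h"
      using s staticD(3,4) n vals by (auto simp: 3 frozen_def)
    show ?case
    proof (cases "fst u ''z'' 0 = 0")
      case True
      then show ?thesis using walking_stop[OF fill q h] 3(5) by (simp add: walk_step_def fst_nwrite)
    next
      case False
      from walking_step[OF fill q h 3(5) False] show ?thesis
        using False u by (auto simp: walk_step_def fst_nwrite split: if_splits)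
    qed
  qed (simp add: program_defs)
  then show ?thesis unfolding n by blast
qed

lemma sem_insert_one:
  assumes s: "frozen s" and k: "fst s ''k'' 0 = k" and b: "fst s ''b'' 0 = B" "B < n * n" "fst s ''s'' 0 = B div n"
    and p: "progress B k (fst s ''bk'') (fst s ''rm'')"
  defines "t \<equiv> sem insert_one s"
  shows "progress B (Suc k) (fst t ''bk'') (fst t ''rm'')"
proof -
  define q where "q = ro (B div n)"
  have st: "static s" using s by (simp add: frozen_def)
  note d = staticD[OF st]
  define s1 where "s1 = sem (assign ''q'' (NRead ''ro'' (V ''s''))) s"
  define s2 where "s2 = sem (assign ''h'' (pred (NRead ''rm'' (V ''q''))) ;; PN ''rm'' (V ''q'') (V ''h'') ;;
        assign ''c'' (succ (V ''b'')) ;; assign ''y'' (V ''s'') ;; assign ''z'' (NConst 1)) s1"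
  define s3 where "s3 = sem walk s2"
  have run: "t = (if bval (Conj (NLess (V ''k'') (NRead ''ex'' (V ''b''))) (nz (NRead ''rm'' (V ''q'')))) s1 then s3 else s1)"
    by (simp only: t_def insert_one_def sem.simps s1_def s2_def s3_def)
  let ?bk = "fst s ''bk''" and ?rm = "fst s ''rm''"
  have e1: "fst s1 ''q'' 0 = q" "z \<noteq> ''q'' \<Longrightarrow> fst s1 z = fst s z" for z
    using b d(4) by (simp_all add: s1_def fst_nwrite q_def)
  have cond: "bval (Conj (NLess (V ''k'') (NRead ''ex'' (V ''b''))) (nz (NRead ''rm'' (V ''q'')))) s1 \<longleftrightarrow>
      k < ex B \<and> 0 < ?rm q"
    using e1 k b s by (simp add: frozen_def)
  have fill: "filling ?bk ?rm" by (rule conjunct1[OF p[unfolded progress_def]])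
  have pr: "(b < B \<longrightarrow> cnt ?bk b = lb I + ex b \<or> ?rm (ro (b div n)) = 0) \<and>
       (b = B \<longrightarrow> cnt ?bk b = lb I + min k (ex b) \<or> ?rm (ro (b div n)) = 0) \<and>
       (B < b \<longrightarrow> cnt ?bk b = lb I)"
    if "nonvoid bk0 b" for b
    using that by (rule mp[OF spec[OF conjunct2[OF p[unfolded progress_def]]]])
  show ?thesis
  proof (cases "k < ex B \<and> 0 < ?rm q")
    case False
    have t: "fst t ''bk'' = ?bk" "fst t ''rm'' = ?rm" using False e1 unfolding run cond by auto
    show ?thesis
      unfolding progress_def t
    proof (intro conjI allI impI fill)
      fix b assume nv: "nonvoid bk0 b"
      show "b < B \<Longrightarrow> cnt ?bk b = lb I + ex b \<or> ?rm (ro (b div n)) = 0" "B < b \<Longrightarrow> cnt ?bk b = lb I"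
        using pr[OF nv] by auto
      show "b = B \<Longrightarrow> cnt ?bk b = lb I + min (Suc k) (ex b) \<or> ?rm (ro (b div n)) = 0"
        using pr[OF nv] False by (auto simp: q_def min_def)
    qed
  next
    case True
    \<comment> \<open>A void block has no room by \<open>ex_void\<close>, so a block with room has
      members and a tree.\<close>
    have nv: "nonvoid bk0 B" using ex_void[OF b(2)] True by (metis not_less_zero)
    have selq: "sel q" "ro q = q" using sel_ro[OF nonvoid_less(2)[OF nv]] by (auto simp: q_def)
    define h where "h = ?rm q - 1"
    have h: "h < ?rm q" "Suc h = ?rm q" using True by (auto simp: h_def)
    have e2: "fst s2 ''bk'' = ?bk" "fst s2 ''h'' 0 = h" "fst s2 ''c'' 0 = Suc B" "fst s2 ''y'' 0 = B div n"
      "fst s2 ''z'' 0 = 1" "fst s2 ''rm'' = ?rm(q := h)"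
      using e1 b by (simp_all add: s2_def fst_nwrite h_def)
    have "frozen s2" unfolding s2_def s1_def by (intro frozen_sem s) simp_all
    from sem_walk[OF this fill selq h(1) nv q_def[symmetric] e2(1-5)]
    obtain c y z where w: "walking ?bk q h B n (fst s3 ''bk'') c y z" unfolding s3_def by blast
    have cB: "cnt ?bk B = lb I + k" using pr[OF nv] True by (auto simp: q_def min_def)
    note we = walking_end[OF fill selq h(1) w h(2) _ nv]
    have t: "t = s3" using True unfolding run cond by simp
    have rm3: "fst s3 ''rm'' = ?rm(q := h)" using e2 by (simp add: s3_def sem_frame_fst)
    have room: "cnt ?bk B < lb I + ex B" using cB True by simp
    show ?thesis
      unfolding progress_def t rm3
    proof (intro conjI allI impI)
      show "filling (fst s3 ''bk'') (?rm(q := h))" using we(1)[OF room] .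
      fix b assume nvb: "nonvoid bk0 b"
      note cb = we(2)[OF room, of b]
      show "b < B \<Longrightarrow> cnt (fst s3 ''bk'') b = lb I + ex b \<or> (?rm(q := h)) (ro (b div n)) = 0"
        using pr[OF nvb] cb h by auto
      show "b = B \<Longrightarrow> cnt (fst s3 ''bk'') b = lb I + min (Suc k) (ex b) \<or> (?rm(q := h)) (ro (b div n)) = 0"
        using cb cB True by (auto simp: min_def)
      show "B < b \<Longrightarrow> cnt (fst s3 ''bk'') b = lb I"
        using pr[OF nvb] cb by auto
    qed
  qed
qed

text \<open>\<open>n\<close> attempts per block suffice even if \<open>ex B\<close> exceeds
  \<open>n\<close>: if all of them succeeded, the block would have \<open>lb I + n\<close> members,
  more than there are points.\<close>

lemma progress_next:
  assumes p: "progress B n bk rem"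
  shows "progress (Suc B) 0 bk rem"
proof -
  have fill: "filling bk rem" by (rule conjunct1[OF p[unfolded progress_def]])
  have pr: "(b < B \<longrightarrow> cnt bk b = lb I + ex b \<or> rem (ro (b div n)) = 0) \<and>
       (b = B \<longrightarrow> cnt bk b = lb I + min n (ex b) \<or> rem (ro (b div n)) = 0) \<and>
       (B < b \<longrightarrow> cnt bk b = lb I)"
    if "nonvoid bk0 b" for b
    using that by (rule mp[OF spec[OF conjunct2[OF p[unfolded progress_def]]]])
  have le: "cnt bk b \<le> n" for b
    using card_mono[of "{..<n}" "{v \<in> reach I r. bk v = Suc b}"] reach_less by auto
  show ?thesis
    unfolding progress_def
  proof (intro conjI allI impI fill)
    fix b assume nv: "nonvoid bk0 b"
    show "cnt bk b = lb I + ex b \<or> rem (ro (b div n)) = 0" if "b < Suc B"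
      using pr[OF nv] that le[of b] lb_pos by (cases "b = B") (auto simp: min_def split: if_splits)
    show "b = Suc B \<Longrightarrow> cnt bk b = lb I + min 0 (ex b) \<or> rem (ro (b div n)) = 0"
      "Suc B < b \<Longrightarrow> cnt bk b = lb I"
      using pr[OF nv] by auto
  qed
qed

lemma sem_insert_surplus:
  assumes s: "frozen s" and init: "fst s ''bk'' = bk0" "fst s ''rm'' = R0"
  defines "t \<equiv> sem insert_surplus s"
  shows "progress (n * n) 0 (fst t ''bk'') (fst t ''rm'')"
proof -
  have nn: "frozen u \<Longrightarrow> fst u ''n'' 0 = n" for u using staticD(8) by (simp add: frozen_def)
  have fr: "frozen u" if "frozen u0" "\<And>x. x \<notin> nwrites insert_surplus \<Longrightarrow> fst u x = fst u0 x" "snd u = snd u0" for u u0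
  proof -
    have "static u"
    proof (rule static_frame[of u0])
      show "static u0" using that(1) by (simp add: frozen_def)
      fix x
      show "fst u x = fst u0 x"
        if "x \<in> {''n'', ''l'', ''client'', ''facility'', ''U'', ''good'', ''m'', ''pa'', ''ro'', ''hm'', ''core''}"
        by (rule \<open>\<And>x. x \<notin> nwrites insert_surplus \<Longrightarrow> fst u x = fst u0 x\<close>) (use that in auto)
      show "snd u x = snd u0 x" using \<open>snd u = snd u0\<close> by simp
    qed
    then show ?thesis using that(1) that(2)[of "''ca''"] that(2)[of "''ex''"] by (simp add: frozen_def)
  qed
  have "progress (fst s ''n'' 0 * n) 0 (fst t ''bk'') (fst t ''rm'')"
    unfolding t_def insert_surplus_def
  proof (rule sem_For_invariant[where P = "\<lambda>j u. progress (j * n) 0 (fst u ''bk'') (fst u ''rm'')"], goal_cases)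
    case 2
    have "progress 0 0 bk0 R0" unfolding progress_def using filling_init card0 by auto
    then show ?case using init by (simp add: fst_nwrite)
  next
    case (3 j u)
    have u: "frozen u"
    proof (rule fr[OF s])
      show "fst u y = fst s y" if "y \<notin> nwrites insert_surplus" for y
        by (rule 3(3)) (use that in simp)
      show "snd u = snd s" by (rule ext, rule 3(4)) simp
    qed
    have j: "j < n" using 3(1) nn[OF s] by simp
    let ?body = "assign ''b'' (pair (V ''s'') (V ''i'')) ;; PFor ''k'' insert_one"
    have "progress (j * n + fst u ''n'' 0) 0 (fst (sem (PFor ''i'' ?body) u) ''bk'') (fst (sem (PFor ''i'' ?body) u) ''rm'')"
    proof (rule sem_For_invariant[where P = "\<lambda>i w. progress (j * n + i) 0 (fst w ''bk'') (fst w ''rm'')"], goal_cases)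
      case 2
      then show ?case using 3(5) by (simp add: fst_nwrite)
    next
      case h: (3 i w)
      have w: "frozen w"
    proof (rule fr[OF u])
      show "fst w y = fst u y" if "y \<notin> nwrites insert_surplus" for y
        by (rule h(3)) (use that in simp)
      show "snd w = snd u" by (rule ext, rule h(4)) simp
    qed
      have i: "i < n" using h(1) nn[OF u] by simp
      define B where "B = j * n + i"
      have B: "B < n * n" "B div n = j"
      proof -
        show "B div n = j" using i by (simp add: B_def)
        have "B < Suc j * n" using i by (simp add: B_def)
        also have "\<dots> \<le> n * n" using j by (intro mult_right_mono) auto
        finally show "B < n * n" .
      qed
      define w1 where "w1 = sem (assign ''b'' (pair (V ''s'') (V ''i''))) w"
      have w1: "frozen w1" unfolding w1_def by (intro frozen_sem w) simp_all
      have v1: "fst w1 ''b'' 0 = B" "fst w1 ''s'' 0 = j" "fst w1 ''bk'' = fst w ''bk''" "fst w1 ''rm'' = fst w ''rm''"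
        using h(2) h(3)[of "''s''"] 3(2) nn[OF w] by (simp_all add: w1_def fst_nwrite B_def)
      have "progress B (fst w1 ''n'' 0) (fst (sem (PFor ''k'' insert_one) w1) ''bk'') (fst (sem (PFor ''k'' insert_one) w1) ''rm'')"
      proof (rule sem_For_invariant[where P = "\<lambda>k x. progress B k (fst x ''bk'') (fst x ''rm'')"], goal_cases)
        case 2
        then show ?case using h(5) v1 by (simp add: fst_nwrite B_def)
      next
        case g: (3 k x)
        have x: "frozen x"
    proof (rule fr[OF w1])
      show "fst x y = fst w1 y" if "y \<notin> nwrites insert_surplus" for y
        by (rule g(3)) (use that in simp)
      show "snd x = snd w1" by (rule ext, rule g(4)) simp
    qed
        have "fst x ''b'' 0 = B" "fst x ''s'' 0 = B div n" using g(3) v1 B by auto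
        from sem_insert_one[OF x g(2) this(1) B(1) this(2) g(5)] show ?case by (simp add: fst_nwrite)
      qed (simp add: program_defs)
      then have "progress (Suc B) 0 (fst (sem (PFor ''k'' insert_one) w1) ''bk'') (fst (sem (PFor ''k'' insert_one) w1) ''rm'')"
        unfolding nn[OF w1] by (rule progress_next)
      then show ?case unfolding sem.simps(4) w1_def[symmetric] by (simp only: fst_nwrite B_def) simp
    qed (simp add: program_defs)
    then show ?case unfolding nn[OF u] by (simp only: fst_nwrite) (simp add: add.commute)
  qed (simp add: program_defs)
  then show ?thesis unfolding nn[OF s] .
qed

end

section \<open>Correctness of the program\<close>

context input
begin

text \<open>The second clause speaks of any record that agrees with the work arrays, because the
  output arrays are filled only by \<open>commit\<close>, and only if the radius turns out to be an
  improvement.\<close>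

definition solved :: "mem \<Rightarrow> bool" where
  "solved s \<longleftrightarrow>
     (\<forall>S. feasible I S \<longrightarrow> (\<forall>v\<in>served S. D v (fst (assigned S v)) \<le> r) \<longrightarrow>
        card (served S) \<le> card {v. v < n \<and> fst s ''bk'' v \<noteq> 0}) \<and>
     (quota I \<le> card {v. v < n \<and> fst s ''bk'' v \<noteq> 0} \<longrightarrow>
       (\<forall>S. served S = {v. v < n \<and> fst s ''bk'' v \<noteq> 0} \<longrightarrow>
          (\<forall>u. count (opened S) u = (if u < n then fst s ''cp'' u else 0)) \<longrightarrow>
          (\<forall>v\<in>served S. assigned S v = (fst s ''fa'' (fst s ''bk'' v - 1), fst s ''ci'' (fst s ''bk'' v - 1))) \<longrightarrow>
          feasible I S \<and> solution_value I S \<le> 11 * r))"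

lemma solvedD:
  assumes "solved s"
  shows "feasible I S \<Longrightarrow> \<forall>v\<in>served S. D v (fst (assigned S v)) \<le> r \<Longrightarrow>
      card (served S) \<le> card {v. v < n \<and> fst s ''bk'' v \<noteq> 0}"
    and "quota I \<le> card {v. v < n \<and> fst s ''bk'' v \<noteq> 0} \<Longrightarrow>
      served S' = {v. v < n \<and> fst s ''bk'' v \<noteq> 0} \<Longrightarrow>
      \<forall>u. count (opened S') u = (if u < n then fst s ''cp'' u else 0) \<Longrightarrow>
      \<forall>v\<in>served S'. assigned S' v = (fst s ''fa'' (fst s ''bk'' v - 1), fst s ''ci'' (fst s ''bk'' v - 1)) \<Longrightarrow>
      feasible I S' \<and> solution_value I S' \<le> 11 * r"
  using assms unfolding solved_def by (elim conjE, simp)+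

lemma prepared_ready:
  assumes "inputs I r s" "prepared n s"
  shows "ready s"
  using assms good_less unfolding prepared_def ready_def by blast

end

section \<open>Correctness for one radius\<close>

context packing
begin

lemma solved_blocks:
  fixes s t :: mem
  assumes l: "laid R0 s" and dvd: "\<And>p. sel p \<Longrightarrow> lb I dvd (fst s ''len'' p - R0 p)"
    and od: "ordered (fst s ''order'')"
    and o: "opened_upto (n * n) t"
    and bk0: "\<And>v. v < n \<Longrightarrow> fst t ''bk'' v = layout.block I R0 (fst s ''st'') (fst s ''sp'') v"
    and ca: "fst t ''ca'' = fst s ''ca''" and rm: "fst t ''rm'' = R0" and st: "static t"
  shows "solved (sem insert_surplus t)"
proof -
  interpret l: layout I r m cov pa ro hm R0 "fst s ''st''" "fst s ''sp''" "fst s ''len''" "fst s ''ca''"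
    using l .
  let ?bk0 = "fst t ''bk''" and ?ex = "fst t ''ex''" and ?fa = "fst t ''fa''" and ?ci = "fst t ''ci''" and ?cp = "fst t ''cp''"
  have bk: "v \<in> reach I r \<Longrightarrow> ?bk0 v = l.block v" for v using bk0 reach_less by blast
  have o1: "\<And>b. b < n * n \<Longrightarrow> nonvoid ?bk0 b \<Longrightarrow>
        (\<exists>w\<in>reach I r. ?bk0 w = Suc b \<and> ?fa b = m (hm w) \<and>
          (\<forall>v\<in>reach I r. ?bk0 v = Suc b \<longrightarrow> U (m (hm v)) \<le> U (m (hm w)))) \<and>
        ?ci b < ?cp (?fa b) \<and> ?ex b = U (?fa b) - lb I"
    and o2: "\<And>b. b < n * n \<Longrightarrow> \<not> nonvoid ?bk0 b \<Longrightarrow> ?ex b = 0"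
    and o3: "\<And>b b'. b < n * n \<Longrightarrow> b' < n * n \<Longrightarrow> nonvoid ?bk0 b \<Longrightarrow> nonvoid ?bk0 b' \<Longrightarrow>
        ?fa b = ?fa b' \<Longrightarrow> ?ci b = ?ci b' \<Longrightarrow> b = b'"
    and o4: "\<And>u k. u < n \<Longrightarrow> k < ?cp u \<Longrightarrow> \<exists>b<n * n. nonvoid ?bk0 b \<and> ?fa b = u \<and> ?ci b = k"
    using o unfolding opened_upto_def Let_def by ((elim conjE, simp)+)
  \<comment> \<open>The position in \<open>order\<close> serves as rank, since parents were selected
    before their children.\<close>
  define rk where "rk p = (LEAST k. fst s ''order'' k = Suc p)" for p
  have od1: "\<exists>k<n. fst s ''order'' k = Suc p" if "sel p" for p
    using od that unfolding ordered_def by blast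
  have od4: "\<exists>k'<k. fst s ''order'' k' = Suc (pa i)" if "k < n" "fst s ''order'' k = Suc i" "ro i \<noteq> i" for k i
    using od that unfolding ordered_def by blast
  have rk: "rk p < n \<and> fst s ''order'' (rk p) = Suc p" if p: "sel p" for p
  proof -
    obtain k where k: "k < n" "fst s ''order'' k = Suc p" using od1[OF p] by blast
    then have "rk p \<le> k" unfolding rk_def by (intro Least_le)
    moreover have "fst s ''order'' (rk p) = Suc p" unfolding rk_def using k by (intro LeastI)
    ultimately show ?thesis using k by simp
  qed
  have rk_pa: "rk (pa p) < rk p" if p: "sel p" "ro p \<noteq> p" for p
  proof -
    obtain k where k: "k < rk p" "fst s ''order'' k = Suc (pa p)" using od4 rk[OF p(1)] p(2) by blast
    then have "rk (pa p) \<le> k" unfolding rk_def by (intro Least_le)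
    then show ?thesis using k by simp
  qed
  have cards: "{v \<in> reach I r. ?bk0 v = Suc b} = {v \<in> reach I r. l.block v = Suc b}" for b
    using bk by auto
  have card0: "card {v \<in> reach I r. ?bk0 v = Suc b} = lb I" if nv: "nonvoid ?bk0 b" for b
  proof -
    obtain v where "v \<in> reach I r" "?bk0 v = Suc b" using nv by (auto simp: nonvoid_def)
    then show ?thesis unfolding cards using l.block_card[OF dvd] bk by simp
  qed
  interpret sp: surplus I r m cov pa ro hm "fst s ''ca''" R0 ?bk0 ?ex rk
  proof unfold_locales
    fix p k assume "sel p" "k < lb I"
    then show "fst s ''ca'' (p * n + k) \<in> reach I r \<and> core (fst s ''ca'' (p * n + k)) \<and> hm (fst s ''ca'' (p * n + k)) = p"
      using l.ca_core by blast
  next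
    fix p k k' assume "sel p" "k < lb I" "k' < lb I" "fst s ''ca'' (p * n + k) = fst s ''ca'' (p * n + k')"
    then show "k = k'" using l.ca_inj by blast
  next
    fix v b assume "v \<in> reach I r" "?bk0 v = Suc b"
    then show "sel (b div n) \<and> (hm v = b div n \<or> core v \<and> ro (hm v) \<noteq> hm v \<and> pa (hm v) = b div n)"
      using l.block_star[of v b] bk by simp
  next
    fix v assume v: "v \<in> reach I r"
    have "?bk0 v = 0 \<longleftrightarrow> fst s ''st'' v = 0" using bk[OF v] by (simp add: l.block_def)
    then show "?bk0 v = 0 \<longleftrightarrow> (\<exists>q k. sel q \<and> ro q = q \<and> k < R0 q \<and> v = fst s ''ca'' (q * n + k))"
      using l.st_zero[OF v] by simp
  next
    fix v assume "v < n" "v \<notin> reach I r"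
    then show "?bk0 v = 0" using bk0[of v] l.st_other[of v] by (simp add: l.block_def)
  qed (use l.lo_less card0 o2 rk rk_pa in auto)
  have "sp.frozen t" unfolding sp.frozen_def using st ca by simp
  note pr = sp.sem_insert_surplus[OF this refl rm]
  define t' where "t' = sem insert_surplus t"
  define bk' where "bk' = fst t' ''bk''"
  define rem where "rem = fst t' ''rm''"
  have pr: "sp.progress (n * n) 0 bk' rem" using pr by (simp add: t'_def bk'_def rem_def)
  have fill: "sp.filling bk' rem" by (rule conjunct1[OF pr[unfolded sp.progress_def]])
  have full: "sp.cnt bk' b = lb I + ?ex b \<or> rem (ro (b div n)) = 0" if nv: "nonvoid ?bk0 b" for b
    by (rule mp[OF conjunct1[OF mp[OF spec[OF conjunct2[OF pr[unfolded sp.progress_def]]] nv]]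
          sp.nonvoid_less(1)[OF nv]])
  have nvI: "nonvoid ?bk0 b" if "v \<in> reach I r" "?bk0 v = Suc b" for v b using that by (auto simp: nonvoid_def)
  \<comment> \<open>The memory stores only the facility \<open>fa b = m (loc b)\<close>, from which
    \<open>loc b\<close> cannot be recovered. It is recovered from a member whose home has the
    largest capacity.\<close>
  define rep where "rep b = (SOME w. w \<in> reach I r \<and> ?bk0 w = Suc b \<and> ?fa b = m (hm w) \<and>
          (\<forall>v\<in>reach I r. ?bk0 v = Suc b \<longrightarrow> U (m (hm v)) \<le> U (m (hm w))))" for b
  have rep: "rep b \<in> reach I r \<and> ?bk0 (rep b) = Suc b \<and> ?fa b = m (hm (rep b)) \<and>
          (\<forall>v\<in>reach I r. ?bk0 v = Suc b \<longrightarrow> U (m (hm v)) \<le> U (m (hm (rep b))))" if nv: "nonvoid ?bk0 b" for b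
    unfolding rep_def
    by (rule someI_ex[OF conjunct1[OF o1[OF sp.nonvoid_less(1)[OF nv] nv], unfolded Bex_def]])
  define loc where "loc b = hm (rep b)" for b
  have ex: "lb I + ?ex b = U (m (loc b))" if nv: "nonvoid ?bk0 b" for b
  proof -
    have "lb I \<le> U (m (loc b))"
      using m_lb[of "loc b"] sel_hm[of "rep b"] rep[OF nv] by (auto simp: loc_def sel_def)
    moreover have "?ex b = U (m (loc b)) - lb I"
      using o1[OF sp.nonvoid_less(1)[OF nv] nv] rep[OF nv] by (simp add: loc_def)
    ultimately show ?thesis by simp
  qed
  interpret b: blocks I r m cov pa ro hm "\<lambda>b. b div n" ?bk0 bk' loc
  proof unfold_locales
    fix v b assume v: "v \<in> reach I r" "?bk0 v = Suc b"
    show "sel (b div n) \<and> (hm v = b div n \<or> core v \<and> ro (hm v) \<noteq> hm v \<and> pa (hm v) = b div n)"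
      using sp.star0[OF v] .
    show "card {v \<in> reach I r. ?bk0 v = Suc b} = lb I" using card0[OF nvI[OF v]] .
    show "\<exists>w\<in>reach I r. ?bk0 w = Suc b \<and> loc b = hm w"
      using rep[OF nvI[OF v]] unfolding loc_def by blast
    show "U (m (hm v)) \<le> U (m (loc b))" using rep[OF nvI[OF v]] v unfolding loc_def by blast
    show "lb I \<le> sp.cnt bk' b" using sp.fillingD(5)[OF fill nvI[OF v]] by simp
    show "sp.cnt bk' b \<le> U (m (loc b))"
      using sp.fillingD(5)[OF fill nvI[OF v]] ex[OF nvI[OF v]] by simp
  next
    fix v assume v: "v \<in> reach I r" "?bk0 v = 0"
    show "ro (hm v) = hm v" using l.block_rest[of v] v bk by simp
  next
    fix q assume "sel q"
    moreover have "{v \<in> reach I r. ?bk0 v = 0 \<and> hm v = q} = {v \<in> reach I r. l.block v = 0 \<and> hm v = q}"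
      using bk by auto
    ultimately show "card {v \<in> reach I r. ?bk0 v = 0 \<and> hm v = q} < lb I" using l.rest_card by simp
  next
    fix v b assume v: "v \<in> reach I r" "bk' v = Suc b"
    show "hm v = b div n \<or>
      core v \<and> (ro (hm v) \<noteq> hm v \<and> pa (hm v) = b div n \<or> ro (b div n) \<noteq> b div n \<and> pa (b div n) = hm v)"
      using sp.fillingD(1)[OF fill v] unfolding sp.near_star_def by simp
    show "\<exists>w\<in>reach I r. ?bk0 w = Suc b"
      using sp.fillingD(1)[OF fill v] by (simp add: nonvoid_def)
  next
    fix v w b assume v: "v \<in> reach I r" "bk' v = 0" and w: "w \<in> reach I r" "?bk0 w = Suc b"
      and ro: "ro (b div n) = ro (hm v)"
    obtain q k where q: "sel q" "ro q = q" "k < rem q" "v = fst s ''ca'' (q * n + k)"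
      using sp.fillingD(3)[OF fill v(1)] v(2) by blast
    have "k < lb I" using q sp.fillingD(4)[OF fill q(1,2)] l.lo_less[OF q(1)] by simp
    then have "hm v = q" using sp.ca_core[OF q(1)] q(4) by simp
    \<comment> \<open>An unserved client shows that its tree has not run out of surplus, so a block
      of this tree can only have stopped growing because it is full.\<close>
    then have "rem (ro (b div n)) \<noteq> 0" using ro q by simp
    then show "sp.cnt bk' b = U (m (loc b))" using full[OF nvI[OF w]] ex[OF nvI[OF w]] by simp
  qed
  have served: "{v. v < n \<and> bk' v \<noteq> 0} = {v \<in> reach I r. bk' v \<noteq> 0}"
  proof (rule Collect_cong)
    fix v
    show "v < n \<and> bk' v \<noteq> 0 \<longleftrightarrow> v \<in> reach I r \<and> bk' v \<noteq> 0"
      using sp.fillingD(6)[OF fill, of v] reach_less[of v] by (cases "v \<in> reach I r") auto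
  qed
  have e: "fst t' ''fa'' = ?fa" "fst t' ''ci'' = ?ci" "fst t' ''cp'' = ?cp"
    by (simp_all add: t'_def sem_frame_fst)
  show ?thesis
    unfolding solved_def t'_def[symmetric] e bk'_def[symmetric] served
  proof (intro conjI allI impI)
    fix S assume "feasible I S" "\<forall>v\<in>served S. D v (fst (assigned S v)) \<le> r"
    then show "card (served S) \<le> card {v \<in> reach I r. bk' v \<noteq> 0}"
      by (intro b.served_dominates) auto
  next
    fix S :: "nat solution"
    assume q: "quota I \<le> card {v \<in> reach I r. bk' v \<noteq> 0}"
      and S: "served S = {v \<in> reach I r. bk' v \<noteq> 0}"
        "\<forall>u. count (opened S) u = (if u < n then ?cp u else 0)"
        "\<forall>v\<in>served S. assigned S v = (?fa (bk' v - 1), ?ci (bk' v - 1))"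
    have fa: "?fa b = m (loc b) \<and> ?ci b < count (opened S) (?fa b)" if "v \<in> reach I r" "?bk0 v = Suc b" for v b
    proof -
      note nv = nvI[OF that]
      have f: "?fa b = m (loc b)" using rep[OF nv] by (simp add: loc_def)
      moreover have "m (loc b) < n"
        using sel_points(3)[OF b.sel_loc[OF that]] facility_less by simp
      ultimately show ?thesis using o1[OF sp.nonvoid_less(1)[OF nv] nv] S(2) by simp
    qed
    have inj: "b = b'" if "v \<in> reach I r" "?bk0 v = Suc b" "w \<in> reach I r" "?bk0 w = Suc b'"
        "?fa b = ?fa b'" "?ci b = ?ci b'" for v w b b'
      using o3[OF sp.nonvoid_less(1)[OF nvI[OF that(1,2)]] sp.nonvoid_less(1)[OF nvI[OF that(3,4)]]
          nvI[OF that(1,2)] nvI[OF that(3,4)] that(5,6)] .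
    have surj: "\<exists>v\<in>reach I r. \<exists>b. ?bk0 v = Suc b \<and> ?fa b = u \<and> ?ci b = k" if "k < count (opened S) u" for u k
    proof -
      have "u < n" "k < ?cp u" using that S(2) by (auto split: if_splits)
      from o4[OF this] show ?thesis by (auto simp: nonvoid_def)
    qed
    have as: "assigned S v = (?fa (bk' v - 1), ?ci (bk' v - 1))" if "v \<in> served S" for v
      using bspec[OF S(3) that] .
    have "feasible I S \<and> solution_value I S \<le> 11 * r"
    proof (rule b.feasible_assignment[where fa = ?fa and ci = ?ci and M = "opened S"])
      fix v b assume "v \<in> reach I r" "?bk0 v = Suc b"
      then show "?fa b = m (loc b) \<and> ?ci b < count (opened S) (?fa b)" by (rule fa)
    next
      fix v w b b' assume "v \<in> reach I r" "?bk0 v = Suc b" "w \<in> reach I r" "?bk0 w = Suc b'"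
        "?fa b = ?fa b'" "?ci b = ?ci b'"
      then show "b = b'" by (rule inj)
    next
      fix u k assume "k < count (opened S) u"
      then show "\<exists>v\<in>reach I r. \<exists>b. ?bk0 v = Suc b \<and> ?fa b = u \<and> ?ci b = k" by (rule surj)
    next
      fix v assume "v \<in> served S"
      then show "assigned S v = (?fa (bk' v - 1), ?ci (bk' v - 1))" by (rule as)
    qed (rule q S(1) refl)+
    then show "feasible I S" "solution_value I S \<le> 11 * r" by simp_all
  qed
qed

end

context input
begin

lemma sem_try_radius:
  assumes s: "inputs I r s"
  shows "solved (sem try_radius s)"
proof -
  define s1 where "s1 = sem prepare s"
  define s2 where "s2 = sem select s1"
  define s3 where "s3 = sem find_homes s2"
  define s4 where "s4 = sem push_clients s3"
  define s5 where "s5 = sem pass_up s4"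
  define s6 where "s6 = sem make_blocks s5"
  define s7 where "s7 = sem open_blocks s6"
  have run: "sem try_radius s = sem insert_surplus s7"
    by (simp only: try_radius_def sem.simps s1_def s2_def s3_def s4_def s5_def s6_def s7_def)
  have p1: "prepared n s1" unfolding s1_def by (rule sem_prepare[OF s])
  have i1: "inputs I r s1" unfolding s1_def by (rule inputs_sem[OF s]) simp_all
  have r1: "ready s1" using prepared_ready[OF i1 p1] .
  have r2: "ready s2" unfolding s2_def by (rule ready_sem[OF r1]) simp_all
  have sel2: "selecting n s2"
    unfolding s2_def by (rule sem_select[OF r1]) (use p1 good_less in \<open>auto simp: prepared_def\<close>)
  have pl: "placed s3 v" if "v < n" for v
    unfolding s3_def by (rule sem_find_homes[OF r2 selecting_separated[OF r2 sel2] that])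
  have r3: "ready s3" unfolding s3_def by (rule ready_sem[OF r2]) simp_all
  have sel3: "selecting n s3" using sel2 unfolding selecting_def s3_def by (simp add: sem_frame_fst)
  define m where "m = fst s3 ''m''"
  define cov where "cov = (\<lambda>u. fst s3 ''cov'' u - 1)"
  define pa where "pa = fst s3 ''pa''"
  define ro where "ro = fst s3 ''ro''"
  define hm where "hm = (\<lambda>v. fst s3 ''hm'' v - 1)"
  have "homes I r m cov pa ro hm"
    unfolding m_def cov_def pa_def ro_def hm_def by (rule homes_locale[OF r3 sel3 pl])
  then interpret packing I r m cov pa ro hm by (intro packing.intro input_axioms)
  have chosen_sel: "chosen (fst s3 ''cov'') i \<longleftrightarrow> sel i" for i
    using selecting_clustering(2)[OF r3 sel3, of i] unfolding chosen_by_def sel_def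
    unfolding cov_def by auto
  have st3: "static s3"
    unfolding static_def
  proof (intro conjI allI impI r3 m_def[symmetric] pa_def[symmetric] ro_def[symmetric])
    fix v assume v: "v < n"
    note p = pl[OF v, unfolded placed_def]
    show "if v \<in> reach I r then fst s3 ''hm'' v = Suc (hm v) else fst s3 ''hm'' v = 0"
      using p by (auto simp: hm_def)
    show "(0 < fst s3 ''core'' v) = (v \<in> reach I r \<and> core v)"
      using p unfolding core_def unfolding hm_def by simp
  qed
  have zero: "fst s3 ''len'' u = 0 \<and> fst s3 ''cp'' u = 0" if "u < n" for u
    using p1 that unfolding prepared_def s3_def s2_def by (simp add: sem_frame_fst)
  have pu: "pushed (reach I r) s4"
    unfolding s4_def by (rule sem_push_clients[OF st3]) (use pl zero in \<open>auto simp: placed_def\<close>)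
  have st4: "static s4" unfolding s4_def by (rule static_sem[OF st3]) simp_all
  have "listed n (fst s3 ''cov'') pa ro (fst s3 ''order'')"
    using sel3 unfolding selecting_def pa_def ro_def by blast
  then have od: "ordered (fst s4 ''order'')"
    unfolding listed_def ordered_def chosen_sel s4_def by (simp add: sem_frame_fst)
  note pass = sem_pass_up[OF st4 od pu, folded s5_def]
  have st5: "static s5" unfolding s5_def by (rule static_sem[OF st4]) simp_all
  have od5: "ordered (fst s5 ''order'')" using od unfolding s5_def by (simp add: sem_frame_fst)
  interpret l: layout I r m cov pa ro hm "fst s5 ''rm''" "fst s5 ''st''" "fst s5 ''sp''" "fst s5 ''len''" "fst s5 ''ca''"
    using pass(1) .
  have bk6: "fst s6 ''bk'' v = l.block v" if "v < n" for v
    unfolding s6_def by (rule sem_make_blocks[OF st5 pass(1) that])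
  have st6: "static s6" unfolding s6_def by (rule static_sem[OF st5]) simp_all
  have ok6: "block_ok (fst s6 ''bk'')"
    unfolding block_ok_def
  proof (intro allI impI)
    fix v assume v: "v < n" "fst s6 ''bk'' v \<noteq> 0"
    then have "l.block v \<noteq> 0" using bk6[OF v(1)] by simp
    then have "fst s5 ''st'' v \<noteq> 0" by (metis l.block_def)
    then show "v \<in> reach I r" using l.st_other[OF v(1)] by (metis (full_types))
  qed
  have cp6: "fst s6 ''cp'' u = 0" if "u < n" for u
    using zero[OF that] unfolding s6_def s5_def s4_def by (simp add: sem_frame_fst)
  have op: "opened_upto (n * n) s7" unfolding s7_def by (rule sem_open_blocks[OF st6 ok6 cp6])
  have st7: "static s7" unfolding s7_def by (rule static_sem[OF st6]) simp_all
  show ?thesis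
    unfolding run
  proof (rule solved_blocks[OF pass(1) pass(2) od5 op _ _ _ st7])
    show "fst s7 ''bk'' v = l.block v" if "v < n" for v
      using bk6[OF that] unfolding s7_def by (simp add: sem_frame_fst)
    show "fst s7 ''ca'' = fst s5 ''ca''" "fst s7 ''rm'' = fst s5 ''rm''"
      unfolding s7_def s6_def by (simp_all add: sem_frame_fst)
  qed
qed

end

section \<open>Search over all radii\<close>

lemma count_sum_replicate:
  "finite A \<Longrightarrow> count (\<Sum>u\<in>A. replicate_mset (f u) u) x = (if x \<in> A then f x else 0)"
  by (induction A rule: finite_induct) auto

lemma nwrites_output [simp]:
  "nwrites try_radius = {''u'', ''v'', ''w'', ''c'', ''m'', ''good'', ''cov'', ''near'', ''len'', ''cp'',
     ''t'', ''x'', ''y'', ''order'', ''pa'', ''ro'', ''st'', ''hm'', ''core'', ''q'', ''ca'', ''sp'', ''rm'', ''k'',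
     ''bk'', ''s'', ''i'', ''b'', ''fa'', ''ci'', ''ex'', ''h'', ''j'', ''z''}"
  "nwrites count_served = {''v'', ''c''}"
  "nwrites copy_solution = {''v'', ''served'', ''center'', ''copy'', ''copies''}"
  "nwrites commit = {''v'', ''c'', ''found'', ''served'', ''center'', ''copy'', ''copies''}"
  "rwrites try_radius = {}" "rwrites count_served = {}" "rwrites copy_solution = {}" "rwrites commit = {''best''}"
  unfolding try_radius_def count_served_def copy_solution_def commit_def by auto

text \<open>\<open>A\<close> is the set of the radii that have been tried.\<close>

definition outcome :: "nat supplier \<Rightarrow> real set \<Rightarrow> mem \<Rightarrow> bool" where
  "outcome I A s \<longleftrightarrow>
     (fst s ''found'' 0 \<noteq> 0 \<longrightarrow> feasible I (read_solution I s) \<and>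
        solution_value I (read_solution I s) \<le> 11 * snd s ''best'' 0) \<and>
     (\<forall>\<rho>\<in>A. \<forall>S. feasible I S \<longrightarrow> (\<forall>v\<in>served S. distance I v (fst (assigned S v)) \<le> \<rho>) \<longrightarrow>
        fst s ''found'' 0 \<noteq> 0 \<and> snd s ''best'' 0 \<le> \<rho>)"

lemma read_solution_cong:
  assumes "\<And>x. x \<in> {''served'', ''copies'', ''center'', ''copy''} \<Longrightarrow> fst s x = fst t x"
  shows "read_solution I s = read_solution I t"
  using assms by (simp add: read_solution_def)

lemma outcome_cong:
  assumes "\<And>x. x \<in> {''served'', ''copies'', ''center'', ''copy'', ''found''} \<Longrightarrow> fst s x = fst t x"
    and "snd s ''best'' = snd t ''best''"
  shows "outcome I A s \<longleftrightarrow> outcome I A t"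
proof -
  have "read_solution I s = read_solution I t" using assms by (intro read_solution_cong) auto
  then show ?thesis unfolding outcome_def using assms by simp
qed

context input
begin

lemma sem_count_served:
  assumes s: "fst s ''n'' 0 = n"
  shows "fst (sem count_served s) ''c'' 0 = card {v. v < n \<and> fst s ''bk'' v \<noteq> 0}"
proof -
  let ?l = "PFor ''v'' (PIf (nz (NRead ''bk'' (V ''v''))) (assign ''c'' (succ (V ''c''))) PSkip)"
  define s1 where "s1 = sem (assign ''c'' (NConst 0)) s"
  let ?P = "\<lambda>k t. fst t ''c'' 0 = card {v. v < k \<and> fst s ''bk'' v \<noteq> 0}"
  have "?P (fst s1 ''n'' 0) (sem ?l s1)"
  proof (rule sem_For_invariant[where P = ?P], goal_cases)
    case (3 k t)
    have "fst t ''bk'' = fst s ''bk''" by (simp add: 3 s1_def fst_nwrite)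
    moreover have "{v. v < Suc k \<and> fst s ''bk'' v \<noteq> 0} =
        (if fst s ''bk'' k \<noteq> 0 then insert k {v. v < k \<and> fst s ''bk'' v \<noteq> 0} else {v. v < k \<and> fst s ''bk'' v \<noteq> 0})"
      by (auto simp: less_Suc_eq)
    ultimately show ?case using 3(2,5) by (simp add: fst_nwrite)
  qed (simp_all add: s1_def fst_nwrite)
  then show ?thesis using s by (simp add: count_served_def s1_def fst_nwrite)
qed

lemma sem_copy_solution:
  assumes s: "fst s ''n'' 0 = n" and v: "v < n"
  defines "t \<equiv> sem copy_solution s"
  shows "fst t ''served'' v \<noteq> 0 \<longleftrightarrow> fst s ''bk'' v \<noteq> 0"
    and "fst t ''center'' v = fst s ''fa'' (fst s ''bk'' v - 1)"
    and "fst t ''copy'' v = fst s ''ci'' (fst s ''bk'' v - 1)"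
    and "fst t ''copies'' v = fst s ''cp'' v"
proof -
  let ?P = "\<lambda>k t. \<forall>v<k. (fst t ''served'' v \<noteq> 0 \<longleftrightarrow> fst s ''bk'' v \<noteq> 0) \<and>
    fst t ''center'' v = fst s ''fa'' (fst s ''bk'' v - 1) \<and>
    fst t ''copy'' v = fst s ''ci'' (fst s ''bk'' v - 1) \<and> fst t ''copies'' v = fst s ''cp'' v"
  have "?P (fst s ''n'' 0) t"
    unfolding t_def copy_solution_def
  proof (rule sem_For_invariant[where P = ?P], goal_cases)
    case (3 k u)
    have e: "fst u ''bk'' = fst s ''bk''" "fst u ''fa'' = fst s ''fa''" "fst u ''ci'' = fst s ''ci''"
      "fst u ''cp'' = fst s ''cp''"
      by (simp_all add: 3)
    show ?case using 3(2,5) e by (auto simp: fst_nwrite less_Suc_eq)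
  qed (auto simp: fst_nwrite)
  then have P: "?P n t" using s by simp
  show "fst t ''served'' v \<noteq> 0 \<longleftrightarrow> fst s ''bk'' v \<noteq> 0"
    "fst t ''center'' v = fst s ''fa'' (fst s ''bk'' v - 1)"
    "fst t ''copy'' v = fst s ''ci'' (fst s ''bk'' v - 1)"
    "fst t ''copies'' v = fst s ''cp'' v"
    using P v by blast+
qed

text \<open>If some solution has value at most \<open>r\<close>, then \<open>solved\<close> makes
  the count reach the quota. The radius is then either stored now or rejected because one that is
  not larger is already stored.\<close>

lemma sem_commit:
  assumes n: "fst s ''n'' 0 = n" and p: "fst s ''p'' 0 = quota I" and r: "snd s ''r'' 0 = r"
    and sol: "solved s" and out: "outcome I A s"
  shows "outcome I (insert r A) (sem commit s)"
proof -
  let ?Q = "{v. v < n \<and> fst s ''bk'' v \<noteq> 0}"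
  define s1 where "s1 = sem count_served s"
  define s2 where "s2 = sem (assign ''found'' (NConst 1) ;; PR ''best'' (NConst 0) radius_exp) s1"
  define s3 where "s3 = sem copy_solution s2"
  let ?cond = "Conj (Neg (NLess (V ''c'') (V ''p'')))
    (orb (eqb (V ''found'') (NConst 0)) (RLess radius_exp (RRead ''best'' (NConst 0))))"
  have run: "sem commit s = (if bval ?cond s1 then s3 else s1)"
    by (simp only: commit_def sem.simps s1_def s2_def s3_def)
  have e1: "x \<notin> {''v'', ''c''} \<Longrightarrow> fst s1 x = fst s x" "snd s1 y = snd s y" for x y
    by (simp_all add: s1_def sem_frame_fst sem_frame_snd)
  have c1: "fst s1 ''c'' 0 = card ?Q" unfolding s1_def by (rule sem_count_served[OF n])
  have cond: "bval ?cond s1 \<longleftrightarrow> quota I \<le> card ?Q \<and> (fst s ''found'' 0 = 0 \<or> r < snd s ''best'' 0)"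
    using c1 p r by (simp add: e1 not_less)
  have dom: "card (served S) \<le> card ?Q" if "feasible I S" "\<forall>v\<in>served S. D v (fst (assigned S v)) \<le> r" for S
    using solvedD(1)[OF sol that] .
  show ?thesis
  proof (cases "quota I \<le> card ?Q \<and> (fst s ''found'' 0 = 0 \<or> r < snd s ''best'' 0)")
    case False
    have found: "fst s ''found'' 0 \<noteq> 0 \<and> snd s ''best'' 0 \<le> r"
      if S: "feasible I S" "\<forall>v\<in>served S. D v (fst (assigned S v)) \<le> r" for S
    proof -
      have "quota I \<le> card ?Q" using dom[OF S] S(1)[unfolded feasible_def] by linarith
      then show ?thesis using False by auto
    qed
    have "outcome I (insert r A) s" using out found unfolding outcome_def by simp
    moreover have "outcome I (insert r A) s1 \<longleftrightarrow> outcome I (insert r A) s"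
      by (rule outcome_cong) (auto simp: e1)
    ultimately show ?thesis unfolding run cond if_not_P[OF False] by simp
  next
    case True
    have n2: "fst s2 ''n'' 0 = n" using n by (simp add: s2_def fst_nwrite e1)
    have e2: "fst s2 x = fst s x" if "x \<in> {''bk'', ''fa'', ''ci'', ''cp''}" for x
      using that by (auto simp: s2_def fst_nwrite e1)
    note cs = sem_copy_solution[OF n2, folded s3_def]
    let ?S = "read_solution I s3"
    have fp: "finite (points I)" using fin by (simp add: points_def)
    have S: "served ?S = ?Q" "\<forall>u. count (opened ?S) u = (if u < n then fst s ''cp'' u else 0)"
      "\<forall>v\<in>served ?S. assigned ?S v = (fst s ''fa'' (fst s ''bk'' v - 1), fst s ''ci'' (fst s ''bk'' v - 1))"
      using cs e2 unfolding read_solution_def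
      by (auto simp: points_iff count_sum_replicate[OF fp])
    have fS: "feasible I ?S \<and> solution_value I ?S \<le> 11 * r"
      by (rule solvedD(2)[OF sol conjunct1[OF True] S])
    have f3: "fst s3 ''found'' 0 = 1" "snd s3 ''best'' 0 = r"
      by (simp_all add: s3_def sem_frame_fst sem_frame_snd s2_def fst_nwrite snd_rwrite e1 r)
    have "outcome I (insert r A) s3"
      unfolding outcome_def f3
    proof (intro conjI impI ballI allI)
      show "feasible I ?S" "solution_value I ?S \<le> 11 * r" using fS by blast+
      show "(1::nat) \<noteq> 0" by simp
      fix \<rho> S assume \<rho>: "\<rho> \<in> insert r A" and S: "feasible I S" "\<forall>v\<in>served S. D v (fst (assigned S v)) \<le> \<rho>"
      \<comment> \<open>For a radius tried earlier, the stored one is at most \<open>\<rho>\<close>,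
        and the test of \<open>commit\<close> succeeded only because \<open>r\<close> is smaller
        still.\<close>
      show "r \<le> \<rho>"
      proof (cases "\<rho> = r")
        case False
        then have "fst s ''found'' 0 \<noteq> 0 \<and> snd s ''best'' 0 \<le> \<rho>"
          using \<rho> S out unfolding outcome_def by blast
        then show ?thesis using True by linarith
      qed simp
    qed
    then show ?thesis unfolding run cond if_P[OF True] .
  qed
qed

end

text \<open>The radius cell changes from round to round, so \<open>inputs\<close> is taken at
  whatever it currently contains.\<close>

definition environment :: "nat supplier \<Rightarrow> mem \<Rightarrow> bool" where
  "environment I s \<longleftrightarrow> inputs I (snd s ''r'' 0) s \<and> fst s ''p'' 0 = quota I"

lemma environment_frame:
  assumes "environment I s"
    and "\<And>x. x \<in> {''n'', ''l'', ''client'', ''facility'', ''U'', ''p''} \<Longrightarrow> fst t x = fst s x"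
    and "snd t ''d'' = snd s ''d''"
  shows "environment I t"
  using assms by (simp add: environment_def inputs_def)

lemma input_points: "input_instance I \<Longrightarrow> v \<in> points I \<longleftrightarrow> v < card (points I)"
  unfolding input_instance_def by (metis lessThan_iff)

lemma sem_try_commit:
  assumes I: "input_instance I" and s: "environment I s" and ab: "fst s ''f'' 0 = a" "fst s ''g'' 0 = b"
    "a < card (points I)" "b < card (points I)" and out: "outcome I A s"
  shows "outcome I (insert (distance I a b) A)
    (sem (PR ''r'' (NConst 0) (RRead ''d'' (pair (V ''f'') (V ''g''))) ;; try_radius ;; commit) s)"
proof -
  define \<rho> where "\<rho> = distance I a b"
  define s1 where "s1 = sem (PR ''r'' (NConst 0) (RRead ''d'' (pair (V ''f'') (V ''g'')))) s"
  define s2 where "s2 = sem try_radius s1"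
  note i = inputsD[of I "snd s ''r'' 0" s]
  have si: "inputs I (snd s ''r'' 0) s" "fst s ''p'' 0 = quota I" using s by (auto simp: environment_def)
  have r1: "snd s1 ''r'' 0 = \<rho>"
    using ab inputsD(1,7)[OF si(1)] by (simp add: s1_def snd_rwrite \<rho>_def)
  have e1: "fst s1 = fst s" "x \<noteq> ''r'' \<Longrightarrow> snd s1 x = snd s x" for x by (simp_all add: s1_def snd_rwrite)
  have si1: "inputs I \<rho> s1" using si(1) r1 e1 by (simp add: inputs_def)
  have inst: "supplier_instance I" using I by (simp add: input_instance_def)
  have "a \<in> points I" "b \<in> points I" using ab input_points[OF I] by simp_all
  then have "0 \<le> \<rho>" using inst by (simp add: \<rho>_def supplier_instance_def)
  then interpret input I \<rho> using inst I by unfold_locales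
  have sol: "solved s2" unfolding s2_def by (rule sem_try_radius[OF si1])
  have n2: "fst s2 ''n'' 0 = n" "fst s2 ''p'' 0 = quota I" "snd s2 ''r'' 0 = \<rho>"
    using inputsD(1)[OF si(1)] si(2) r1 e1 by (simp_all add: s2_def sem_frame_fst sem_frame_snd)
  have "outcome I A s2 \<longleftrightarrow> outcome I A s"
    by (rule outcome_cong) (auto simp: s2_def sem_frame_fst sem_frame_snd e1)
  then have "outcome I A s2" using out by simp
  from sem_commit[OF n2 sol this] show ?thesis
    by (simp only: sem.simps s1_def s2_def \<rho>_def)
qed

lemma sem_algorithm:
  assumes I: "input_instance I" and q: "0 < quota I"
  shows "outcome I {distance I a b |a b. a < card (points I) \<and> b < card (points I)}
    (sem algorithm (initial_mem I))"
proof -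
  let ?n = "card (points I)"
  define s where "s = sem (PIf (nz (V ''L'')) (assign ''l'' (V ''L'')) (assign ''l'' (NConst 1))) (initial_mem I)"
  let ?body = "PR ''r'' (NConst 0) (RRead ''d'' (pair (V ''f'') (V ''g''))) ;; try_radius ;; commit"
  have frame: "x \<noteq> ''l'' \<Longrightarrow> fst s x = fst (initial_mem I) x" "snd s = snd (initial_mem I)" for x
    by (simp_all add: s_def fst_nwrite)
  have l: "fst s ''l'' 0 = lb I" by (auto simp: s_def fst_nwrite initial_mem_def Let_def lb_def)
  have env: "environment I s"
  proof -
    have lt: "a * ?n + b < ?n * ?n" if "a < ?n" "b < ?n" for a b
    proof -
      have "a * ?n + b < Suc a * ?n" using that by simp
      also have "\<dots> \<le> ?n * ?n" using that by (intro mult_right_mono) auto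
      finally show ?thesis .
    qed
    show ?thesis
      unfolding environment_def inputs_def using l lt
      by (auto simp: frame initial_mem_def Let_def)
  qed
  have out0: "outcome I {} s"
    unfolding outcome_def by (simp add: frame initial_mem_def Let_def)
  have n: "fst t ''n'' 0 = ?n" if "environment I t" for t
    using that inputsD(1)[of I "snd t ''r'' 0" t] by (simp add: environment_def)
  have "sem algorithm (initial_mem I) = sem (PFor ''f'' (PFor ''g'' ?body)) s"
  proof -
    have "bval (nz (V ''p'')) s" using q frame(1)[of "''p''"] by (simp add: initial_mem_def Let_def)
    then show ?thesis unfolding algorithm_def s_def sem.simps(4,5) by (rule if_P)
  qed
  moreover have "outcome I {distance I a b |a b. a < fst s ''n'' 0 \<and> b < ?n} (sem (PFor ''f'' (PFor ''g'' ?body)) s)"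
  proof (rule sem_For_invariant[where P = "\<lambda>k. outcome I {distance I a b |a b. a < k \<and> b < ?n}"], goal_cases)
    case 1
    show ?case using wf_algorithm by (simp add: algorithm_def)
  next
    case 2
    have "outcome I {distance I a b |a b. a < 0 \<and> b < ?n} (nwrite ''f'' 0 0 s) \<longleftrightarrow>
        outcome I {distance I a b |a b. a < 0 \<and> b < ?n} s"
      by (rule outcome_cong) (auto simp: fst_nwrite)
    then show ?case using out0 by simp
  next
    case (3 k t)
    have t: "environment I t" using env by (rule environment_frame) (auto simp: 3)
    have k: "k < ?n" using 3(1) n[OF env] by simp
    let ?A = "\<lambda>j. {distance I a b |a b. a < k \<and> b < ?n} \<union> {distance I k b |b. b < j}"
    have "outcome I (?A (fst t ''n'' 0)) (sem (PFor ''g'' ?body) t)"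
    proof (rule sem_For_invariant[where P = "\<lambda>j. outcome I (?A j)"], goal_cases)
      case 1
      show ?case using wf_algorithm by (simp add: algorithm_def)
    next
      case 2
      have "outcome I (?A 0) (nwrite ''g'' 0 0 t) \<longleftrightarrow> outcome I (?A 0) t"
        by (rule outcome_cong) (auto simp: fst_nwrite)
      then show ?case using 3(5) by simp
    next
      case h: (3 j u)
      have u: "environment I u" using t by (rule environment_frame) (auto simp: h)
      have j: "j < ?n" using h(1) n[OF t] by simp
      have fk: "fst u ''f'' 0 = k" using h(3)[of "''f''"] 3(2) by simp
      have "?A (Suc j) = insert (distance I k j) (?A j)" by (auto simp: less_Suc_eq)
      then have "outcome I (?A (Suc j)) (sem ?body u)"
        using sem_try_commit[OF I u fk h(2) k j h(5)] by simp
      moreover have "outcome I (?A (Suc j)) (nwrite ''g'' 0 (Suc j) (sem ?body u)) \<longleftrightarrow>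
          outcome I (?A (Suc j)) (sem ?body u)"
        by (rule outcome_cong) (auto simp: fst_nwrite)
      ultimately show ?case by simp
    qed
    moreover have "?A (fst t ''n'' 0) = {distance I a b |a b. a < Suc k \<and> b < ?n}"
      using n[OF t] by (auto simp: less_Suc_eq)
    moreover have "outcome I A (nwrite ''f'' 0 (Suc k) (sem (PFor ''g'' ?body) t)) \<longleftrightarrow>
        outcome I A (sem (PFor ''g'' ?body) t)" for A
      by (rule outcome_cong) (auto simp: fst_nwrite)
    ultimately show ?case by simp
  qed
  ultimately show ?thesis using n[OF env] by simp
qed

section \<open>Comparison with the optimum\<close>

lemma solution_value_attained:
  assumes I: "supplier_instance I" and S: "feasible I S"
  shows "0 \<le> solution_value I S"
    and "v \<in> served S \<Longrightarrow> distance I v (fst (assigned S v)) \<le> solution_value I S"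
    and "served S \<noteq> {} \<Longrightarrow> \<exists>v\<in>points I. \<exists>u\<in>points I. solution_value I S = distance I v u"
proof -
  let ?d = "\<lambda>v. distance I v (fst (assigned S v))"
  have sub: "served S \<subseteq> clients I" using S[unfolded feasible_def, THEN conjunct1] .
  then have fin: "finite (served S)" using I by (auto simp: supplier_instance_def intro: finite_subset)
  have pts: "v \<in> points I \<and> fst (assigned S v) \<in> points I" if "v \<in> served S" for v
  proof -
    obtain u k where uk: "assigned S v = (u, k)" by (cases "assigned S v")
    have "assigned S v \<in> open_copies S" using S that unfolding feasible_def by metis
    then have "0 < count (opened S) u" using uk by (auto simp: open_copies_def simp del: count_greater_zero_iff)
    then have "u \<in># opened S" by (simp only: count_greater_zero_iff)
    moreover have "set_mset (opened S) \<subseteq> facilities I" using S unfolding feasible_def by metis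
    ultimately show ?thesis using sub that uk by (auto simp: points_def)
  qed
  show le: "v \<in> served S \<Longrightarrow> ?d v \<le> solution_value I S" for v
    using fin by (auto simp: solution_value_def)
  show att: "\<exists>v\<in>points I. \<exists>u\<in>points I. solution_value I S = distance I v u" if ne: "served S \<noteq> {}"
  proof -
    have "Max (?d ` served S) \<in> ?d ` served S" using fin ne by (intro Max_in) auto
    then obtain v where "v \<in> served S" "Max (?d ` served S) = ?d v" by auto
    then show ?thesis using pts[of v] ne by (auto simp: solution_value_def)
  qed
  show "0 \<le> solution_value I S"
  proof (cases "served S = {}")
    case True
    then show ?thesis by (simp add: solution_value_def)
  next
    case False
    then show ?thesis using att I by (force simp: supplier_instance_def)
  qed
qed

text \<open>Dividing by \<open>\<rho>\<close> turns the assumption into a lower bound of all values,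
  so only the infimum property is used; no solution attaining the optimum is needed.\<close>

lemma le_optimum:
  assumes "feasible I S" and "\<And>S. feasible I S \<Longrightarrow> x \<le> \<rho> * solution_value I S" and "0 < \<rho>"
  shows "x \<le> \<rho> * optimum I"
proof -
  have "x / \<rho> \<le> optimum I"
    unfolding optimum_def
  proof (rule cINF_greatest)
    fix S assume "S \<in> {S. feasible I S}"
    then show "x / \<rho> \<le> solution_value I S" using assms(2)[of S] assms(3) by (simp add: field_simps)
  qed (use assms(1) in auto)
  then show ?thesis using assms(3) by (simp add: field_simps)
qed

lemma algorithm_correct:
  assumes I: "input_instance I" and S0: "feasible I S0"
  defines "R \<equiv> read_solution I (sem algorithm (initial_mem I))"
  shows "feasible I R \<and> solution_value I R \<le> 11 * optimum I"
proof -
  let ?s = "sem algorithm (initial_mem I)"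
  have inst: "supplier_instance I" using I by (simp add: input_instance_def)
  show ?thesis
  proof (cases "quota I = 0")
    case True
    \<comment> \<open>With quota 0 only \<open>''l''\<close> is written, and the untouched output
      arrays describe the empty solution.\<close>
    have "fst ?s x = fst (initial_mem I) x" if "x \<noteq> ''l''" for x
      using that True by (simp add: algorithm_def fst_nwrite initial_mem_def Let_def)
    then have R: "R = \<lparr>served = {}, opened = {#}, assigned = (\<lambda>v. (0, 0))\<rparr>"
      unfolding R_def read_solution_def by (simp add: initial_mem_def Let_def)
    have "feasible I R" unfolding R feasible_def open_copies_def using True by simp
    moreover have "0 \<le> 11 * optimum I"
      by (rule le_optimum[OF S0]) (use solution_value_attained(1)[OF inst] in auto)
    ultimately show ?thesis by (simp add: R solution_value_def)
  next
    case False
    have out: "outcome I {distance I a b |a b. a < card (points I) \<and> b < card (points I)} ?s"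
      using sem_algorithm[OF I] False by simp
    have best: "fst ?s ''found'' 0 \<noteq> 0 \<and> snd ?s ''best'' 0 \<le> solution_value I S" if S: "feasible I S" for S
    proof -
      have "quota I \<le> card (served S)" using S unfolding feasible_def by metis
      \<comment> \<open>A positive quota forces \<open>S\<close> to serve a client, so its value is
        a distance between two points and hence one of the radii that have been tried.\<close>
      then have "served S \<noteq> {}" using False by auto
      then obtain v u where vu: "v \<in> points I" "u \<in> points I" "solution_value I S = distance I v u"
        using solution_value_attained(3)[OF inst S] by blast
      then have "solution_value I S \<in> {distance I a b |a b. a < card (points I) \<and> b < card (points I)}"
        using input_points[OF I] by blast
      then show ?thesis
        using out S solution_value_attained(2)[OF inst S] unfolding outcome_def by blast
    qed
    then have R: "feasible I R" "solution_value I R \<le> 11 * snd ?s ''best'' 0"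
      using out S0 unfolding outcome_def R_def by blast+
    have "solution_value I R \<le> 11 * optimum I"
    proof (rule le_optimum[OF S0])
      fix S assume "feasible I S"
      from best[OF this] show "solution_value I R \<le> 11 * solution_value I S" using R(2) by linarith
    qed simp
    then show ?thesis using R(1) by simp
  qed
qed

theorem theorem14:
  "\<exists>c. polynomial_time c \<and> approximation_algorithm 11 c"
proof (intro exI conjI)
  show "polynomial_time (compile algorithm)"
    by (rule compile_polynomial_time[OF wf_algorithm])
  show "approximation_algorithm 11 (compile algorithm)"
    unfolding approximation_algorithm_def
    using compile_correct[OF wf_algorithm] algorithm_correct by blast
qed

end
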